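(* Under Assumption (D) there exist $c,c'>0$ and an event $\tilde{\mathcal E}$ with $\mathbb P^n_{\theta_0}(\tilde{\mathcal E})\ge1-c'e^{-cn\delta_n^2}$ on which $$W_2^2\big(\tilde\Pi(\cdot\mid Z^{(n)}),\Pi(\cdot\mid Z^{(n)})\big)\le e^{-n\delta_n^2},$$ where $\tilde\Pi(\cdot\mid Z^{(n)})$ has Lebesgue density $\tilde\pi(\cdot\mid Z^{(n)})$ and $W_2$ is the 2-Wasserstein distance.
   Context: General setting. Let $\Theta\subset\ell^2(\mathbb N)$ contain $\mathbb R^p$ (viewed as sequences vanishing after coordinate $p$); $\|\cdot\|$ is the $\ell^2$/Euclidean norm, $\|\cdot\|_{op}$ the operator norm, $\lambda_{\min}$ the smallest eigenvalue. For $\theta\in\Theta$, $\mathbb P_\theta$ is a law on a measurable space $\mathcal Z$ with density $p_\theta$ w.r.t. a measure $\nu$; data $Z^{(n)}=(Z_i)_{i=1}^n$ have law $\mathbb P^n_\theta=\otimes_{i=1}^n\mathbb P_\theta$. Let $\ell(\theta,z)=\log p_\theta(z)$, $\ell_n(\theta)=\sum_i\ell(\theta,Z_i)$. The prior $\Pi=\Pi_n$ is supported on $\mathbb R^p$ with Lebesgue density $\pi$; the posterior $\Pi(\cdot\mid Z^{(n)})$ has density proportional to $e^{\ell_n(\theta)}\pi(\theta)$. A function $f$ is $m$-strongly concave if $f(\theta')\le f(\theta)+(\theta'-\theta)^\top\nabla f(\theta)-\frac m2\|\theta-\theta'\|^2$ for all $\theta,\theta'$, and has $\Lambda$-Lipschitz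 gradients if $\|\nabla f(\theta)-\nabla f(\theta')\|\le\Lambda\|\theta-\theta'\|$. Assumption (A): the data have law $\mathbb P^n_{\theta_0}$ for a fixed $\theta_0\in\Theta$; there are $c_0>0$, $\theta_{*,p}\in\mathbb R^p$ with $\|\theta_{*,p}\|\le c_0$, and $0<\delta_n\to0$ such that for some $\beta\ge1$, any $c>0$ and any sufficiently large $L$ there are $C_1,\dots,C_4>0$ with $\mathbb P^n_{\theta_0}(\Pi(\{\theta:\|\theta-\theta_{*,p}\|^\beta>L\delta_n\}\mid Z^{(n)})\ge e^{-cn\delta_n^2})\le C_2e^{-C_1n\delta_n^2}$ and $\mathbb P^n_{\theta_0}(\int_{\|\theta-\theta_{*,p}\|\le\delta_n}e^{\ell_n(\theta)-\ell_n(\theta_0)}\pi(\theta)d\theta\le e^{-C_3n\delta_n^2})\le e^{-C_4n\delta_n^2}$. Assumption (B): $\log\pi$ is $m_\pi$-strongly concave with $\Lambda_\pi$-Lipschitz gradients, its maximiser $\theta_{\pi,\max}$ satisfies $\|\theta_{\pi,\max}\|\le c_0$, and the fourth moments of $\Pi$ are bounded uniformly in $n,p$. Assumption (C): there are $0<\eta\le1$, an event $\mathcal E$ with $\mathbb P^n_{\theta_0}(\mathcal E)\ge1-c'e^{-cn\delta_n^2}$ ($c,c'>0$), and $\mathcal B=\{\theta\in\mathbb R^p:\|\theta-\theta_{*,p}\|\le\eta\}$ such that $\ell_n\in C^2(\mathcal B)$ a.s., and for some $c_{\max}\ge c_{\min}>0$, $\kappa_1,\kappa_2,\kappa_3\ge0$,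 on $\mathcal E$: $\|\nabla\ell_n(\theta_{*,p})\|\le c_{\max}n\delta_np^{\kappa_1}$, $\sup_{\theta\in\mathcal B}\|\nabla^2\ell_n(\theta)\|_{op}\le c_{\max}np^{\kappa_2}$, and $\inf_{\theta\in\mathcal B}\lambda_{\min}(-\nabla^2\ell_n(\theta))\ge c_{\min}np^{-\kappa_3}$. Surrogate: fix smooth $v:\mathbb R\to[0,1]$ with $v(t)=1$ for $t\le3/4$, $v(t)=0$ for $t>7/8$, and $\|v\|_{C^2}=\max_{j\le2}\sup|v^{(j)}|$; let $\varphi\ge0$ be smooth, even, supported in $[-1,1]$, $\int\varphi=1$, $\varphi_t(x)=t^{-1}\varphi(x/t)$; $\gamma_\eta(t)=0$ for $t<5\eta/8$, $(t-5\eta/8)^2$ otherwise; $v_\eta=\varphi_{\eta/8}*\gamma_\eta$. For $K>0$, $\theta_{\mathrm{init}}\in\mathbb R^p$: $\tilde\ell_n(\theta)=v(\|\theta-\theta_{\mathrm{init}}\|/\eta)(\ell_n(\theta)-\ell_n(\theta_{\mathrm{init}}))+\ell_n(\theta_{\mathrm{init}})-Kv_\eta(\|\theta-\theta_{\mathrm{init}}\|)$, and $\tilde\pi(\theta\mid Z^{(n)})\propto e^{\tilde\ell_n(\theta)}\pi(\theta)$. Assumption (D): (A), (B), (C) hold, $\|\theta_{\mathrm{init}}-\theta_{*,p}\|\le\eta/8$, and with $\tilde\delta_{n,p}=\max(\delta_n^{1/\beta},\delta_np^{\kappa_1+\kappa_3})$, for some $C>0$: $p\le Cn\delta_n^2$,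 $\eta\ge(\log n)\tilde\delta_{n,p}$, $K\ge60c_{\max}\|v\|_{C^2}n(1+p^{\kappa_2})$. *)

theory Defs
  imports "HOL-Probability.Probability"
begin

typedef l2 = "{x::nat \<Rightarrow> real. summable (\<lambda>i. (x i)\<^sup>2)}" morphisms l2_seq Abs_l2
  by (rule exI[of _ "\<lambda>_. 0"]) simp

setup_lifting type_definition_l2

lemma l2_summable_add:
  fixes x y :: "nat \<Rightarrow> real"
  assumes "summable (\<lambda>i. (x i)\<^sup>2)" "summable (\<lambda>i. (y i)\<^sup>2)"
  shows "summable (\<lambda>i. (x i + y i)\<^sup>2)"
proof (rule summable_comparison_test[where g="\<lambda>i. 2 * (x i)\<^sup>2 + 2 * (y i)\<^sup>2"])
  show "\<exists>N. \<forall>n\<ge>N. norm ((x n + y n)\<^sup>2) \<le> 2 * (x n)\<^sup>2 + 2 * (y n)\<^sup>2"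
    proof (intro exI[of _ 0] allI impI)
    fix n :: nat
    have "0 \<le> (x n - y n)\<^sup>2" by simp
    then have "(x n + y n)\<^sup>2 \<le> 2 * (x n)\<^sup>2 + 2 * (y n)\<^sup>2"
      by (simp add: power2_eq_square algebra_simps)
    then show "norm ((x n + y n)\<^sup>2) \<le> 2 * (x n)\<^sup>2 + 2 * (y n)\<^sup>2"
      by simp
  qed
  show "summable (\<lambda>i. 2 * (x i)\<^sup>2 + 2 * (y i)\<^sup>2)"
    using assms by (intro summable_add summable_mult)
qed

lemma l2_summable_mult:
  fixes x y :: "nat \<Rightarrow> real"
  assumes "summable (\<lambda>i. (x i)\<^sup>2)" "summable (\<lambda>i. (y i)\<^sup>2)"
  shows "summable (\<lambda>i. x i * y i)"
proof (rule summable_comparison_test[where g="\<lambda>i. (x i)\<^sup>2 + (y i)\<^sup>2"])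
  show "\<exists>N. \<forall>n\<ge>N. norm (x n * y n) \<le> (x n)\<^sup>2 + (y n)\<^sup>2"
    proof (intro exI[of _ 0] allI impI)
    fix n :: nat
    have "0 \<le> (\<bar>x n\<bar> - \<bar>y n\<bar>)\<^sup>2" by simp
    then have "2 * (\<bar>x n\<bar> * \<bar>y n\<bar>) \<le> \<bar>x n\<bar>\<^sup>2 + \<bar>y n\<bar>\<^sup>2"
      by (simp add: power2_eq_square algebra_simps)
    moreover have "0 \<le> \<bar>x n\<bar> * \<bar>y n\<bar>" by simp
    ultimately have "\<bar>x n\<bar> * \<bar>y n\<bar> \<le> \<bar>x n\<bar>\<^sup>2 + \<bar>y n\<bar>\<^sup>2"
      by linarith
    then show "norm (x n * y n) \<le> (x n)\<^sup>2 + (y n)\<^sup>2"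
      by (simp add: abs_mult)
  qed
  show "summable (\<lambda>i. (x i)\<^sup>2 + (y i)\<^sup>2)"
    using assms by (intro summable_add)
qed

instantiation l2 :: real_vector
begin
lift_definition zero_l2 :: l2 is "\<lambda>_. 0" by simp
lift_definition plus_l2 :: "l2 \<Rightarrow> l2 \<Rightarrow> l2" is "\<lambda>x y i. x i + y i"
  by (rule l2_summable_add)
lift_definition uminus_l2 :: "l2 \<Rightarrow> l2" is "\<lambda>x i. - x i" by simp
lift_definition minus_l2 :: "l2 \<Rightarrow> l2 \<Rightarrow> l2" is "\<lambda>x y i. x i - y i"
proof -
  fix x y :: "nat \<Rightarrow> real"
  assume "summable (\<lambda>i. (x i)\<^sup>2)" "summable (\<lambda>i. (y i)\<^sup>2)"
  then have "summable (\<lambda>i. (x i + - y i)\<^sup>2)" by (intro l2_summable_add) simp_all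
  then show "summable (\<lambda>i. (x i - y i)\<^sup>2)" by simp
qed
lift_definition scaleR_l2 :: "real \<Rightarrow> l2 \<Rightarrow> l2" is "\<lambda>c x i. c * x i"
  by (simp add: power_mult_distrib summable_mult)
instance
proof
  fix a b c :: l2 and r s :: real
  show "a + b + c = a + (b + c)" by transfer (simp add: add.assoc)
  show "a + b = b + a" by transfer (simp add: add.commute)
  show "0 + a = a" by transfer simp
  show "- a + a = 0" by transfer simp
  show "a - b = a + - b" by transfer simp
  show "r *\<^sub>R (a + b) = r *\<^sub>R a + r *\<^sub>R b" by transfer (simp add: distrib_left)
  show "(r + s) *\<^sub>R a = r *\<^sub>R a + s *\<^sub>R a" by transfer (simp add: distrib_right)
  show "r *\<^sub>R s *\<^sub>R a = (r * s) *\<^sub>R a" by transfer (simp add: mult.assoc)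
  show "1 *\<^sub>R a = a" by transfer simp
qed
end

instantiation l2 :: real_inner
begin
lift_definition inner_l2 :: "l2 \<Rightarrow> l2 \<Rightarrow> real" is "\<lambda>x y. \<Sum>i. x i * y i" .
definition norm_l2 :: "l2 \<Rightarrow> real" where "norm_l2 x = sqrt (inner x x)"
definition dist_l2 :: "l2 \<Rightarrow> l2 \<Rightarrow> real" where "dist_l2 x y = norm (x - y)"
definition sgn_l2 :: "l2 \<Rightarrow> l2" where "sgn_l2 x = x /\<^sub>R norm x"
definition uniformity_l2 :: "(l2 \<times> l2) filter"
  where "uniformity_l2 = (INF e\<in>{0<..}. principal {(x, y). dist x y < e})"
definition open_l2 :: "l2 set \<Rightarrow> bool"
  where "open_l2 U = (\<forall>x\<in>U. \<forall>\<^sub>F (x', y) in uniformity. x' = x \<longrightarrow> y \<in> U)"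
instance
proof
  fix x y z :: l2 and r :: real
  show "inner x y = inner y x" by transfer (simp add: mult.commute)
  show "inner (x + y) z = inner x z + inner y z"
    by transfer (simp add: distrib_right suminf_add[symmetric] l2_summable_mult)
  show "inner (r *\<^sub>R x) y = r * inner x y"
    by transfer (simp add: mult.assoc suminf_mult l2_summable_mult)
  show "0 \<le> inner x x" by transfer (auto intro!: suminf_nonneg simp: power2_eq_square)
  show "inner x x = 0 \<longleftrightarrow> x = 0"
  proof transfer
    fix x :: "nat \<Rightarrow> real" assume s: "summable (\<lambda>i. (x i)\<^sup>2)"
    then have s': "summable (\<lambda>i. x i * x i)" by (simp add: power2_eq_square)
    show "((\<Sum>i. x i * x i) = 0) = (x = (\<lambda>_. 0))"
      using suminf_eq_zero_iff[OF s'] by (simp add: fun_eq_iff)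
  qed
  show "norm x = sqrt (inner x x)" by (simp add: norm_l2_def)
qed (fact dist_l2_def sgn_l2_def uniformity_l2_def open_l2_def)+
end


definition Rp :: "nat \<Rightarrow> l2 set" where
  "Rp p = {x. \<forall>i\<ge>p. l2_seq x i = 0}"

definition embRp :: "nat \<Rightarrow> (nat \<Rightarrow> real) \<Rightarrow> l2" where
  "embRp p x = Abs_l2 (\<lambda>i. if i < p then x i else 0)"

text \<open>Lebesgue measure on R^p (a measure on the Borel sets of l2, concentrated on R^p).\<close>
definition lebRp :: "nat \<Rightarrow> l2 measure" where
  "lebRp p = distr (PiM {..<p} (\<lambda>_. lborel)) borel (embRp p)"

definition data_law :: "'z measure \<Rightarrow> (l2 \<Rightarrow> 'z \<Rightarrow> real) \<Rightarrow> l2 \<Rightarrow> nat \<Rightarrow> (nat \<Rightarrow> 'z) measure" where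
  "data_law \<nu> dens \<theta> n = PiM {..<n} (\<lambda>_. density \<nu> (\<lambda>z. ennreal (dens \<theta> z)))"

definition loglik :: "(l2 \<Rightarrow> 'z \<Rightarrow> real) \<Rightarrow> nat \<Rightarrow> (nat \<Rightarrow> 'z) \<Rightarrow> l2 \<Rightarrow> real" where
  "loglik dens n Z \<theta> = (\<Sum>i<n. ln (dens \<theta> (Z i)))"

definition gibbs :: "nat \<Rightarrow> (l2 \<Rightarrow> real) \<Rightarrow> (l2 \<Rightarrow> real) \<Rightarrow> l2 measure" where
  "gibbs p prior f = density (lebRp p)
     (\<lambda>\<theta>. ennreal (exp (f \<theta>) * prior \<theta>) / (\<integral>\<^sup>+\<theta>'. ennreal (exp (f \<theta>') * prior \<theta>') \<partial>lebRp p))"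

text \<open>Outer probability bound: P(S) <= b for a possibly non-measurable event S.\<close>
definition outer_prob_le :: "'a measure \<Rightarrow> 'a set \<Rightarrow> real \<Rightarrow> bool" where
  "outer_prob_le M S b \<longleftrightarrow> (\<exists>A\<in>sets M. S \<inter> space M \<subseteq> A \<and> measure M A \<le> b)"

definition couplings :: "l2 measure \<Rightarrow> l2 measure \<Rightarrow> (l2 \<times> l2) measure set" where
  "couplings \<mu> \<mu>' = {\<gamma>. sets \<gamma> = sets (borel \<Otimes>\<^sub>M borel) \<and>
      distr \<gamma> borel fst = \<mu> \<and> distr \<gamma> borel snd = \<mu>'}"

definition W2sq :: "l2 measure \<Rightarrow> l2 measure \<Rightarrow> ennreal" where
  "W2sq \<mu> \<mu>' = (INF \<gamma>\<in>couplings \<mu> \<mu>'. \<integral>\<^sup>+xy. ennreal ((norm (fst xy - snd xy))\<^sup>2) \<partial>\<gamma>)"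

definition has_grad_on :: "nat \<Rightarrow> l2 set \<Rightarrow> (l2 \<Rightarrow> real) \<Rightarrow> (l2 \<Rightarrow> l2) \<Rightarrow> bool" where
  "has_grad_on p S f G \<longleftrightarrow>
     (\<forall>\<theta>\<in>S. G \<theta> \<in> Rp p \<and> (f has_derivative (\<lambda>h. inner (G \<theta>) h)) (at \<theta> within S))"

definition C2_grad_hess :: "nat \<Rightarrow> l2 set \<Rightarrow> (l2 \<Rightarrow> real) \<Rightarrow> (l2 \<Rightarrow> l2) \<Rightarrow> (l2 \<Rightarrow> l2 \<Rightarrow> l2) \<Rightarrow> bool" where
  "C2_grad_hess p S f G H \<longleftrightarrow> has_grad_on p S f G \<and>
     (\<forall>\<theta>\<in>S. (G has_derivative H \<theta>) (at \<theta> within S)) \<and>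
     (\<forall>h\<in>Rp p. continuous_on S (\<lambda>\<theta>. H \<theta> h))"

definition C2_on :: "nat \<Rightarrow> l2 set \<Rightarrow> (l2 \<Rightarrow> real) \<Rightarrow> bool" where
  "C2_on p S f \<longleftrightarrow> (\<exists>G H. C2_grad_hess p S f G H)"

definition opnorm_Rp :: "nat \<Rightarrow> (l2 \<Rightarrow> l2) \<Rightarrow> real" where
  "opnorm_Rp p A = (SUP h\<in>{h\<in>Rp p. norm h = 1}. norm (A h))"

definition lam_min_Rp :: "nat \<Rightarrow> (l2 \<Rightarrow> l2) \<Rightarrow> real" where
  "lam_min_Rp p A = Inf {r. \<exists>h\<in>Rp p. h \<noteq> 0 \<and> A h = r *\<^sub>R h}"

definition strongly_concave_Rp :: "nat \<Rightarrow> real \<Rightarrow> (l2 \<Rightarrow> real) \<Rightarrow> bool" where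
  "strongly_concave_Rp p m f \<longleftrightarrow> (\<exists>G. has_grad_on p (Rp p) f G \<and>
     (\<forall>\<theta>\<in>Rp p. \<forall>\<theta>'\<in>Rp p. f \<theta>' \<le> f \<theta> + inner (\<theta>' - \<theta>) (G \<theta>) - m / 2 * (norm (\<theta> - \<theta>'))\<^sup>2))"

definition lipschitz_grad_Rp :: "nat \<Rightarrow> real \<Rightarrow> (l2 \<Rightarrow> real) \<Rightarrow> bool" where
  "lipschitz_grad_Rp p L f \<longleftrightarrow> (\<exists>G. has_grad_on p (Rp p) f G \<and>
     (\<forall>\<theta>\<in>Rp p. \<forall>\<theta>'\<in>Rp p. norm (G \<theta> - G \<theta>') \<le> L * norm (\<theta> - \<theta>')))"

definition smooth_fun :: "(real \<Rightarrow> real) \<Rightarrow> bool" where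
  "smooth_fun f \<longleftrightarrow> (\<forall>k x. ((deriv ^^ k) f has_real_derivative (deriv ^^ Suc k) f x) (at x))"

definition C2norm :: "(real \<Rightarrow> real) \<Rightarrow> real" where
  "C2norm v = Max ((\<lambda>j. SUP t. \<bar>(deriv ^^ j) v t\<bar>) ` {..2::nat})"

definition cutoff_fun :: "(real \<Rightarrow> real) \<Rightarrow> bool" where
  "cutoff_fun v \<longleftrightarrow> smooth_fun v \<and> (\<forall>t. 0 \<le> v t \<and> v t \<le> 1) \<and>
     (\<forall>t. t \<le> 3/4 \<longrightarrow> v t = 1) \<and> (\<forall>t. t > 7/8 \<longrightarrow> v t = 0)"

definition mollifier :: "(real \<Rightarrow> real) \<Rightarrow> bool" where
  "mollifier \<phi> \<longleftrightarrow> smooth_fun \<phi> \<and> (\<forall>x. 0 \<le> \<phi> x) \<and> (\<forall>x. \<phi> (- x) = \<phi> x) \<and>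
     (\<forall>x. \<bar>x\<bar> > 1 \<longrightarrow> \<phi> x = 0) \<and> (\<integral>x. \<phi> x \<partial>lborel) = 1"

definition phi_t :: "(real \<Rightarrow> real) \<Rightarrow> real \<Rightarrow> real \<Rightarrow> real" where
  "phi_t \<phi> t x = \<phi> (x / t) / t"

definition gamma_eta :: "real \<Rightarrow> real \<Rightarrow> real" where
  "gamma_eta \<eta> t = (if t < 5 * \<eta> / 8 then 0 else (t - 5 * \<eta> / 8)\<^sup>2)"

definition v_eta :: "(real \<Rightarrow> real) \<Rightarrow> real \<Rightarrow> real \<Rightarrow> real" where
  "v_eta \<phi> \<eta> t = (\<integral>s. phi_t \<phi> (\<eta> / 8) (t - s) * gamma_eta \<eta> s \<partial>lborel)"

definition ltilde :: "(real \<Rightarrow> real) \<Rightarrow> (real \<Rightarrow> real) \<Rightarrow> real \<Rightarrow> real \<Rightarrow> l2 \<Rightarrow> (l2 \<Rightarrow> real) \<Rightarrow> l2 \<Rightarrow> real" where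
  "ltilde v \<phi> \<eta> K \<theta>init ll \<theta> =
     v (norm (\<theta> - \<theta>init) / \<eta>) * (ll \<theta> - ll \<theta>init) + ll \<theta>init - K * v_eta \<phi> \<eta> (norm (\<theta> - \<theta>init))"

definition delta_tilde :: "real \<Rightarrow> real \<Rightarrow> nat \<Rightarrow> real \<Rightarrow> real \<Rightarrow> real" where
  "delta_tilde \<beta> \<delta> p \<kappa>1 \<kappa>3 = max (\<delta> powr (1 / \<beta>)) (\<delta> * real p powr (\<kappa>1 + \<kappa>3))"

definition ballRp :: "nat \<Rightarrow> l2 \<Rightarrow> real \<Rightarrow> l2 set" where
  "ballRp p c r = {\<theta>\<in>Rp p. norm (\<theta> - c) \<le> r}"

end

(* Both posteriors are densities relative to the prior, and they are proportional on the ball B of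
   radius eta/2 around theta_init, where the surrogate equals the log-likelihood.  Couple them by
   keeping their common mass on B on the diagonal and coupling the remainders independently; this
   bounds the squared Wasserstein distance by second moments of the two remainders.  For the true
   posterior, posterior contraction and Cauchy-Schwarz (in the form 1 + r^2 <= eps (1 + r^4) + 1/eps)
   suffice, the fourth moment and the likelihood ratio at theta_star being controlled by Markov's
   inequality, as likelihood ratios have expectation 1.  For the surrogate, strong concavity on the
   ball around theta_star and the penalty K v_eta outside of it make exp(ltilde - ell(theta_star)) smaller
   than any fixed power of exp(- n delta^2) off B, since eta exceeds the critical radius by log n. *)

theory Submission
  imports Defs
begin

subsection \<open>The sequence space and its coordinate subspaces\<close>

text \<open>\<open>lam_min_Rp\<close> is an infimum over eigenvalues, and \<open>H\<close> is merely
  a derivative within a ball of R^p. The curvature hypothesis therefore says nothing about quadratic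
  forms until \<open>H\<close> is known to be symmetric and to map R^p into itself. The exponents
  come from one budget, with x = n delta^2 and likelihoods normalised at the true parameter. The
  evidence is at least exp(-C3 x), so both remainders must be of order exp(-(C3+3) x) to leave
  exp(-3x) after division; of this, exp(-2x) is the reserve for constants. Cauchy-Schwarz halves the
  contraction exponent, hence the level 2 C3 + 8. Strong concavity compares with the likelihood at
  theta_star instead of the true parameter, and the ratio between the two costs a further factor
  exp(x). The target holds for every n although n delta^2 need not tend to infinity: where it is
  small, an empty event and a large c' satisfy the claim.\<close>

lift_definition unit_l2 :: "nat \<Rightarrow> l2" is "\<lambda>i j. if j = i then 1 else 0"
proof -
  fix i :: nat
  have "(\<lambda>j. ((if j = i then 1 else 0)::real)\<^sup>2) = (\<lambda>j. if j = i then 1 else 0)" by auto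
  then show "summable (\<lambda>j. ((if j = i then 1 else 0)::real)\<^sup>2)" by simp
qed

lemma inner_unit_l2: "inner x (unit_l2 i) = l2_seq x i"
proof transfer
  fix x :: "nat \<Rightarrow> real" and i
  have "(\<lambda>j. x j * (if j = i then 1 else 0)) = (\<lambda>j. if j = i then x j else 0)" by auto
  then show "(\<Sum>j. x j * (if j = i then 1 else 0)) = x i"
    using sums_single[of i x] by (simp add: sums_unique[symmetric])
qed

lemma l2_eqI: "(\<And>i. l2_seq x i = l2_seq y i) \<Longrightarrow> x = y"
  by (metis l2_seq_inject ext)

lemma l2_seq_unit [simp]: "l2_seq (unit_l2 i) j = (if j = i then 1 else 0)"
  by transfer simp

lemma norm_unit_l2 [simp]: "norm (unit_l2 i) = 1"
  by (simp add: norm_eq_1 inner_unit_l2)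

lemma l2_seq_add [simp]: "l2_seq (x + y) i = l2_seq x i + l2_seq y i"
  by transfer simp

lemma l2_seq_diff [simp]: "l2_seq (x - y) i = l2_seq x i - l2_seq y i"
  by transfer simp

lemma l2_seq_scaleR [simp]: "l2_seq (c *\<^sub>R x) i = c * l2_seq x i"
  by transfer simp

lemma l2_seq_zero [simp]: "l2_seq 0 i = 0"
  by transfer simp

lemma l2_seq_sum: "l2_seq (\<Sum>j\<in>A. f j) i = (\<Sum>j\<in>A. l2_seq (f j) i)"
  by (simp flip: inner_unit_l2 add: inner_sum_left)

lemma l2_seq_partial_sum:
  "l2_seq (\<Sum>j<N. a j *\<^sub>R unit_l2 j) i = (if i < N then a i else 0)"
proof -
  have "l2_seq (\<Sum>j<N. a j *\<^sub>R unit_l2 j) i = (\<Sum>j<N. if j = i then a j else 0)"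
    unfolding l2_seq_sum by (intro sum.cong) auto
  then show ?thesis by simp
qed

text \<open>Replaces the abstraction function by a finite linear combination, from which membership
  in \<open>Rp\<close> and measurability of \<open>embRp\<close> follow by generic rules.\<close>

lemma embRp_eq_sum: "embRp p x = (\<Sum>i<p. x i *\<^sub>R unit_l2 i)"
proof (rule l2_eqI)
  fix i
  have s: "summable (\<lambda>i. (if i < p then x i else 0)\<^sup>2)"
    by (rule summable_finite[of "{..<p}"]) auto
  show "l2_seq (embRp p x) i = l2_seq (\<Sum>i<p. x i *\<^sub>R unit_l2 i) i"
    unfolding l2_seq_partial_sum embRp_def using s by (subst Abs_l2_inverse) auto
qed

lemma embRp_in_Rp: "embRp p x \<in> Rp p"
  by (simp add: embRp_eq_sum Rp_def l2_seq_partial_sum)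

lemma subspace_Rp: "subspace (Rp p)"
  by (auto simp: subspace_def Rp_def)

lemma closed_Rp: "closed (Rp p)"
proof -
  have "Rp p = (\<Inter>i\<in>{p..}. {x. inner x (unit_l2 i) = 0})"
    by (auto simp: Rp_def inner_unit_l2)
  moreover have "closed {x. inner x (unit_l2 i) = 0}" for i
    by (intro closed_Collect_eq continuous_intros)
  ultimately show ?thesis by auto
qed

text \<open>Closed balls of l2 itself are not compact, so the dimension must enter: splitting off
  coordinate \<open>p\<close> exhibits the ball of R^(p+1) as a closed subset of the continuous
  image of a compact product. Compactness later lets a quadratic form attain its minimum on the unit
  sphere.\<close>

lemma compact_Rp_cball: "compact {x \<in> Rp p. norm x \<le> r}"
proof (induction p)
  case 0
  have "{x \<in> Rp 0. norm x \<le> r} \<subseteq> {0}"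
    by (auto simp: Rp_def intro!: l2_eqI)
  then show ?case using finite_imp_compact finite_subset by blast
next
  case (Suc p)
  let ?f = "\<lambda>(x, t). x + t *\<^sub>R unit_l2 p"
  let ?C = "{x \<in> Rp p. norm x \<le> r} \<times> {-r..r}"
  have "compact (?f ` ?C)"
    by (intro compact_continuous_image compact_Times Suc)
      (auto simp: case_prod_unfold intro!: continuous_intros)
  moreover have "{x \<in> Rp (Suc p). norm x \<le> r} \<subseteq> ?f ` ?C"
  proof
    fix x assume x: "x \<in> {x \<in> Rp (Suc p). norm x \<le> r}"
    define t where "t = l2_seq x p"
    define y where "y = x - t *\<^sub>R unit_l2 p"
    have "\<bar>t\<bar> \<le> norm x"
      using Cauchy_Schwarz_ineq2[of x "unit_l2 p"] by (simp add: t_def inner_unit_l2)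
    moreover have "y \<in> Rp p"
      using x by (auto simp: y_def Rp_def t_def not_less_eq_eq Suc_le_eq)
    \<comment> \<open>Removing a coordinate is an orthogonal projection.\<close>
    moreover have "norm y \<le> norm x"
    proof -
      have "(norm x)\<^sup>2 = (norm (y + t *\<^sub>R unit_l2 p))\<^sup>2" by (simp add: y_def)
      also have "\<dots> = (norm y)\<^sup>2 + t\<^sup>2 + 2 * t * inner y (unit_l2 p)"
        using power2_norm_eq_inner[of "unit_l2 p"]
        by (simp add: power2_norm_eq_inner inner_add_left inner_add_right
            inner_commute[of "unit_l2 p" y]) (simp add: power2_eq_square algebra_simps)
      also have "inner y (unit_l2 p) = 0" by (simp add: inner_unit_l2 y_def t_def)
      finally have "(norm y)\<^sup>2 \<le> (norm x)\<^sup>2" by simp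
      then show ?thesis by simp
    qed
    ultimately have "(y, t) \<in> ?C" using x by auto
    moreover have "x = ?f (y, t)" by (simp add: y_def)
    ultimately show "x \<in> ?f ` ?C" by blast
  qed
  moreover have "closed {x \<in> Rp (Suc p). norm x \<le> r}"
  proof -
    have "{x \<in> Rp (Suc p). norm x \<le> r} = Rp (Suc p) \<inter> cball 0 r" by auto
    then show ?thesis using closed_Rp by auto
  qed
  ultimately show ?case
    using closed_Int_compact by (metis (no_types, lifting) inf.absorb1)
qed

lemma norm_l2_tail:
  "(norm (x - (\<Sum>i<N. l2_seq x i *\<^sub>R unit_l2 i)))\<^sup>2 = (\<Sum>i. (l2_seq x (i + N))\<^sup>2)"
proof -
  let ?y = "x - (\<Sum>i<N. l2_seq x i *\<^sub>R unit_l2 i)"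
  have "(norm ?y)\<^sup>2 = (\<Sum>i. (l2_seq ?y i)\<^sup>2)"
    unfolding power2_norm_eq_inner inner_l2.rep_eq by (simp add: power2_eq_square)
  also have "\<dots> = (\<Sum>i. (l2_seq ?y (i + N))\<^sup>2) + (\<Sum>i<N. (l2_seq ?y i)\<^sup>2)"
    using l2_seq[of ?y] by (intro suminf_split_initial_segment) simp
  finally show ?thesis by (simp add: l2_seq_partial_sum)
qed

section \<open>Separability of the sequence space\<close>

definition rat_l2 :: "rat list \<Rightarrow> l2" where
  "rat_l2 qs = (\<Sum>i<length qs. of_rat (qs ! i) *\<^sub>R unit_l2 i)"

text \<open>Half of \<open>e\<close> pays for truncating \<open>x\<close> after \<open>N\<close>
  coordinates, the other half for rounding the remaining ones to rationals.\<close>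

lemma rat_l2_dense:
  fixes x :: l2
  assumes "0 < e"
  shows "\<exists>qs. dist (rat_l2 qs) x < e"
proof -
  have s: "summable (\<lambda>i. (l2_seq x i)\<^sup>2)" using l2_seq[of x] by simp
  have r: "0 < (e/2)\<^sup>2" using assms by simp
  obtain N where N: "norm (\<Sum>i. (l2_seq x (i + N))\<^sup>2) < (e/2)\<^sup>2"
    using suminf_exist_split[OF r s] by blast
  let ?t = "\<Sum>i<N. l2_seq x i *\<^sub>R unit_l2 i"
  have 1: "norm (x - ?t) < e/2"
  proof (rule power2_less_imp_less)
    have "(norm (x - ?t))\<^sup>2 = (\<Sum>i. (l2_seq x (i + N))\<^sup>2)" by (rule norm_l2_tail)
    also have "\<dots> \<le> norm (\<Sum>i. (l2_seq x (i + N))\<^sup>2)" unfolding real_norm_def by (rule abs_ge_self)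
    also note N
    finally show "(norm (x - ?t))\<^sup>2 < (e/2)\<^sup>2" .
  qed (use assms in simp)
  \<comment> \<open>With \<open>N + 1\<close> in place of \<open>N\<close>, \<open>d\<close> is
    positive and the \<open>N\<close> rounding errors add up to strictly less than
    \<open>e / 2\<close>, even for \<open>N = 0\<close>.\<close>
  define d where "d = e / (2 * (real N + 1))"
  have d: "0 < d" using assms by (simp add: d_def)
  have "\<exists>q. \<bar>of_rat q - l2_seq x i\<bar> < d" for i
  proof -
    obtain q where "l2_seq x i < of_rat q" "of_rat q < l2_seq x i + d"
      using of_rat_dense[of "l2_seq x i" "l2_seq x i + d"] d by auto
    then show ?thesis by (intro exI[of _ q]) auto
  qed
  then obtain q where q: "\<And>i. \<bar>of_rat (q i) - l2_seq x i\<bar> < d" by metis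
  have "norm (rat_l2 (map q [0..<N]) - ?t) = norm (\<Sum>i<N. (of_rat (q i) - l2_seq x i) *\<^sub>R unit_l2 i)"
    by (simp add: rat_l2_def sum_subtractf scaleR_diff_left)
  also have "\<dots> \<le> (\<Sum>i<N. d)"
    by (intro sum_norm_le) (use q in \<open>auto simp: less_imp_le\<close>)
  also have "\<dots> < e / 2"
    using assms by (simp add: d_def field_simps)
  finally have "dist (rat_l2 (map q [0..<N])) x < e"
    using 1 norm_triangle_ineq4[of "rat_l2 (map q [0..<N]) - ?t" "x - ?t"] by (simp add: dist_norm)
  then show ?thesis ..
qed

text \<open>Makes the Borel sets of a product agree with the product of the Borel sets, so that sums
  and distances of l2 vectors are measurable in the pair.\<close>

instance l2 :: second_countable_topology
proof
  let ?B = "(\<lambda>(qs, k). ball (rat_l2 qs) (inverse (real (Suc k)))) ` (UNIV :: (rat list \<times> nat) set)"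
  have "topological_basis ?B"
  proof (rule topological_basisI)
    fix O' :: "l2 set" and x assume "open O'" "x \<in> O'"
    then obtain e where e: "0 < e" "ball x e \<subseteq> O'" by (meson open_contains_ball)
    obtain k where k: "inverse (real (Suc k)) < e / 2"
      using reals_Archimedean[of "e/2"] e by auto
    obtain qs where qs: "dist (rat_l2 qs) x < inverse (real (Suc k))"
      using rat_l2_dense[of "inverse (real (Suc k))" x] by auto
    have "ball (rat_l2 qs) (inverse (real (Suc k))) \<subseteq> ball x e"
    proof
      fix y assume "y \<in> ball (rat_l2 qs) (inverse (real (Suc k)))"
      then have "dist x y \<le> dist (rat_l2 qs) x + dist (rat_l2 qs) y" "dist (rat_l2 qs) y < inverse (real (Suc k))"
        by (auto intro: dist_triangle3)
      then show "y \<in> ball x e" using qs k by auto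
    qed
    then show "\<exists>B'\<in>?B. x \<in> B' \<and> B' \<subseteq> O'"
      using qs e by (intro bexI[of _ "ball (rat_l2 qs) (inverse (real (Suc k)))"]) (auto intro!: image_eqI[of _ _ "(qs, k)"])
  qed auto
  moreover have "countable ?B" by simp
  ultimately show "\<exists>B::l2 set set. countable B \<and> open = generate_topology B"
    using topological_basis_imp_subbasis by blast
qed

section \<open>Lebesgue measure on R^p\<close>

lemma measurable_embRp [measurable]: "embRp p \<in> PiM {..<p} (\<lambda>_. lborel) \<rightarrow>\<^sub>M borel"
proof -
  have "(\<lambda>x. \<Sum>i<p. x i *\<^sub>R unit_l2 i) \<in> PiM {..<p} (\<lambda>_. lborel) \<rightarrow>\<^sub>M borel"
    by measurable
  then show ?thesis by (simp add: embRp_eq_sum[abs_def])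
qed

lemma sets_lebRp [simp, measurable_cong]: "sets (lebRp p) = sets borel"
  by (simp add: lebRp_def)

lemma space_lebRp [simp]: "space (lebRp p) = UNIV"
  by (simp add: lebRp_def)

lemma AE_lebRp: "AE x in lebRp p. x \<in> Rp p"
  unfolding lebRp_def using closed_Rp
  by (subst AE_distr_iff) (auto simp: embRp_in_Rp intro: borel_closed)

subsection \<open>Curvature of the log-likelihood\<close>

lemma has_derivative_along_line:
  assumes "(F has_derivative F') (at (x + t *\<^sub>R k) within S)"
    and "\<And>s. s \<in> T \<Longrightarrow> x + s *\<^sub>R k \<in> S"
  shows "((\<lambda>s. F (x + s *\<^sub>R k)) has_derivative (\<lambda>d. F' (d *\<^sub>R k))) (at t within T)"
proof -
  have "((\<lambda>s. x + s *\<^sub>R k) has_derivative (\<lambda>d. d *\<^sub>R k)) (at t within T)"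
    by (auto intro!: derivative_eq_intros)
  moreover have "(F has_derivative F') (at (x + t *\<^sub>R k) within ((\<lambda>s. x + s *\<^sub>R k) ` T))"
    using assms by (auto intro: has_derivative_subset)
  ultimately show ?thesis
    using has_derivative_in_compose[where g = F and f = "\<lambda>s. x + s *\<^sub>R k"] by blast
qed

text \<open>The second difference of \<open>f\<close> at \<open>x\<close> is symmetric in the increments \<open>h\<close>, \<open>k\<close>,
  and by the mean value theorem it is \<open>t\<^sup>2 * inner (H k) h + o(t\<^sup>2)\<close>.\<close>

lemma second_difference_limit:
  fixes f :: "l2 \<Rightarrow> real"
  assumes grad: "has_grad_on p S f G"
    and hess: "(G has_derivative H) (at x within S)"
    and ball: "0 < r" "\<And>y. y \<in> Rp p \<Longrightarrow> norm (y - x) < r \<Longrightarrow> y \<in> S"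
    and x: "x \<in> Rp p" and h: "h \<in> Rp p" and k: "k \<in> Rp p"
  shows "((\<lambda>t. (f (x + t *\<^sub>R h + t *\<^sub>R k) - f (x + t *\<^sub>R h) - f (x + t *\<^sub>R k) + f x) / t\<^sup>2)
           \<longlongrightarrow> inner (H k) h) (at_right 0)"
proof (rule tendstoI)
  fix e :: real assume e: "0 < e"
  define M where "M = norm h + norm k + 1"
  have M: "0 < M" by (simp add: M_def add_nonneg_pos)
  \<comment> \<open>Each of the two expansions of \<open>G\<close> below has error at most
    \<open>e' * (t * M)\<close>; multiplied by \<open>norm h \<le> M\<close> and divided by
    \<open>t\<close>, they contribute \<open>e / 2\<close> together.\<close>
  define e' where "e' = e / (4 * M * M)"
  have e': "0 < e'" using e M by (simp add: e'_def)
  obtain d where d: "0 < d" "\<And>y. y \<in> S \<Longrightarrow> norm (y - x) < d \<Longrightarrow>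
      norm (G y - G x - H (y - x)) \<le> e' * norm (y - x)"
    using hess e' unfolding has_derivative_within_alt by blast
  have lin: "linear H" using hess by (simp add: has_derivative_linear)
  define b where "b = min r d / M"
  have b: "0 < b" using M d ball by (simp add: b_def)
  have "dist ((f (x + t *\<^sub>R h + t *\<^sub>R k) - f (x + t *\<^sub>R h) - f (x + t *\<^sub>R k) + f x) / t\<^sup>2)
      (inner (H k) h) < e" if t: "0 < t" "t < b" for t
  proof -
    have in_Rp: "x + s *\<^sub>R h + u *\<^sub>R k \<in> Rp p" for s u
      using x h k subspace_Rp by (auto intro!: subspace_add subspace_scale)
    have small: "norm (s *\<^sub>R h + u *\<^sub>R k) \<le> t * M" "norm (s *\<^sub>R h + u *\<^sub>R k) < min r d"
      if "0 \<le> s" "s \<le> t" "0 \<le> u" "u \<le> t" for s u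
    proof -
      have "norm (s *\<^sub>R h + u *\<^sub>R k) \<le> s * norm h + u * norm k"
        using that norm_triangle_ineq[of "s *\<^sub>R h" "u *\<^sub>R k"] by simp
      also have "\<dots> \<le> t * norm h + t * norm k"
        using that by (intro add_mono mult_right_mono) auto
      also have "\<dots> \<le> t * M" using t by (simp add: M_def algebra_simps)
      finally show 1: "norm (s *\<^sub>R h + u *\<^sub>R k) \<le> t * M" .
      have "t * M < min r d" using t M by (simp add: b_def pos_less_divide_eq)
      with 1 show "norm (s *\<^sub>R h + u *\<^sub>R k) < min r d" by linarith
    qed
    have in_S: "x + s *\<^sub>R h + u *\<^sub>R k \<in> S" if "0 \<le> s" "s \<le> t" "0 \<le> u" "u \<le> t" for s u
      using small(2)[OF that] in_Rp[of s u] ball by (auto simp: add.assoc)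
    \<comment> \<open>\<open>\<psi>\<close> takes the difference in direction \<open>k\<close> while
      the argument moves along \<open>h\<close>. The mean value theorem for it involves only values
      of \<open>G\<close>, so differentiability of \<open>G\<close> at the single point
      \<open>x\<close> suffices.\<close>
    define \<psi> where "\<psi> s = f (x + t *\<^sub>R k + s *\<^sub>R h) - f (x + s *\<^sub>R h)" for s
    have der: "(\<psi> has_derivative (\<lambda>q. inner (G (x + t *\<^sub>R k + s *\<^sub>R h)) (q *\<^sub>R h)
           - inner (G (x + s *\<^sub>R h)) (q *\<^sub>R h))) (at s within {0..t})" if "0 \<le> s" "s \<le> t" for s
      unfolding \<psi>_def
    proof (intro has_derivative_diff has_derivative_along_line[where S = S])
      show "(f has_derivative inner (G (x + t *\<^sub>R k + s *\<^sub>R h))) (at (x + t *\<^sub>R k + s *\<^sub>R h) within S)"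
        using grad in_S[of s t] that by (simp add: has_grad_on_def add_ac)
      show "(f has_derivative inner (G (x + s *\<^sub>R h))) (at (x + s *\<^sub>R h) within S)"
        using grad in_S[of s 0] that by (simp add: has_grad_on_def)
      show "x + t *\<^sub>R k + s *\<^sub>R h \<in> S" if "s \<in> {0..t}" for s
        using in_S[of s t] that by (simp add: add_ac)
      show "x + s *\<^sub>R h \<in> S" if "s \<in> {0..t}" for s
        using in_S[of s 0] that by simp
    qed
    obtain s where s: "0 < s" "s < t" and
      mv: "\<psi> t - \<psi> 0 = inner (G (x + t *\<^sub>R k + s *\<^sub>R h)) ((t - 0) *\<^sub>R h)
           - inner (G (x + s *\<^sub>R h)) ((t - 0) *\<^sub>R h)"
      using mvt_simple[OF t(1), of \<psi>] der by (smt (verit, best) greaterThanLessThan_iff)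
    define y1 where "y1 = x + s *\<^sub>R h + t *\<^sub>R k"
    define y2 where "y2 = x + s *\<^sub>R h"
    have y1: "y1 \<in> S" "norm (y1 - x) < d" "norm (y1 - x) \<le> t * M"
      using in_S[of s t] small[of s t] s by (auto simp: y1_def add.assoc)
    have y2: "y2 \<in> S" "norm (y2 - x) < d" "norm (y2 - x) \<le> t * M"
      using in_S[of s 0] small[of s 0] s by (auto simp: y2_def)
    have 1: "norm (G y1 - G x - H (y1 - x)) \<le> e' * (t * M)"
      by (rule order_trans[OF d(2)[OF y1(1,2)]]) (use e' y1 in \<open>auto intro: mult_left_mono\<close>)
    have 2: "norm (G y2 - G x - H (y2 - x)) \<le> e' * (t * M)"
      by (rule order_trans[OF d(2)[OF y2(1,2)]]) (use e' y2 in \<open>auto intro: mult_left_mono\<close>)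
    have Hk: "H (y1 - x) - H (y2 - x) = t *\<^sub>R H k"
      by (simp add: linear_diff[OF lin, symmetric] linear_scale[OF lin, symmetric] y1_def y2_def)
    have 3: "norm (G y1 - G y2 - t *\<^sub>R H k) \<le> 2 * (e' * (t * M))"
    proof -
      have "G y1 - G y2 - t *\<^sub>R H k = (G y1 - G x - H (y1 - x)) - (G y2 - G x - H (y2 - x))"
        unfolding Hk[symmetric] by simp
      also have "norm \<dots> \<le> norm (G y1 - G x - H (y1 - x)) + norm (G y2 - G x - H (y2 - x))"
        by (rule norm_triangle_ineq4)
      finally show ?thesis using 1 2 by linarith
    qed
    have eq: "f (x + t *\<^sub>R h + t *\<^sub>R k) - f (x + t *\<^sub>R h) - f (x + t *\<^sub>R k) + f x = t * inner (G y1 - G y2) h"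
      using mv by (simp add: \<psi>_def y1_def y2_def add_ac inner_diff_left algebra_simps)
    have "(f (x + t *\<^sub>R h + t *\<^sub>R k) - f (x + t *\<^sub>R h) - f (x + t *\<^sub>R k) + f x) / t\<^sup>2 - inner (H k) h
        = inner (G y1 - G y2 - t *\<^sub>R H k) h / t"
    proof -
      have "inner (G y1 - G y2 - t *\<^sub>R H k) h = inner (G y1 - G y2) h - t * inner (H k) h"
        by (simp only: inner_diff_left inner_scaleR_left)
      then show ?thesis unfolding eq using t by (simp only:) (simp add: diff_divide_distrib power2_eq_square)
    qed
    also have "\<bar>\<dots>\<bar> \<le> norm (G y1 - G y2 - t *\<^sub>R H k) * norm h / t"
      using t Cauchy_Schwarz_ineq2 by (auto simp: intro!: divide_right_mono)
    also have "\<dots> \<le> 2 * (e' * (t * M)) * M / t"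
      using 3 t by (intro divide_right_mono mult_mono) (use M e' in \<open>auto simp: M_def less_imp_le\<close>)
    also have "\<dots> = e / 2" using t M by (simp add: e'_def)
    finally show ?thesis using e by (simp add: dist_real_def)
  qed
  then show "\<forall>\<^sub>F t in at_right 0. dist ((f (x + t *\<^sub>R h + t *\<^sub>R k) - f (x + t *\<^sub>R h) - f (x + t *\<^sub>R k) + f x) / t\<^sup>2)
      (inner (H k) h) < e"
    unfolding eventually_at_right_field using b by blast
qed

text \<open>The second difference is unchanged when \<open>h\<close> and \<open>k\<close> are
  exchanged, so its two limits coincide. No continuity of the second derivative enters.\<close>

lemma hessian_symmetric:
  fixes f :: "l2 \<Rightarrow> real"
  assumes "has_grad_on p S f G"
    and "(G has_derivative H) (at x within S)"
    and "0 < r" "\<And>y. y \<in> Rp p \<Longrightarrow> norm (y - x) < r \<Longrightarrow> y \<in> S"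
    and "x \<in> Rp p" "h \<in> Rp p" "k \<in> Rp p"
  shows "inner (H k) h = inner (H h) k"
proof (rule tendsto_unique[OF trivial_limit_at_right_real])
  show "((\<lambda>t. (f (x + t *\<^sub>R h + t *\<^sub>R k) - f (x + t *\<^sub>R h) - f (x + t *\<^sub>R k) + f x) / t\<^sup>2)
           \<longlongrightarrow> inner (H k) h) (at_right 0)"
    by (rule second_difference_limit) (fact assms)+
  have "((\<lambda>t. (f (x + t *\<^sub>R k + t *\<^sub>R h) - f (x + t *\<^sub>R k) - f (x + t *\<^sub>R h) + f x) / t\<^sup>2)
           \<longlongrightarrow> inner (H h) k) (at_right 0)"
    by (rule second_difference_limit) (fact assms)+
  then show "((\<lambda>t. (f (x + t *\<^sub>R h + t *\<^sub>R k) - f (x + t *\<^sub>R h) - f (x + t *\<^sub>R k) + f x) / t\<^sup>2)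
           \<longlongrightarrow> inner (H h) k) (at_right 0)"
    by (simp add: algebra_simps)
qed

text \<open>Along a segment in direction \<open>h\<close> the coordinates of \<open>G\<close> from
  \<open>p\<close> on are identically 0, and one-sided derivatives are unique. R^p is thus invariant
  under \<open>H\<close>, as an eigenvector argument within R^p requires.\<close>

lemma hessian_in_Rp:
  assumes grad: "has_grad_on p S f G"
    and hess: "(G has_derivative H) (at x within S)"
    and ball: "0 < r" "\<And>y. y \<in> Rp p \<Longrightarrow> norm (y - x) < r \<Longrightarrow> y \<in> S"
    and x: "x \<in> Rp p" and h: "h \<in> Rp p"
  shows "H h \<in> Rp p"
proof -
  \<comment> \<open>The summand 1 covers \<open>h = 0\<close> and keeps the segment strictly inside
    the ball of radius \<open>r\<close>.\<close>
  define b where "b = r / (norm h + 1)"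
  have b: "0 < b" using ball by (simp add: b_def add_nonneg_pos)
  have S: "x + s *\<^sub>R h \<in> S" if "s \<in> {0..b}" for s
  proof (rule ball(2))
    show "x + s *\<^sub>R h \<in> Rp p" using x h subspace_Rp by (auto intro!: subspace_add subspace_scale)
    have "norm (x + s *\<^sub>R h - x) \<le> b * norm h" using that by (simp add: mult_right_mono)
    also have "\<dots> < b * (norm h + 1)" using b by simp
    also have "\<dots> = r" by (simp add: b_def add_nonneg_pos less_imp_neq[symmetric])
    finally show "norm (x + s *\<^sub>R h - x) < r" .
  qed
  have "((\<lambda>s. G (x + s *\<^sub>R h)) has_derivative (\<lambda>d. H (d *\<^sub>R h))) (at 0 within {0..b})"
    by (rule has_derivative_along_line[where S = S]) (use hess S in auto)
  moreover have "(\<lambda>d. H (d *\<^sub>R h)) = (\<lambda>d. d *\<^sub>R H h)"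
    using has_derivative_linear[OF hess] by (simp add: linear_scale)
  ultimately have "((\<lambda>s. G (x + s *\<^sub>R h)) has_vector_derivative H h) (at 0 within {0..b})"
    by (simp add: has_vector_derivative_def)
  then have der: "((\<lambda>s. inner (G (x + s *\<^sub>R h)) (unit_l2 i)) has_vector_derivative inner (H h) (unit_l2 i))
      (at 0 within {0..b})" for i
    by (rule bounded_linear.has_vector_derivative[OF bounded_linear_inner_left])
  have "inner (H h) (unit_l2 i) = 0" if "p \<le> i" for i
  proof (rule vector_derivative_unique_within[OF _ der])
    show "at 0 within {0..b} \<noteq> bot"
      using b by (simp add: at_within_Icc_at_right)
    have "inner (G (x + s *\<^sub>R h)) (unit_l2 i) = 0" if "s \<in> {0..b}" for s
      using grad S[OF that] \<open>p \<le> i\<close> by (simp add: has_grad_on_def Rp_def inner_unit_l2)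
    then show "((\<lambda>s. inner (G (x + s *\<^sub>R h)) (unit_l2 i)) has_vector_derivative 0) (at 0 within {0..b})"
      using b by (intro has_vector_derivative_transform[OF _ _ has_vector_derivative_const[of 0]]) auto
  qed
  then show ?thesis by (simp add: Rp_def inner_unit_l2)
qed

text \<open>The minimum of the quadratic form over the unit sphere is attained at an eigenvector.\<close>

lemma lam_min_Rp_le_quadratic_form:
  assumes lin: "linear A" and cont: "continuous_on UNIV A"
    and inv: "\<And>h. h \<in> Rp p \<Longrightarrow> A h \<in> Rp p"
    and sym: "\<And>h k. h \<in> Rp p \<Longrightarrow> k \<in> Rp p \<Longrightarrow> inner (A h) k = inner (A k) h"
    and h: "h \<in> Rp p"
  shows "lam_min_Rp p A * (norm h)\<^sup>2 \<le> inner (A h) h"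
proof (cases "h = 0")
  case True
  then show ?thesis by (simp add: linear_0[OF lin])
next
  case False
  let ?S = "{x \<in> Rp p. norm x = 1}"
  have "?S = {x \<in> Rp p. norm x \<le> 1} \<inter> {x. norm x = 1}" by auto
  moreover have "closed {x::l2. norm x = 1}" by (intro closed_Collect_eq continuous_intros)
  ultimately have "compact ?S" using compact_Rp_cball[of p 1] by (simp add: compact_Int_closed)
  moreover have unit: "(1 / norm x) *\<^sub>R x \<in> ?S" if "x \<in> Rp p" "x \<noteq> 0" for x
    using that subspace_Rp by (auto intro: subspace_scale)
  ultimately obtain u where u: "u \<in> ?S" and umin: "\<And>x. x \<in> ?S \<Longrightarrow> inner (A u) u \<le> inner (A x) x"
    using continuous_attains_inf[of ?S "\<lambda>x. inner (A x) x"] unit[OF h False]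
      continuous_on_inner[OF continuous_on_subset[OF cont subset_UNIV] continuous_on_id, of ?S]
    by blast
  define \<mu> where "\<mu> = inner (A u) u"
  have quad: "\<mu> * (norm x)\<^sup>2 \<le> inner (A x) x" if x: "x \<in> Rp p" for x
  proof (cases "x = 0")
    case True then show ?thesis by (simp add: linear_0[OF lin])
  next
    case False
    have "\<mu> \<le> inner (A ((1 / norm x) *\<^sub>R x)) ((1 / norm x) *\<^sub>R x)"
      unfolding \<mu>_def using unit[OF x False] by (rule umin)
    then show ?thesis using False
      by (simp add: linear_scale[OF lin] field_simps power2_eq_square)
  qed
  have eig: "A u = \<mu> *\<^sub>R u"
  proof -
    \<comment> \<open>The residual of the eigenvalue equation. Moving the minimiser \<open>u\<close>
      along \<open>w\<close> has first-order effect \<open>2 * t * inner w w\<close>, which a small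
      negative \<open>t\<close> would turn into a violation of \<open>quad\<close> unless
      \<open>w = 0\<close>.\<close>
    define w where "w = A u - \<mu> *\<^sub>R u"
    have w: "w \<in> Rp p" using u inv subspace_Rp by (auto simp: w_def intro!: subspace_diff subspace_scale)
    have "0 \<le> 2 * t * inner w w + t\<^sup>2 * (inner (A w) w - \<mu> * inner w w)" for t
    proof -
      have "\<mu> * (norm (u + t *\<^sub>R w))\<^sup>2 \<le> inner (A (u + t *\<^sub>R w)) (u + t *\<^sub>R w)"
        using u w subspace_Rp by (intro quad subspace_add subspace_scale) auto
      also have "inner (A (u + t *\<^sub>R w)) (u + t *\<^sub>R w)
          = inner (A u) u + 2 * t * inner (A u) w + t\<^sup>2 * inner (A w) w"
        using sym[OF w, of u] u
        by (simp add: linear_add[OF lin] linear_scale[OF lin] inner_add_left inner_add_right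
            power2_eq_square algebra_simps)
      also have "(norm (u + t *\<^sub>R w))\<^sup>2 = (norm u)\<^sup>2 + 2 * t * inner u w + t\<^sup>2 * inner w w"
        unfolding power2_norm_eq_inner
        by (simp add: inner_add_left inner_add_right inner_commute[of w u] power2_eq_square algebra_simps)
      also have "norm u = 1" using u by simp
      finally have "0 \<le> 2 * t * (inner (A u) w - \<mu> * inner u w) + t\<^sup>2 * (inner (A w) w - \<mu> * inner w w)"
        by (simp add: \<mu>_def algebra_simps)
      also have "inner (A u) w - \<mu> * inner u w = inner w w"
        by (simp add: w_def inner_diff_left)
      finally show ?thesis .
    qed
    then have lin_le: "0 \<le> 2 * t * inner w w + t\<^sup>2 * (inner (A w) w - \<mu> * inner w w)" for t .
    \<comment> \<open>A positive bound for the coefficient of the quadratic term in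
      \<open>t\<close>; the choice \<open>t = - inner w w / B\<close> then gives
      \<open>- (inner w w)^2 / B\<close> as upper bound for a nonnegative number.\<close>
    define B where "B = \<bar>inner (A w) w - \<mu> * inner w w\<bar> + 1"
    have B: "0 < B" by (simp add: B_def)
    have "0 \<le> 2 * (- inner w w / B) * inner w w + (- inner w w / B)\<^sup>2 * B"
      using lin_le[of "- inner w w / B"] mult_left_mono[of "inner (A w) w - \<mu> * inner w w" B "(- inner w w / B)\<^sup>2"]
      unfolding B_def by force
    also have "\<dots> = - (inner w w)\<^sup>2 / B" using B by (simp add: field_simps power2_eq_square)
    finally have "inner w w = 0" using B by (simp add: zero_le_divide_iff divide_le_0_iff)
    then show ?thesis by (simp add: w_def)
  qed
  have "lam_min_Rp p A \<le> \<mu>"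
    unfolding lam_min_Rp_def
  proof (rule cInf_lower)
    show "\<mu> \<in> {r. \<exists>h\<in>Rp p. h \<noteq> 0 \<and> A h = r *\<^sub>R h}" using eig u by force
    \<comment> \<open>The infimum of a set that is unbounded below would be meaningless;
      \<open>quad\<close> shows that no eigenvalue lies below \<open>\<mu>\<close>.\<close>
    show "bdd_below {r. \<exists>h\<in>Rp p. h \<noteq> 0 \<and> A h = r *\<^sub>R h}"
    proof (rule bdd_belowI[of _ \<mu>])
      fix r assume "r \<in> {r. \<exists>h\<in>Rp p. h \<noteq> 0 \<and> A h = r *\<^sub>R h}"
      then obtain x where x: "x \<in> Rp p" "x \<noteq> 0" "A x = r *\<^sub>R x" by auto
      then have "\<mu> * (norm x)\<^sup>2 \<le> r * (norm x)\<^sup>2" using quad[of x] by (simp add: power2_norm_eq_inner)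
      then show "\<mu> \<le> r" using x by (simp add: mult_le_cancel_right)
    qed
  qed
  then have "lam_min_Rp p A * (norm h)\<^sup>2 \<le> \<mu> * (norm h)\<^sup>2" by (intro mult_right_mono) auto
  also have "\<dots> \<le> inner (A h) h" using h by (rule quad)
  finally show ?thesis .
qed

text \<open>Taylor's formula along the segment from \<open>c\<close> to \<open>x\<close>. The
  curvature bound keeps the directional derivative plus \<open>m * t * |h|^2\<close> below its value
  at 0, and this sum is the derivative of \<open>f\<close> plus
  \<open>m / 2 * t^2 * |h|^2\<close>.\<close>

lemma quadratic_upper_bound:
  assumes C2: "C2_grad_hess p (ballRp p c r) f G H"
    and lam: "\<And>y. y \<in> ballRp p c r \<Longrightarrow> m \<le> lam_min_Rp p (\<lambda>h. - H y h)"
    and c: "c \<in> Rp p" and x: "x \<in> ballRp p c r"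
  shows "f x \<le> f c + inner (G c) (x - c) - m / 2 * (norm (x - c))\<^sup>2"
proof (cases "x = c")
  case False
  define h where "h = x - c"
  have h0: "0 < norm h" using False by (simp add: h_def)
  have h: "h \<in> Rp p" using x c subspace_Rp by (auto simp: h_def ballRp_def intro: subspace_diff)
  have hr: "norm h \<le> r" using x by (simp add: h_def ballRp_def)
  have grad: "has_grad_on p (ballRp p c r) f G" using C2 by (simp add: C2_grad_hess_def)
  have hess: "(G has_derivative H y) (at y within ballRp p c r)" if "y \<in> ballRp p c r" for y
    using C2 that by (simp add: C2_grad_hess_def)
  have seg: "c + t *\<^sub>R h \<in> ballRp p c r" if "t \<in> {0..1}" for t
  proof -
    have "\<bar>t\<bar> * norm h \<le> 1 * norm h" using that by (intro mult_right_mono) auto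
    then show ?thesis using c h hr subspace_Rp
      by (auto simp: ballRp_def intro!: subspace_add subspace_scale)
  qed
  have curv: "inner (H (c + t *\<^sub>R h) h) h \<le> - m * (norm h)\<^sup>2" if t: "0 < t" "t < 1" for t
  proof -
    let ?y = "c + t *\<^sub>R h" let ?A = "\<lambda>h. - H ?y h"
    have y: "?y \<in> ballRp p c r" "?y \<in> Rp p" using seg[of t] t by (auto simp: ballRp_def)
    \<comment> \<open>Symmetry and invariance of the Hessian need an R^p-ball around the point
      inside the domain. The end point \<open>x\<close> may lie on the boundary, but the mean value
      theorem visits only interior points of the segment, which have a ball of this radius.\<close>
    have r': "0 < (1 - t) * norm h" using t h0 by simp
    have ball: "z \<in> ballRp p c r" if "z \<in> Rp p" "norm (z - ?y) < (1 - t) * norm h" for z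
    proof -
      have "norm (z - c) \<le> norm (z - ?y) + norm (t *\<^sub>R h)"
        using norm_triangle_ineq[of "z - ?y" "t *\<^sub>R h"] by (simp add: algebra_simps)
      also have "\<dots> \<le> norm h" using that t by (simp add: algebra_simps)
      finally show ?thesis using that hr by (simp add: ballRp_def)
    qed
    note H = hess[OF y(1)]
    have "m * (norm h)\<^sup>2 \<le> lam_min_Rp p ?A * (norm h)\<^sup>2"
      using lam[OF y(1)] by (intro mult_right_mono) auto
    also have "\<dots> \<le> inner (?A h) h"
    proof (rule lam_min_Rp_le_quadratic_form[OF _ _ _ _ h])
      show "linear ?A" using has_derivative_linear[OF H] by (rule linear_compose_neg)
      show "continuous_on UNIV ?A"
        using has_derivative_bounded_linear[OF H]
        by (intro continuous_on_minus linear_continuous_on)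
      show "- H ?y k \<in> Rp p" if "k \<in> Rp p" for k
        using hessian_in_Rp[OF grad H r' ball y(2) that] subspace_Rp by (simp add: subspace_neg)
      show "inner (- H ?y k) l = inner (- H ?y l) k" if "k \<in> Rp p" "l \<in> Rp p" for k l
        using hessian_symmetric[OF grad H r' ball y(2) that] by simp
    qed
    finally show ?thesis by simp
  qed
  define \<psi>' where "\<psi>' t = inner (G (c + t *\<^sub>R h)) h + m * t * (norm h)\<^sup>2" for t
  have d1: "(\<psi>' has_derivative (\<lambda>d. inner (H (c + t *\<^sub>R h) (d *\<^sub>R h)) h + m * d * (norm h)\<^sup>2))
      (at t within {0..1})" if "t \<in> {0..1}" for t
    unfolding \<psi>'_def
    by (intro has_derivative_add has_derivative_inner_left has_derivative_along_line[where S = "ballRp p c r"]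
        hess seg that) (auto intro!: derivative_eq_intros)
  have mono: "\<psi>' t \<le> \<psi>' 0" if t: "0 < t" "t < 1" for t
  proof -
    obtain s where s: "0 < s" "s < t" and
      "\<psi>' t - \<psi>' 0 = inner (H (c + s *\<^sub>R h) ((t - 0) *\<^sub>R h)) h + m * (t - 0) * (norm h)\<^sup>2"
    proof -
      have "(\<psi>' has_derivative (\<lambda>d. inner (H (c + u *\<^sub>R h) (d *\<^sub>R h)) h + m * d * (norm h)\<^sup>2))
          (at u within {0..t})" if "0 \<le> u" "u \<le> t" for u
        using d1[of u] that t by (auto elim: has_derivative_subset)
      from mvt_simple[OF t(1) this] show ?thesis using that by auto
    qed
    then have "\<psi>' t - \<psi>' 0 = t * (inner (H (c + s *\<^sub>R h) h) h + m * (norm h)\<^sup>2)"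
      using hess[of "c + s *\<^sub>R h"] seg[of s] t
      by (simp add: has_derivative_linear linear_scale algebra_simps)
    also have "\<dots> \<le> 0" using curv[of s] s t by (intro mult_nonneg_nonpos) auto
    finally show ?thesis by simp
  qed
  define \<psi> where "\<psi> t = f (c + t *\<^sub>R h) + m / 2 * t\<^sup>2 * (norm h)\<^sup>2" for t
  have d0: "(\<psi> has_derivative (\<lambda>d. inner (G (c + t *\<^sub>R h)) (d *\<^sub>R h) + m * t * d * (norm h)\<^sup>2))
      (at t within {0..1})" if "0 \<le> t" "t \<le> 1" for t
    unfolding \<psi>_def
  proof (intro has_derivative_add has_derivative_along_line[where S = "ballRp p c r"] seg)
    show "(f has_derivative inner (G (c + t *\<^sub>R h))) (at (c + t *\<^sub>R h) within ballRp p c r)"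
      using grad seg[of t] that by (simp add: has_grad_on_def)
    show "((\<lambda>t. m / 2 * t\<^sup>2 * (norm h)\<^sup>2) has_derivative (\<lambda>d. m * t * d * (norm h)\<^sup>2)) (at t within {0..1})"
      by (auto intro!: derivative_eq_intros)
  qed
  obtain s where s: "0 < s" "s < 1" and
    "\<psi> 1 - \<psi> 0 = inner (G (c + s *\<^sub>R h)) ((1 - 0) *\<^sub>R h) + m * s * (1 - 0) * (norm h)\<^sup>2"
    using mvt_simple[OF zero_less_one d0] by auto
  then have "\<psi> 1 - \<psi> 0 = \<psi>' s" by (simp add: \<psi>'_def)
  also have "\<dots> \<le> \<psi>' 0" using mono s by simp
  finally show ?thesis by (simp add: \<psi>_def \<psi>'_def h_def)
qed simp

subsection \<open>The surrogate log-likelihood\<close>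

lemma smooth_fun_borel_measurable: "smooth_fun f \<Longrightarrow> f \<in> borel_measurable borel"
proof -
  assume "smooth_fun f"
  then have "(f has_real_derivative deriv f x) (at x)" for x
    unfolding smooth_fun_def by (metis comp_apply funpow.simps(1) funpow.simps(2) id_apply)
  then have "continuous_on UNIV f"
    by (metis DERIV_isCont continuous_at_imp_continuous_on)
  then show ?thesis by (rule borel_measurable_continuous_onI)
qed

text \<open>The term of order zero already reaches 1, since \<open>v 0 = 1\<close>. This lets the
  factor \<open>C2norm v\<close> in the lower bound for \<open>K\<close> be replaced by 1.\<close>

lemma one_le_C2norm:
  assumes "cutoff_fun v"
  shows "1 \<le> C2norm v"
proof -
  have v: "0 \<le> v t" "v t \<le> 1" "v 0 = 1" for t using assms by (auto simp: cutoff_fun_def)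
  have "1 = \<bar>(deriv ^^ 0) v 0\<bar>" using v by simp
  also have "\<dots> \<le> (SUP t. \<bar>(deriv ^^ 0) v t\<bar>)"
    by (rule cSUP_upper) (auto intro!: bdd_aboveI[of _ 1] simp: v)
  also have "\<dots> \<le> C2norm v" unfolding C2norm_def by (intro Max_ge imageI) auto
  finally show ?thesis .
qed

section \<open>The rescaled mollifier as a centred probability density\<close>

context
  fixes \<phi> :: "real \<Rightarrow> real" and \<tau> :: real
  assumes phi: "mollifier \<phi>" and tau: "0 < \<tau>"
begin

lemma phi_t_nonneg: "0 \<le> phi_t \<phi> \<tau> x"
  using phi tau by (simp add: mollifier_def phi_t_def)

lemma phi_t_support: "\<tau> < \<bar>x\<bar> \<Longrightarrow> phi_t \<phi> \<tau> x = 0"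
  using phi tau by (simp add: mollifier_def phi_t_def abs_divide)

lemma phi_measurable [measurable]: "\<phi> \<in> borel_measurable borel"
  using phi by (simp add: mollifier_def smooth_fun_borel_measurable)

lemma phi_t_measurable [measurable]: "phi_t \<phi> \<tau> \<in> borel_measurable borel"
  unfolding phi_t_def by measurable

lemma phi_t_affine: "phi_t \<phi> \<tau> (t - s) = \<phi> (t / \<tau> + (- 1 / \<tau>) * s) / \<tau>"
  by (simp add: phi_t_def diff_divide_distrib)

lemma phi_t_integrable: "integrable lborel (\<lambda>s. phi_t \<phi> \<tau> (t - s))"
proof -
  \<comment> \<open>A function that is not integrable has integral 0 by convention, so integral 1
    entails integrability.\<close>
  have "integrable lborel \<phi>"
    using phi not_integrable_integral_eq[of lborel \<phi>] by (force simp: mollifier_def)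
  then have "integrable lborel (\<lambda>s. \<phi> (t / \<tau> + (- 1 / \<tau>) * s))"
    using tau by (intro lborel_integrable_real_affine) auto
  then show ?thesis unfolding phi_t_affine by simp
qed

lemma phi_t_integral: "(\<integral>s. phi_t \<phi> \<tau> (t - s) \<partial>lborel) = 1"
proof -
  have "1 = (\<integral>x. \<phi> x \<partial>lborel)" using phi by (simp add: mollifier_def)
  also have "\<dots> = \<bar>- 1 / \<tau>\<bar> *\<^sub>R (\<integral>s. \<phi> (t / \<tau> + (- 1 / \<tau>) * s) \<partial>lborel)"
    using tau by (intro lborel_integral_real_affine) auto
  also have "\<dots> = (\<integral>s. phi_t \<phi> \<tau> (t - s) \<partial>lborel)"
    unfolding phi_t_affine using tau by simp
  finally show ?thesis by simp
qed

text \<open>Reflecting \<open>s\<close> at \<open>t\<close> preserves the even kernel and flips the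
  sign of \<open>s - t\<close>, so the integral equals its own negative.\<close>

lemma phi_t_first_moment: "(\<integral>s. phi_t \<phi> \<tau> (t - s) * (s - t) \<partial>lborel) = 0" (is "?I = 0")
proof -
  have even: "phi_t \<phi> \<tau> (- x) = phi_t \<phi> \<tau> x" for x
    using phi by (simp add: mollifier_def phi_t_def)
  have "?I = \<bar>- 1\<bar> *\<^sub>R (\<integral>s. phi_t \<phi> \<tau> (t - (2 * t + - 1 * s)) * ((2 * t + - 1 * s) - t) \<partial>lborel)"
    by (rule lborel_integral_real_affine) simp
  also have "\<dots> = (\<integral>s. - (phi_t \<phi> \<tau> (t - s) * (s - t)) \<partial>lborel)"
    using even[of "t - s" for s] by (simp add: algebra_simps)
  finally show ?thesis by simp
qed

lemma phi_t_mult_integrable: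
  assumes [measurable]: "g \<in> borel_measurable borel"
    and "\<And>s. \<bar>t - s\<bar> \<le> \<tau> \<Longrightarrow> \<bar>g s\<bar> \<le> B"
  shows "integrable lborel (\<lambda>s. phi_t \<phi> \<tau> (t - s) * g s)"
proof (rule Bochner_Integration.integrable_bound)
  show "integrable lborel (\<lambda>s. phi_t \<phi> \<tau> (t - s) * B)" using phi_t_integrable by simp
  have "\<bar>phi_t \<phi> \<tau> (t - s) * g s\<bar> \<le> \<bar>phi_t \<phi> \<tau> (t - s) * B\<bar>" for s
  proof (cases "\<bar>t - s\<bar> \<le> \<tau>")
    case True
    then show ?thesis using assms(2)[OF True] by (simp add: abs_mult mult_left_mono)
  qed (simp add: phi_t_support)
  then show "AE s in lborel. norm (phi_t \<phi> \<tau> (t - s) * g s) \<le> norm (phi_t \<phi> \<tau> (t - s) * B)" by simp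
qed measurable

end

section \<open>The penalty\<close>

lemma gamma_eta_measurable [measurable]: "gamma_eta \<eta> \<in> borel_measurable borel"
  unfolding gamma_eta_def by measurable

lemma gamma_eta_nonneg: "0 \<le> gamma_eta \<eta> t"
  by (simp add: gamma_eta_def)

text \<open>\<open>gamma_eta\<close> is the square of the positive part of
  \<open>t - 5 * \<eta> / 8\<close>, hence convex; its supporting lines are what Jensen's inequality
  needs.\<close>

lemma gamma_eta_tangent:
  "gamma_eta \<eta> t + 2 * max 0 (t - 5 * \<eta> / 8) * (s - t) \<le> gamma_eta \<eta> s"
proof -
  define a where "a = t - 5 * \<eta> / 8"
  define b where "b = s - 5 * \<eta> / 8"
  have eq: "gamma_eta \<eta> t = (max 0 a)\<^sup>2" "gamma_eta \<eta> s = (max 0 b)\<^sup>2" "s - t = b - a"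
    by (auto simp: gamma_eta_def a_def b_def max_def)
  have "max 0 a * b \<le> max 0 a * max 0 b" by (intro mult_left_mono) auto
  moreover have "max 0 a * a = (max 0 a)\<^sup>2" by (auto simp: max_def power2_eq_square)
  moreover have "2 * (max 0 a * max 0 b) \<le> (max 0 a)\<^sup>2 + (max 0 b)\<^sup>2"
    using sum_squares_bound[of "max 0 a" "max 0 b"] by (simp add: mult.assoc)
  ultimately show ?thesis unfolding eq a_def[symmetric] by (simp add: algebra_simps)
qed

lemma v_eta_nonneg:
  assumes "mollifier \<phi>" "0 < \<eta>"
  shows "0 \<le> v_eta \<phi> \<eta> t"
  unfolding v_eta_def
  by (intro Bochner_Integration.integral_nonneg mult_nonneg_nonneg phi_t_nonneg gamma_eta_nonneg) (use assms in auto)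

text \<open>The kernel reaches at most \<open>\<eta> / 8\<close> beyond \<open>t\<close>, so only
  \<open>s \<le> 5 * \<eta> / 8\<close> contribute, where \<open>gamma_eta\<close> vanishes.\<close>

lemma v_eta_eq_0:
  assumes "mollifier \<phi>" "0 < \<eta>" "t \<le> \<eta> / 2"
  shows "v_eta \<phi> \<eta> t = 0"
proof -
  have "phi_t \<phi> (\<eta> / 8) (t - s) * gamma_eta \<eta> s = 0" for s
    using phi_t_support[of \<phi> "\<eta> / 8" "t - s"] assms
    by (cases "s < 5 * \<eta> / 8") (auto simp: gamma_eta_def)
  then show ?thesis unfolding v_eta_def by (simp only:) simp
qed

text \<open>Jensen's inequality: averaging a convex function against a probability density centred
  at \<open>t\<close> cannot go below its value at \<open>t\<close>. The quadratic growth of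
  \<open>gamma_eta\<close> thus passes to the smoothed penalty.\<close>

lemma gamma_eta_le_v_eta:
  assumes phi: "mollifier \<phi>" and eta: "0 < \<eta>"
  shows "gamma_eta \<eta> t \<le> v_eta \<phi> \<eta> t"
proof -
  define \<tau> where "\<tau> = \<eta> / 8"
  have tau: "0 < \<tau>" using eta by (simp add: \<tau>_def)
  define a where "a = 2 * max 0 (t - 5 * \<eta> / 8)"
  note int = phi_t_mult_integrable[OF phi tau] phi_t_integrable[OF phi tau]
  have i1: "integrable lborel (\<lambda>s. phi_t \<phi> \<tau> (t - s) * (s - t))"
    by (rule int(1)[where B = \<tau>]) auto
  have i2: "integrable lborel (\<lambda>s. phi_t \<phi> \<tau> (t - s) * gamma_eta \<eta> s)"
  proof (rule int(1)[where B = "(\<bar>t\<bar> + \<tau> + \<eta>)\<^sup>2"])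
    fix s assume "\<bar>t - s\<bar> \<le> \<tau>"
    then have "\<bar>s - 5 * \<eta> / 8\<bar> \<le> \<bar>t\<bar> + \<tau> + \<eta>" using eta by auto
    then have "(s - 5 * \<eta> / 8)\<^sup>2 \<le> (\<bar>t\<bar> + \<tau> + \<eta>)\<^sup>2" by (rule abs_le_square_iff[THEN iffD1, OF order_trans]) simp
    then show "\<bar>gamma_eta \<eta> s\<bar> \<le> (\<bar>t\<bar> + \<tau> + \<eta>)\<^sup>2" by (simp add: gamma_eta_def)
  qed simp
  have "gamma_eta \<eta> t = gamma_eta \<eta> t * (\<integral>s. phi_t \<phi> \<tau> (t - s) \<partial>lborel)
      + a * (\<integral>s. phi_t \<phi> \<tau> (t - s) * (s - t) \<partial>lborel)"
    by (simp add: phi_t_integral[OF phi tau] phi_t_first_moment[OF phi tau])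
  also have "\<dots> = (\<integral>s. gamma_eta \<eta> t * phi_t \<phi> \<tau> (t - s) + a * (phi_t \<phi> \<tau> (t - s) * (s - t)) \<partial>lborel)"
    using i1 int(2) by simp
  also have "\<dots> \<le> (\<integral>s. phi_t \<phi> \<tau> (t - s) * gamma_eta \<eta> s \<partial>lborel)"
  proof (rule integral_mono)
    fix s
    show "gamma_eta \<eta> t * phi_t \<phi> \<tau> (t - s) + a * (phi_t \<phi> \<tau> (t - s) * (s - t))
        \<le> phi_t \<phi> \<tau> (t - s) * gamma_eta \<eta> s"
      using mult_left_mono[OF gamma_eta_tangent[of \<eta> t s] phi_t_nonneg[OF phi tau, of "t - s"]]
      by (simp add: a_def algebra_simps)
  qed (use i1 i2 int(2) in simp_all)
  finally show ?thesis by (simp add: v_eta_def \<tau>_def)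
qed

lemma v_eta_measurable:
  assumes phi: "mollifier \<phi>"
  shows "v_eta \<phi> \<eta> \<in> borel_measurable borel"
proof -
  note phi_measurable[OF phi zero_less_one, measurable]
  show ?thesis unfolding v_eta_def phi_t_def by measurable
qed

section \<open>The surrogate inside and outside the ball of radius \<eta>/2\<close>

lemma ltilde_measurable [measurable]:
  assumes "cutoff_fun v" "mollifier \<phi>" and [measurable]: "ll \<in> borel_measurable borel"
  shows "ltilde v \<phi> \<eta> K \<theta>init ll \<in> borel_measurable borel"
proof -
  have [measurable]: "v \<in> borel_measurable borel" "v_eta \<phi> \<eta> \<in> borel_measurable borel"
    using assms smooth_fun_borel_measurable v_eta_measurable by (auto simp: cutoff_fun_def)
  show ?thesis unfolding ltilde_def by measurable
qed

lemma ltilde_eq: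
  assumes "cutoff_fun v" "mollifier \<phi>" "0 < \<eta>" "norm (\<theta> - \<theta>init) \<le> \<eta> / 2"
  shows "ltilde v \<phi> \<eta> K \<theta>init ll \<theta> = ll \<theta>"
proof -
  have "norm (\<theta> - \<theta>init) / \<eta> \<le> 3 / 4" using assms by (simp add: field_simps)
  then have "v (norm (\<theta> - \<theta>init) / \<eta>) = 1" using assms(1) by (simp add: cutoff_fun_def)
  then show ?thesis using v_eta_eq_0[OF assms(2,3,4)] by (simp add: ltilde_def)
qed

text \<open>Where the cutoff \<open>v\<close> is not yet 1, the penalty \<open>K v_eta\<close> beats the possible gain
  \<open>ll \<theta>init - ll \<theta>s\<close>; elsewhere strong concavity of \<open>ll\<close> near \<open>\<theta>s\<close> suffices.\<close>

lemma ltilde_tail_bound: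
  assumes v: "cutoff_fun v" and phi: "mollifier \<phi>" and eta: "0 < \<eta>"
    and init: "\<theta>init \<in> Rp p" "norm (\<theta>init - \<theta>s) \<le> \<eta> / 8"
    and quad: "\<And>\<theta>. \<theta> \<in> ballRp p \<theta>s \<eta> \<Longrightarrow> ll \<theta> \<le> ll \<theta>s + g * norm (\<theta> - \<theta>s) - m / 2 * (norm (\<theta> - \<theta>s))\<^sup>2"
    and bounds: "0 \<le> g" "0 \<le> m" "g \<le> 3 / 32 * m * \<eta>" "m \<le> a" "60 * a \<le> K"
    and \<theta>: "\<theta> \<in> Rp p" "\<eta> / 2 < norm (\<theta> - \<theta>init)"
  shows "ltilde v \<phi> \<eta> K \<theta>init ll \<theta> \<le> ll \<theta>s - 9 / 256 * m * \<eta>\<^sup>2"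
proof -
  define r where "r = norm (\<theta> - \<theta>init)"
  define d where "d = norm (\<theta> - \<theta>s)"
  define V where "V = v (r / \<eta>)"
  have V: "0 \<le> V" "V \<le> 1" using v by (auto simp: V_def cutoff_fun_def)
  have K: "0 \<le> K" "0 \<le> a" using bounds by auto
  have dr: "d \<le> r + \<eta> / 8" "r \<le> d + \<eta> / 8"
    using init norm_triangle_ineq[of "\<theta> - \<theta>init" "\<theta>init - \<theta>s"]
      norm_triangle_ineq[of "\<theta> - \<theta>s" "\<theta>s - \<theta>init"]
    by (auto simp: d_def r_def norm_minus_commute)
  \<comment> \<open>Distances to the two centres differ by at most \<open>\<eta> / 8\<close>, and
    \<open>3 / 8 = 1 / 2 - 1 / 8\<close>.\<close>
  have d: "3 / 8 * \<eta> \<le> d" using dr \<theta> by (simp add: r_def)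
  have d2: "9 / 64 * \<eta>\<^sup>2 \<le> d\<^sup>2"
    using power_mono[OF d, of 2] eta by (simp add: power_mult_distrib power2_eq_square)
  have md: "9 / 256 * m * \<eta>\<^sup>2 \<le> m / 4 * d\<^sup>2"
    using mult_left_mono[OF d2, of "m / 4"] bounds by simp
  \<comment> \<open>A nonzero cutoff forces \<open>r \<le> 7 / 8 * \<eta>\<close>, hence
    \<open>d \<le> \<eta>\<close>, so \<open>quad\<close> applies. Since
    \<open>3 / 32 = 1 / 4 * (3 / 8)\<close>, the linear term costs at most half of the quadratic
    one.\<close>
  have near: "V * (ll \<theta> - ll \<theta>s) \<le> V * (- (m / 4 * d\<^sup>2))"
  proof (cases "r / \<eta> > 7 / 8")
    case True
    then have "V = 0" using v by (simp add: V_def cutoff_fun_def)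
    then show ?thesis by simp
  next
    case False
    then have "d \<le> \<eta>" using dr eta by (simp add: field_simps)
    then have "\<theta> \<in> ballRp p \<theta>s \<eta>" using \<theta> by (simp add: ballRp_def d_def)
    then have "ll \<theta> \<le> ll \<theta>s + g * d - m / 2 * d\<^sup>2" unfolding d_def by (rule quad)
    moreover have "g * d \<le> m / 4 * d * d"
    proof (rule mult_right_mono)
      have "g \<le> m / 4 * (3 / 8 * \<eta>)" using bounds by simp
      also have "\<dots> \<le> m / 4 * d" using d bounds by (intro mult_left_mono) auto
      finally show "g \<le> m / 4 * d" .
    qed (simp add: d_def)
    ultimately have "ll \<theta> - ll \<theta>s \<le> - (m / 4 * d\<^sup>2)" by (simp add: power2_eq_square)
    then show ?thesis using V by (intro mult_left_mono)
  qed
  \<comment> \<open>The initial point can beat \<open>\<theta>s\<close> only through the linear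
    term, over a distance of at most \<open>\<eta> / 8\<close>; this gives
    \<open>3 / 256 = 3 / 32 * (1 / 8)\<close>.\<close>
  have gain: "ll \<theta>init - ll \<theta>s \<le> 3 / 256 * a * \<eta>\<^sup>2"
  proof -
    have "\<theta>init \<in> ballRp p \<theta>s \<eta>" using init eta by (simp add: ballRp_def)
    then have "ll \<theta>init - ll \<theta>s \<le> g * norm (\<theta>init - \<theta>s) - m / 2 * (norm (\<theta>init - \<theta>s))\<^sup>2"
      using quad by force
    also have "\<dots> \<le> g * norm (\<theta>init - \<theta>s)" using bounds by simp
    also have "\<dots> \<le> (3 / 32 * a * \<eta>) * (\<eta> / 8)"
    proof (intro mult_mono)
      show "g \<le> 3 / 32 * a * \<eta>"
        using bounds eta by (intro order_trans[OF bounds(3)] mult_right_mono mult_left_mono) auto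
    qed (use init bounds eta K in auto)
    finally show ?thesis by (simp add: power2_eq_square)
  qed
  \<comment> \<open>A convex combination with weights \<open>V\<close> and \<open>1 - V\<close>:
    both parts are shown to lie below their share of \<open>- (m / 4 * d^2)\<close>, with the
    penalty charged to the second.\<close>
  have eq: "ltilde v \<phi> \<eta> K \<theta>init ll \<theta> - ll \<theta>s
      = V * (ll \<theta> - ll \<theta>s) + (1 - V) * (ll \<theta>init - ll \<theta>s) - K * v_eta \<phi> \<eta> r"
    by (simp add: ltilde_def V_def r_def algebra_simps)
  have pen: "0 \<le> K * v_eta \<phi> \<eta> r" using K v_eta_nonneg[OF phi eta] by simp
  have "(1 - V) * (ll \<theta>init - ll \<theta>s) - K * v_eta \<phi> \<eta> r \<le> (1 - V) * (- (m / 4 * d\<^sup>2))"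
  proof (cases "r / \<eta> \<le> 3 / 4")
    case True
    then have "V = 1" using v by (simp add: V_def cutoff_fun_def)
    then show ?thesis using pen by simp
  next
    case False
    then have r: "3 / 4 * \<eta> < r" using eta by (simp add: field_simps)
    \<comment> \<open>From \<open>3 / 4 * \<eta> < r\<close> follow
      \<open>5 / 8 * \<eta> < 5 / 6 * r\<close> and \<open>d \<le> 7 / 6 * r\<close>. The penalty is
      then at least \<open>60 / 36 * a * r^2\<close>, against at most
      \<open>(1 / 48 + 49 / 144) * a * r^2\<close> for the gain and the target together.\<close>
    have "r\<^sup>2 / 36 = (r / 6)\<^sup>2" by (simp add: power_divide)
    also have "\<dots> \<le> (r - 5 * \<eta> / 8)\<^sup>2" using r eta by (intro power_mono) auto
    also have "\<dots> = gamma_eta \<eta> r" using r eta by (simp add: gamma_eta_def)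
    also have "\<dots> \<le> v_eta \<phi> \<eta> r" by (rule gamma_eta_le_v_eta[OF phi eta])
    finally have "60 * a * (r\<^sup>2 / 36) \<le> K * v_eta \<phi> \<eta> r" using bounds K by (intro mult_mono) auto
    moreover have "9 / 16 * \<eta>\<^sup>2 \<le> r\<^sup>2"
      using power_mono[OF less_imp_le[OF r], of 2] eta by (simp add: power_mult_distrib power2_eq_square)
    then have "a * (9 / 16 * \<eta>\<^sup>2) \<le> a * r\<^sup>2" using K by (intro mult_left_mono) auto
    moreover have "m * d\<^sup>2 \<le> a * (49 / 36 * r\<^sup>2)"
    proof (intro mult_mono)
      have "d \<le> 7 / 6 * r" using dr r by simp
      then have "d\<^sup>2 \<le> (7 / 6 * r)\<^sup>2" by (intro power_mono) (auto simp: d_def)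
      then show "d\<^sup>2 \<le> 49 / 36 * r\<^sup>2" by (simp add: power_mult_distrib power2_eq_square)
    qed (use bounds K in auto)
    moreover have "0 \<le> a * r\<^sup>2" using K by simp
    ultimately have "3 / 256 * a * \<eta>\<^sup>2 - K * v_eta \<phi> \<eta> r \<le> - (m / 4 * d\<^sup>2)"
      by (simp add: algebra_simps)
    moreover have "(1 - V) * (ll \<theta>init - ll \<theta>s) \<le> 1 * (3 / 256 * a * \<eta>\<^sup>2)"
    proof -
      have "(1 - V) * (ll \<theta>init - ll \<theta>s) \<le> (1 - V) * (3 / 256 * a * \<eta>\<^sup>2)"
        using gain V by (intro mult_left_mono) auto
      also have "\<dots> \<le> 1 * (3 / 256 * a * \<eta>\<^sup>2)" using V K by (intro mult_right_mono) auto
      finally show ?thesis .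
    qed
    moreover have "- (m / 4 * d\<^sup>2) \<le> (1 - V) * (- (m / 4 * d\<^sup>2))"
      using V bounds by (simp add: mult_left_le_one_le)
    ultimately show ?thesis by linarith
  qed
  with near have "ltilde v \<phi> \<eta> K \<theta>init ll \<theta> - ll \<theta>s \<le> V * (- (m / 4 * d\<^sup>2)) + (1 - V) * (- (m / 4 * d\<^sup>2))"
    unfolding eq by linarith
  also have "\<dots> = - (m / 4 * d\<^sup>2)" by (simp add: algebra_simps)
  finally show ?thesis using md by linarith
qed

subsection \<open>A coupling of two densities with common mass\<close>

lemma pair_measure_flag_nn_integral:
  fixes F :: "bool \<times> 'a \<Rightarrow> ennreal"
  assumes "sigma_finite_measure N" and [measurable]: "F \<in> borel_measurable (count_space UNIV \<Otimes>\<^sub>M N)"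
  shows "(\<integral>\<^sup>+z. F z \<partial>(count_space UNIV \<Otimes>\<^sub>M N)) = (\<integral>\<^sup>+z. F (True, z) \<partial>N) + (\<integral>\<^sup>+z. F (False, z) \<partial>N)"
proof -
  interpret sigma_finite_measure N by fact
  have "(\<integral>\<^sup>+z. F z \<partial>(count_space UNIV \<Otimes>\<^sub>M N)) = (\<integral>\<^sup>+b. \<integral>\<^sup>+z. F (b, z) \<partial>N \<partial>count_space UNIV)"
    by (simp add: nn_integral_fst)
  also have "\<dots> = (\<integral>\<^sup>+z. F (True, z) \<partial>N) + (\<integral>\<^sup>+z. F (False, z) \<partial>N)"
    by (simp add: nn_integral_count_space_finite UNIV_bool add.commute)
  finally show ?thesis .
qed

text \<open>The coupling keeps the common mass \<open>h\<close> on the diagonal and couples the two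
  remainders independently; the boolean flag encodes this mixture of two measures.\<close>

locale common_mass =
  prob_space P for P :: "l2 measure" +
  fixes f g h :: "l2 \<Rightarrow> ennreal"
  assumes sets_P [measurable_cong]: "sets P = sets borel"
    and f [measurable]: "f \<in> borel_measurable borel"
    and g [measurable]: "g \<in> borel_measurable borel"
    and h [measurable]: "h \<in> borel_measurable borel"
    and int_f: "(\<integral>\<^sup>+x. f x \<partial>P) = 1" and int_g: "(\<integral>\<^sup>+x. g x \<partial>P) = 1"
    and h_le: "\<And>x. h x \<le> f x" "\<And>x. h x \<le> g x"
begin

text \<open>The mass of either remainder, the same for \<open>f\<close> and \<open>g\<close> because
  both integrate to 1.\<close>

definition rest :: ennreal where "rest = 1 - (\<integral>\<^sup>+x. h x \<partial>P)"

definition coupling_weight :: "bool \<times> l2 \<times> l2 \<Rightarrow> ennreal" where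
  "coupling_weight = (\<lambda>(b, x, y). if b then h x else (f x - h x) * (g y - h y) / rest)"

definition coupling :: "(l2 \<times> l2) measure" where
  "coupling = distr (density (count_space UNIV \<Otimes>\<^sub>M (P \<Otimes>\<^sub>M P)) coupling_weight)
     (borel \<Otimes>\<^sub>M borel) (\<lambda>(b, x, y). if b then (x, x) else (x, y))"

lemma int_h_le: "(\<integral>\<^sup>+x. h x \<partial>P) \<le> 1"
  using nn_integral_mono[of P h f] h_le int_f by simp

lemma int_f_rest: "(\<integral>\<^sup>+x. f x - h x \<partial>P) = rest"
  unfolding rest_def int_f[symmetric] using int_h_le h_le
  by (intro nn_integral_diff) (auto simp: top_unique)

lemma int_g_rest: "(\<integral>\<^sup>+x. g x - h x \<partial>P) = rest"
  unfolding rest_def int_g[symmetric] using int_h_le h_le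
  by (intro nn_integral_diff) (auto simp: top_unique)

lemma rest_finite: "rest \<noteq> \<infinity>"
  by (simp add: rest_def)

text \<open>If the remainder has mass zero, the quotient is \<open>0 / 0 = 0\<close>, which agrees
  with \<open>u\<close> only almost everywhere.\<close>

lemma rest_cancel:
  assumes "(\<integral>\<^sup>+x. u x \<partial>P) = rest" and [measurable]: "u \<in> borel_measurable borel"
  shows "AE x in P. u x * rest / rest = u x"
proof (cases "rest = 0")
  case True
  then have "AE x in P. u x = 0" using assms by (simp add: nn_integral_0_iff_AE)
  then show ?thesis by eventually_elim simp
next
  case False
  then show ?thesis using rest_finite by (simp add: ennreal_mult_divide_eq top.not_eq_extremum)
qed

lemma coupling_weight_measurable [measurable]:
  "coupling_weight \<in> borel_measurable (count_space UNIV \<Otimes>\<^sub>M (P \<Otimes>\<^sub>M P))"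
  unfolding coupling_weight_def by measurable

lemma nn_integral_coupling:
  assumes [measurable]: "F \<in> borel_measurable (borel \<Otimes>\<^sub>M borel)"
  shows "(\<integral>\<^sup>+z. F z \<partial>coupling) = (\<integral>\<^sup>+x. h x * F (x, x) \<partial>P)
      + (\<integral>\<^sup>+x. \<integral>\<^sup>+y. (f x - h x) * (g y - h y) / rest * F (x, y) \<partial>P \<partial>P)"
proof -
  interpret PP: pair_prob_space P P ..
  have T [measurable]: "(\<lambda>(b, x, y). if b then (x, x) else (x, y))
      \<in> (count_space UNIV \<Otimes>\<^sub>M (P \<Otimes>\<^sub>M P)) \<rightarrow>\<^sub>M (borel \<Otimes>\<^sub>M borel)"
    by measurable
  have "(\<integral>\<^sup>+z. F z \<partial>coupling) = (\<integral>\<^sup>+z. coupling_weight z * F ((\<lambda>(b, x, y). if b then (x, x) else (x, y)) z)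
      \<partial>(count_space UNIV \<Otimes>\<^sub>M (P \<Otimes>\<^sub>M P)))"
    unfolding coupling_def by (simp add: nn_integral_distr nn_integral_density)
  also have "\<dots> = (\<integral>\<^sup>+z. h (fst z) * F (fst z, fst z) \<partial>(P \<Otimes>\<^sub>M P))
      + (\<integral>\<^sup>+z. (f (fst z) - h (fst z)) * (g (snd z) - h (snd z)) / rest * F (fst z, snd z) \<partial>(P \<Otimes>\<^sub>M P))"
    by (subst pair_measure_flag_nn_integral)
      (auto simp: coupling_weight_def case_prod_unfold intro: PP.sigma_finite_measure_axioms)
  \<comment> \<open>For the diagonal part the second coordinate is idle and integrates to 1.\<close>
  also have "(\<integral>\<^sup>+z. h (fst z) * F (fst z, fst z) \<partial>(P \<Otimes>\<^sub>M P)) = (\<integral>\<^sup>+x. h x * F (x, x) \<partial>P)"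
    by (subst nn_integral_fst[symmetric]) (auto simp: emeasure_space_1)
  also have "(\<integral>\<^sup>+z. (f (fst z) - h (fst z)) * (g (snd z) - h (snd z)) / rest * F (fst z, snd z) \<partial>(P \<Otimes>\<^sub>M P))
      = (\<integral>\<^sup>+x. \<integral>\<^sup>+y. (f x - h x) * (g y - h y) / rest * F (x, y) \<partial>P \<partial>P)"
    by (subst nn_integral_fst[symmetric]) auto
  finally show ?thesis .
qed

lemma nn_integral_remainder_fst:
  assumes [measurable]: "u \<in> borel_measurable borel"
  shows "(\<integral>\<^sup>+x. \<integral>\<^sup>+y. (f x - h x) * (g y - h y) / rest * u x \<partial>P \<partial>P) = (\<integral>\<^sup>+x. (f x - h x) * u x \<partial>P)"
proof -
  have "(\<integral>\<^sup>+x. \<integral>\<^sup>+y. (f x - h x) * (g y - h y) / rest * u x \<partial>P \<partial>P)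
      = (\<integral>\<^sup>+x. \<integral>\<^sup>+y. ((f x - h x) / rest * u x) * (g y - h y) \<partial>P \<partial>P)"
    by (simp add: ennreal_divide_times divide_ennreal_def mult_ac)
  also have "\<dots> = (\<integral>\<^sup>+x. ((f x - h x) / rest * u x) * rest \<partial>P)"
    by (simp add: nn_integral_cmult int_g_rest)
  also have "\<dots> = (\<integral>\<^sup>+x. (f x - h x) * u x \<partial>P)"
  proof (rule nn_integral_cong_AE)
    have "AE x in P. (f x - h x) * rest / rest = f x - h x"
      using int_f_rest by (rule rest_cancel) measurable
    then show "AE x in P. (f x - h x) / rest * u x * rest = (f x - h x) * u x"
      by eventually_elim (simp add: divide_ennreal_def mult_ac)
  qed
  finally show ?thesis .
qed

lemma nn_integral_remainder_snd:
  assumes [measurable]: "u \<in> borel_measurable borel"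
  shows "(\<integral>\<^sup>+x. \<integral>\<^sup>+y. (f x - h x) * (g y - h y) / rest * u y \<partial>P \<partial>P) = (\<integral>\<^sup>+x. (g x - h x) * u x \<partial>P)"
proof -
  have "(\<integral>\<^sup>+x. \<integral>\<^sup>+y. (f x - h x) * (g y - h y) / rest * u y \<partial>P \<partial>P)
      = (\<integral>\<^sup>+x. \<integral>\<^sup>+y. ((f x - h x)) * ((g y - h y) / rest * u y) \<partial>P \<partial>P)"
    by (simp add: divide_ennreal_def mult_ac)
  also have "\<dots> = (\<integral>\<^sup>+x. (f x - h x) * (\<integral>\<^sup>+y. (g y - h y) / rest * u y \<partial>P) \<partial>P)"
    by (simp add: nn_integral_cmult)
  also have "\<dots> = (\<integral>\<^sup>+y. (g y - h y) / rest * u y \<partial>P) * rest"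
    by (simp add: nn_integral_multc int_f_rest mult.commute)
  also have "\<dots> = (\<integral>\<^sup>+y. (g y - h y) / rest * u y * rest \<partial>P)"
    by (simp add: nn_integral_multc)
  also have "\<dots> = (\<integral>\<^sup>+y. (g y - h y) * u y \<partial>P)"
  proof (rule nn_integral_cong_AE)
    have "AE x in P. (g x - h x) * rest / rest = g x - h x"
      using int_g_rest by (rule rest_cancel) measurable
    then show "AE x in P. (g x - h x) / rest * u x * rest = (g x - h x) * u x"
      by eventually_elim (simp add: divide_ennreal_def mult_ac)
  qed
  finally show ?thesis .
qed

lemma coupling_in_couplings: "coupling \<in> couplings (density P f) (density P g)"
proof -
  have sets: "sets coupling = sets (borel \<Otimes>\<^sub>M borel)" by (simp add: coupling_def)
  have add_diff: "h x + (u x - h x) = u x" if "\<And>x. h x \<le> u x" for u :: "l2 \<Rightarrow> ennreal" and x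
    using that[of x] by (simp add: add_diff_inverse_ennreal)
  have "distr coupling borel fst = density P f"
  proof (rule measure_eqI)
    fix A assume "A \<in> sets (distr coupling borel fst)"
    then have A [measurable]: "A \<in> sets borel" by simp
    have "emeasure (distr coupling borel fst) A = (\<integral>\<^sup>+z. indicator A z \<partial>distr coupling borel fst)"
      by (simp add: nn_integral_indicator)
    also have "\<dots> = (\<integral>\<^sup>+z. indicator A (fst z) \<partial>coupling)"
      by (rule nn_integral_distr) (auto simp: measurable_cong_sets[OF sets refl])
    also have "\<dots> = (\<integral>\<^sup>+x. h x * indicator A x \<partial>P)
        + (\<integral>\<^sup>+x. \<integral>\<^sup>+y. (f x - h x) * (g y - h y) / rest * indicator A x \<partial>P \<partial>P)"
      by (subst nn_integral_coupling) auto
    also have "\<dots> = (\<integral>\<^sup>+x. h x * indicator A x + (f x - h x) * indicator A x \<partial>P)"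
      by (simp add: nn_integral_remainder_fst nn_integral_add)
    also have "\<dots> = (\<integral>\<^sup>+x. f x * indicator A x \<partial>P)"
      by (simp add: distrib_right[symmetric] add_diff h_le)
    also have "\<dots> = emeasure (density P f) A" by (simp add: emeasure_density sets_P)
    finally show "emeasure (distr coupling borel fst) A = emeasure (density P f) A" .
  qed (simp add: sets_P)
  moreover have "distr coupling borel snd = density P g"
  proof (rule measure_eqI)
    fix A assume "A \<in> sets (distr coupling borel snd)"
    then have A [measurable]: "A \<in> sets borel" by simp
    have "emeasure (distr coupling borel snd) A = (\<integral>\<^sup>+z. indicator A z \<partial>distr coupling borel snd)"
      by (simp add: nn_integral_indicator)
    also have "\<dots> = (\<integral>\<^sup>+z. indicator A (snd z) \<partial>coupling)"
      by (rule nn_integral_distr) (auto simp: measurable_cong_sets[OF sets refl])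
    also have "\<dots> = (\<integral>\<^sup>+x. h x * indicator A x \<partial>P)
        + (\<integral>\<^sup>+x. \<integral>\<^sup>+y. (f x - h x) * (g y - h y) / rest * indicator A y \<partial>P \<partial>P)"
      by (subst nn_integral_coupling) auto
    also have "\<dots> = (\<integral>\<^sup>+x. h x * indicator A x + (g x - h x) * indicator A x \<partial>P)"
      by (simp add: nn_integral_remainder_snd nn_integral_add)
    also have "\<dots> = (\<integral>\<^sup>+x. g x * indicator A x \<partial>P)"
      by (simp add: distrib_right[symmetric] add_diff h_le)
    also have "\<dots> = emeasure (density P g) A" by (simp add: emeasure_density sets_P)
    finally show "emeasure (distr coupling borel snd) A = emeasure (density P g) A" .
  qed (simp add: sets_P)
  ultimately show ?thesis using sets by (simp add: couplings_def)
qed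

text \<open>The diagonal part costs nothing. On the product part the cost is split into the second
  moments of the two coordinates, each of which sees only its own remainder.\<close>

lemma W2sq_le:
  "W2sq (density P f) (density P g) \<le>
     2 * (\<integral>\<^sup>+x. (f x - h x) * ennreal ((norm x)\<^sup>2) \<partial>P) + 2 * (\<integral>\<^sup>+x. (g x - h x) * ennreal ((norm x)\<^sup>2) \<partial>P)"
proof -
  have sq: "ennreal ((norm (x - y))\<^sup>2) \<le> 2 * ennreal ((norm x)\<^sup>2) + 2 * ennreal ((norm y)\<^sup>2)" for x y :: l2
  proof -
    have "(norm (x - y))\<^sup>2 \<le> (norm x + norm y)\<^sup>2"
      by (intro power_mono norm_triangle_ineq4) auto
    also have "\<dots> \<le> 2 * (norm x)\<^sup>2 + 2 * (norm y)\<^sup>2"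
      using sum_squares_bound[of "norm x" "norm y"] by (simp add: power2_sum)
    finally have "ennreal ((norm (x - y))\<^sup>2) \<le> ennreal (2 * (norm x)\<^sup>2 + 2 * (norm y)\<^sup>2)"
      by (rule ennreal_leI)
    then show ?thesis by (simp add: ennreal_mult)
  qed
  let ?w = "\<lambda>x y. (f x - h x) * (g y - h y) / rest"
  have "W2sq (density P f) (density P g) \<le> (\<integral>\<^sup>+z. ennreal ((norm (fst z - snd z))\<^sup>2) \<partial>coupling)"
    unfolding W2sq_def by (rule INF_lower[OF coupling_in_couplings])
  also have "\<dots> = (\<integral>\<^sup>+x. \<integral>\<^sup>+y. ?w x y * ennreal ((norm (x - y))\<^sup>2) \<partial>P \<partial>P)"
    by (subst nn_integral_coupling) auto
  also have "\<dots> \<le> (\<integral>\<^sup>+x. \<integral>\<^sup>+y. ?w x y * (2 * ennreal ((norm x)\<^sup>2)) + ?w x y * (2 * ennreal ((norm y)\<^sup>2)) \<partial>P \<partial>P)"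
    unfolding distrib_left[symmetric] by (intro nn_integral_mono mult_left_mono) (use sq in auto)
  also have "\<dots> = (\<integral>\<^sup>+x. \<integral>\<^sup>+y. ?w x y * (2 * ennreal ((norm x)\<^sup>2)) \<partial>P \<partial>P)
      + (\<integral>\<^sup>+x. \<integral>\<^sup>+y. ?w x y * (2 * ennreal ((norm y)\<^sup>2)) \<partial>P \<partial>P)"
    by (subst nn_integral_add[symmetric]) (auto intro!: nn_integral_cong nn_integral_add)
  also have "\<dots> = (\<integral>\<^sup>+x. (f x - h x) * (2 * ennreal ((norm x)\<^sup>2)) \<partial>P)
      + (\<integral>\<^sup>+x. (g x - h x) * (2 * ennreal ((norm x)\<^sup>2)) \<partial>P)"
    by (subst nn_integral_remainder_fst nn_integral_remainder_snd; simp)+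
  also have "\<dots> = 2 * (\<integral>\<^sup>+x. (f x - h x) * ennreal ((norm x)\<^sup>2) \<partial>P)
      + 2 * (\<integral>\<^sup>+x. (g x - h x) * ennreal ((norm x)\<^sup>2) \<partial>P)"
    by (subst (1 2) nn_integral_cmult[symmetric]) (auto simp: mult_ac)
  finally show ?thesis .
qed

end

subsection \<open>Wasserstein distance between Gibbs measures\<close>

lemma divide_left_mono_ennreal: "b \<le> c \<Longrightarrow> a / c \<le> a / (b::ennreal)"
proof -
  assume "b \<le> c"
  then have "inverse c \<le> inverse b"
    by (cases b; cases c; cases "b = 0") (auto simp: inverse_ennreal top_unique intro!: ennreal_leI le_imp_inverse_le)
  then show ?thesis unfolding divide_ennreal_def by (rule mult_left_mono) simp
qed

text \<open>The two normalised weights share the mass \<open>w * indicator B / max D D'\<close>, where \<open>D\<close>, \<open>D'\<close>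
  are the total integrals of \<open>w\<close> and \<open>u\<close>.\<close>

lemma W2sq_normalised_weights:
  fixes P :: "l2 measure" and w u :: "l2 \<Rightarrow> ennreal"
  assumes "prob_space P" and sets_P [measurable_cong]: "sets P = sets borel"
    and [measurable]: "w \<in> borel_measurable borel" "u \<in> borel_measurable borel" "B \<in> sets borel"
    and eq: "\<And>x. x \<in> B \<Longrightarrow> u x = w x"
    and R: "0 \<le> R" "\<And>x. x \<in> B \<Longrightarrow> norm x \<le> R"
    and a: "0 < a" "a \<le> (\<integral>\<^sup>+x. w x * indicator B x \<partial>P)"
    and fin: "(\<integral>\<^sup>+x. w x \<partial>P) < \<infinity>" "(\<integral>\<^sup>+x. u x \<partial>P) < \<infinity>"
    and s: "(\<integral>\<^sup>+x. (1 + ennreal ((norm x)\<^sup>2)) * w x * indicator (- B) x \<partial>P) \<le> s"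
    and t: "(\<integral>\<^sup>+x. (1 + ennreal ((norm x)\<^sup>2)) * u x * indicator (- B) x \<partial>P) \<le> t"
  shows "W2sq (density P (\<lambda>x. u x / (\<integral>\<^sup>+x. u x \<partial>P))) (density P (\<lambda>x. w x / (\<integral>\<^sup>+x. w x \<partial>P)))
           \<le> (4 * ennreal (R\<^sup>2) + 2) * ((s + t) / a)"
proof -
  interpret prob_space P by fact
  define Dw where "Dw = (\<integral>\<^sup>+x. w x \<partial>P)"
  define Du where "Du = (\<integral>\<^sup>+x. u x \<partial>P)"
  define W where "W = (\<integral>\<^sup>+x. w x * indicator B x \<partial>P)"
  \<comment> \<open>Dividing by the larger normaliser keeps \<open>h\<close> below both
    densities.\<close>
  define Dm where "Dm = max Dw Du"
  define h where "h x = w x * indicator B x / Dm" for x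
  have split: "(\<integral>\<^sup>+x. k x \<partial>P) = (\<integral>\<^sup>+x. k x * indicator B x \<partial>P) + (\<integral>\<^sup>+x. k x * indicator (- B) x \<partial>P)"
    if [measurable]: "k \<in> borel_measurable borel" for k :: "l2 \<Rightarrow> ennreal"
    by (subst nn_integral_add[symmetric]) (auto intro!: nn_integral_cong split: split_indicator)
  have uB: "(\<integral>\<^sup>+x. u x * indicator B x \<partial>P) = W"
    unfolding W_def by (intro nn_integral_cong) (auto simp: eq split: split_indicator)
  have tail1: "(\<integral>\<^sup>+x. k x * indicator (- B) x \<partial>P)
      \<le> (\<integral>\<^sup>+x. (1 + ennreal ((norm x)\<^sup>2)) * k x * indicator (- B) x \<partial>P)" for k :: "l2 \<Rightarrow> ennreal"
    by (intro nn_integral_mono) (auto simp: distrib_right split: split_indicator)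
  have tail2: "(\<integral>\<^sup>+x. k x * ennreal ((norm x)\<^sup>2) * indicator (- B) x \<partial>P)
      \<le> (\<integral>\<^sup>+x. (1 + ennreal ((norm x)\<^sup>2)) * k x * indicator (- B) x \<partial>P)" for k :: "l2 \<Rightarrow> ennreal"
    by (intro nn_integral_mono) (auto simp: distrib_left distrib_right mult.commute split: split_indicator)
  have Dw: "a \<le> Dw" "0 < Dw" "Dw < \<infinity>" and Du: "a \<le> Du" "0 < Du" "Du < \<infinity>"
    using a fin split[of w] split[of u] uB unfolding Dw_def Du_def W_def
    by (auto intro: order_trans[OF a(2)] less_le_trans[OF less_le_trans[OF a]])
  have Dm: "a \<le> Dm" "0 < Dm" "Dm < \<infinity>" using Dw Du by (auto simp: Dm_def max_def)
  \<comment> \<open>Each normaliser exceeds the shared mass \<open>W\<close> by its tail only, so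
    the mass off the diagonal is at most \<open>(s + t) / a\<close>. This uses the summand 1 of the
    weight \<open>1 + |x|^2\<close>; the other summand bounds second moments.\<close>
  have "Dw \<le> W + (s + t)"
    using split[of w] order_trans[OF tail1 s] by (simp add: Dw_def W_def add_mono add_increasing2)
  moreover have "Du \<le> W + (s + t)"
    using split[of u] order_trans[OF tail1 t] uB by (simp add: Du_def add_mono add_increasing)
  ultimately have "Dm \<le> W + (s + t)" by (simp add: Dm_def)
  then have "Dm / Dm \<le> (W + (s + t)) / Dm" by (rule divide_right_mono_ennreal)
  then have "1 \<le> W / Dm + (s + t) / Dm" using Dm by (simp add: add_divide_distrib_ennreal)
  also have "\<dots> \<le> W / Dm + (s + t) / a" by (intro add_left_mono divide_left_mono_ennreal Dm)
  finally have q: "1 - W / Dm \<le> (s + t) / a" by (simp add: ennreal_minus_le_iff)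
  interpret common_mass P "\<lambda>x. u x / Du" "\<lambda>x. w x / Dw" h
  proof
    show "(\<integral>\<^sup>+x. u x / Du \<partial>P) = 1" "(\<integral>\<^sup>+x. w x / Dw \<partial>P) = 1"
      using Du Dw by (simp_all add: nn_integral_divide Du_def[symmetric] Dw_def[symmetric])
    show "h x \<le> u x / Du" for x
      using eq[of x] by (auto simp: h_def Dm_def intro: divide_left_mono_ennreal split: split_indicator)
    show "h x \<le> w x / Dw" for x
      by (auto simp: h_def Dm_def intro: divide_left_mono_ennreal split: split_indicator)
  qed (simp_all add: sets_P h_def[abs_def])
  have "(\<integral>\<^sup>+x. h x \<partial>P) = W / Dm" by (simp add: h_def nn_integral_divide W_def)
  then have rest: "rest \<le> (s + t) / a" using q by (simp add: rest_def)
  \<comment> \<open>On \<open>B\<close> the norm is at most \<open>R\<close> and the remainder has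
    mass at most \<open>rest\<close>; off \<open>B\<close> the common mass is zero, so the tail
    enters in full.\<close>
  have part: "(\<integral>\<^sup>+x. (k x / D - h x) * ennreal ((norm x)\<^sup>2) \<partial>P) \<le> ennreal (R\<^sup>2) * ((s + t) / a) + z / a"
    if [measurable]: "k \<in> borel_measurable borel" and D: "a \<le> D"
      and mass: "(\<integral>\<^sup>+x. k x / D - h x \<partial>P) = rest"
      and z: "(\<integral>\<^sup>+x. (1 + ennreal ((norm x)\<^sup>2)) * k x * indicator (- B) x \<partial>P) \<le> z"
    for k D z
  proof -
    have "(k x / D - h x) * ennreal ((norm x)\<^sup>2)
        \<le> ennreal (R\<^sup>2) * (k x / D - h x) + k x * ennreal ((norm x)\<^sup>2) * indicator (- B) x / D" for x
    proof (cases "x \<in> B")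
      case True
      have "(norm x)\<^sup>2 \<le> R\<^sup>2" using R True by (intro power_mono) auto
      then have "(k x / D - h x) * ennreal ((norm x)\<^sup>2) \<le> (k x / D - h x) * ennreal (R\<^sup>2)"
        by (intro mult_left_mono ennreal_leI) auto
      then show ?thesis using True by (simp add: mult.commute)
    next
      case False
      then show ?thesis by (simp add: h_def divide_ennreal_def mult_ac)
    qed
    then have "(\<integral>\<^sup>+x. (k x / D - h x) * ennreal ((norm x)\<^sup>2) \<partial>P)
        \<le> (\<integral>\<^sup>+x. ennreal (R\<^sup>2) * (k x / D - h x) + k x * ennreal ((norm x)\<^sup>2) * indicator (- B) x / D \<partial>P)"
      by (rule nn_integral_mono)
    also have "\<dots> = ennreal (R\<^sup>2) * rest + (\<integral>\<^sup>+x. k x * ennreal ((norm x)\<^sup>2) * indicator (- B) x \<partial>P) / D"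
      using mass by (simp add: nn_integral_add nn_integral_cmult nn_integral_divide)
    also have "\<dots> \<le> ennreal (R\<^sup>2) * ((s + t) / a) + z / a"
      by (intro add_mono mult_left_mono rest
          order_trans[OF divide_right_mono_ennreal[OF order_trans[OF tail2 z]] divide_left_mono_ennreal[OF D]]) simp
    finally show ?thesis .
  qed
  have "W2sq (density P (\<lambda>x. u x / Du)) (density P (\<lambda>x. w x / Dw))
      \<le> 2 * (ennreal (R\<^sup>2) * ((s + t) / a) + t / a) + 2 * (ennreal (R\<^sup>2) * ((s + t) / a) + s / a)"
    by (intro order_trans[OF W2sq_le] add_mono mult_left_mono part Du Dw s t int_f_rest int_g_rest) auto
  also have "\<dots> = (4 * ennreal (R\<^sup>2) + 2) * ((s + t) / a)"
  proof -
    have "(s + t) / a = s / a + t / a" by (rule add_divide_distrib_ennreal)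
    moreover have "4 * ennreal (R\<^sup>2) = 2 * ennreal (R\<^sup>2) + 2 * ennreal (R\<^sup>2)"
      by (simp add: distrib_right[symmetric])
    ultimately show ?thesis by (simp only: distrib_left distrib_right add_ac mult.assoc)
  qed
  finally show ?thesis by (simp add: Du_def Dw_def)
qed

text \<open>The prior moves into the base measure, and \<open>exp c\<close> cancels because it is
  neither 0 nor infinite. With \<open>c\<close> the log-likelihood at the true parameter the weights
  become likelihood ratios.\<close>

lemma gibbs_eq_density:
  fixes p :: nat and f prior :: "l2 \<Rightarrow> real" and c :: real
  assumes [measurable]: "f \<in> borel_measurable borel" "prior \<in> borel_measurable borel"
    and nonneg: "\<And>\<theta>. 0 \<le> prior \<theta>"
  defines "P \<equiv> density (lebRp p) (\<lambda>\<theta>. ennreal (prior \<theta>))"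
  shows "gibbs p prior f =
    density P (\<lambda>\<theta>. ennreal (exp (f \<theta> - c)) / (\<integral>\<^sup>+\<theta>. ennreal (exp (f \<theta> - c)) \<partial>P))"
proof -
  have e: "ennreal (exp (f \<theta>) * prior \<theta>) = ennreal (exp c) * (ennreal (prior \<theta>) * ennreal (exp (f \<theta> - c)))" for \<theta>
    using nonneg by (simp add: ennreal_mult[symmetric] exp_diff)
  have I: "(\<integral>\<^sup>+\<theta>. ennreal (exp (f \<theta>) * prior \<theta>) \<partial>lebRp p) = ennreal (exp c) * (\<integral>\<^sup>+\<theta>. ennreal (exp (f \<theta> - c)) \<partial>P)"
    unfolding e P_def by (simp add: nn_integral_cmult nn_integral_density)
  have "ennreal (exp (f \<theta>) * prior \<theta>) / (\<integral>\<^sup>+\<theta>. ennreal (exp (f \<theta>) * prior \<theta>) \<partial>lebRp p)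
      = ennreal (prior \<theta>) * (ennreal (exp (f \<theta> - c)) / (\<integral>\<^sup>+\<theta>. ennreal (exp (f \<theta> - c)) \<partial>P))" for \<theta>
    unfolding I unfolding e by (subst (1 2) mult.commute, subst divide_mult_eq) (auto simp: ennreal_times_divide)
  then show ?thesis
    unfolding gibbs_def P_def by (simp add: density_density_eq)
qed

text \<open>The deterministic core, with \<open>x\<close> in the role of n delta^2 and
  \<open>L0\<close> a reference level. Both weighted tails are of order
  \<open>exp (- (C3 + 3) * x)\<close>; the evidence bound in the denominator leaves
  \<open>exp (- 3 * x)\<close>.\<close>

lemma W2sq_gibbs_ltilde_le:
  fixes p :: nat and ll prior :: "l2 \<Rightarrow> real" and x C3 L0 M R :: real
  assumes [measurable]: "ll \<in> borel_measurable borel" "prior \<in> borel_measurable borel"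
    and nonneg: "\<And>\<theta>. 0 \<le> prior \<theta>"
  defines "P \<equiv> density (lebRp p) (\<lambda>\<theta>. ennreal (prior \<theta>))"
  assumes "prob_space P"
    and v: "cutoff_fun v" and phi: "mollifier \<phi>" and eta: "0 < \<eta>"
    and R: "0 \<le> R" "\<And>\<theta>. norm (\<theta> - \<theta>init) \<le> \<eta> / 2 \<Longrightarrow> norm \<theta> \<le> R"
    and M: "0 \<le> M" "(\<integral>\<^sup>+\<theta>. ennreal (norm \<theta> ^ 4) \<partial>P) \<le> ennreal M"
    and x: "0 \<le> x" "0 \<le> C3"
    and total: "(\<integral>\<^sup>+\<theta>. ennreal ((1 + norm \<theta> ^ 4) * exp (ll \<theta> - L0)) \<partial>P) \<le> ennreal (exp x)"
    and small: "ennreal (exp (- C3 * x)) \<le> (\<integral>\<^sup>+\<theta>. ennreal (exp (ll \<theta> - L0))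
        * indicator {\<theta>. norm (\<theta> - \<theta>init) \<le> \<eta> / 2} \<theta> \<partial>P)"
    and tail: "measure (gibbs p prior ll) {\<theta>. \<eta> / 2 < norm (\<theta> - \<theta>init)} \<le> exp (- (2 * C3 + 8) * x)"
    and tail': "\<And>\<theta>. \<theta> \<in> Rp p \<Longrightarrow> \<eta> / 2 < norm (\<theta> - \<theta>init) \<Longrightarrow>
        ltilde v \<phi> \<eta> K \<theta>init ll \<theta> - L0 \<le> - (C3 + 3) * x"
  shows "W2sq (gibbs p prior (ltilde v \<phi> \<eta> K \<theta>init ll)) (gibbs p prior ll)
           \<le> ennreal ((4 * R\<^sup>2 + 2) * (M + 4) * exp (- 3 * x))"
proof -
  interpret prob_space P by fact
  have sets_P [measurable_cong]: "sets P = sets borel" by (simp add: P_def)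
  define lt where "lt = ltilde v \<phi> \<eta> K \<theta>init ll"
  have [measurable]: "lt \<in> borel_measurable borel" unfolding lt_def by (rule ltilde_measurable[OF v phi]) simp
  define B where "B = {\<theta>. norm (\<theta> - \<theta>init) \<le> \<eta> / 2}"
  have B [measurable]: "B \<in> sets borel" unfolding B_def by measurable
  define w where "w \<theta> = exp (ll \<theta> - L0)" for \<theta>
  define u where "u \<theta> = exp (lt \<theta> - L0)" for \<theta>
  have [measurable]: "w \<in> borel_measurable borel" "u \<in> borel_measurable borel"
    unfolding w_def u_def by measurable
  have w0: "0 \<le> w \<theta>" and u0: "0 \<le> u \<theta>" for \<theta> by (simp_all add: w_def u_def)
  define D where "D = (\<integral>\<^sup>+\<theta>. ennreal (w \<theta>) \<partial>P)"
  have "D \<le> (\<integral>\<^sup>+\<theta>. ennreal ((1 + norm \<theta> ^ 4) * w \<theta>) \<partial>P)"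
    unfolding D_def using w0 by (intro nn_integral_mono ennreal_leI) (simp add: algebra_simps)
  also have total': "\<dots> \<le> ennreal (exp x)" using total by (simp add: w_def)
  finally have D: "D \<le> ennreal (exp x)" .
  have AE_Rp: "AE \<theta> in P. \<theta> \<in> Rp p"
    unfolding P_def by (subst AE_density) (use AE_lebRp[of p] in auto)
  have gibbs_ll: "gibbs p prior ll = density P (\<lambda>\<theta>. ennreal (w \<theta>) / D)"
    unfolding w_def D_def P_def by (rule gibbs_eq_density) (simp_all add: nonneg)
  have gibbs_lt: "gibbs p prior lt = density P (\<lambda>\<theta>. ennreal (u \<theta>) / (\<integral>\<^sup>+\<theta>. ennreal (u \<theta>) \<partial>P))"
    unfolding u_def P_def by (rule gibbs_eq_density) (simp_all add: nonneg)
  define T where "T = (\<integral>\<^sup>+\<theta>. ennreal (w \<theta>) * indicator (- B) \<theta> \<partial>P)"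
  have TD: "T \<le> D" unfolding T_def D_def by (intro nn_integral_mono) (auto split: split_indicator)
  have a: "ennreal (exp (- C3 * x)) \<le> (\<integral>\<^sup>+\<theta>. ennreal (w \<theta>) * indicator B \<theta> \<partial>P)"
    using small by (simp add: w_def B_def)
  also have "\<dots> \<le> D" unfolding D_def by (intro nn_integral_mono) (auto split: split_indicator)
  finally have D0: "0 < D" by (rule less_le_trans[rotated]) simp
  have Dtop: "D < \<infinity>" using D by (auto simp: less_top[symmetric] top_unique)
  \<comment> \<open>Passing from the posterior probability back to the unnormalised integral costs
    the factor \<open>D \<le> exp x\<close>, hence 7 in place of 8.\<close>
  have T: "T \<le> ennreal (exp (- (2 * C3 + 7) * x))"
  proof -
    have "emeasure (gibbs p prior ll) (- B) = (\<integral>\<^sup>+\<theta>. ennreal (w \<theta>) / D * indicator (- B) \<theta> \<partial>P)"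
      unfolding gibbs_ll by (subst emeasure_density) auto
    also have "\<dots> = T / D"
      unfolding T_def by (subst nn_integral_divide[symmetric]) (auto simp: divide_ennreal_def mult_ac)
    finally have em: "emeasure (gibbs p prior ll) (- B) = T / D" .
    have "T / D \<le> 1" using divide_right_mono_ennreal[OF TD, of D] D0 Dtop by simp
    then have "T / D = ennreal (measure (gibbs p prior ll) (- B))"
      using em by (metis emeasure_eq_ennreal_measure ennreal_one_less_top leD)
    also have "- B = {\<theta>. \<eta> / 2 < norm (\<theta> - \<theta>init)}" by (auto simp: B_def)
    also have "ennreal (measure (gibbs p prior ll) {\<theta>. \<eta> / 2 < norm (\<theta> - \<theta>init)})
        \<le> ennreal (exp (- (2 * C3 + 8) * x))" by (rule ennreal_leI[OF tail])
    finally have "T / D * D \<le> ennreal (exp (- (2 * C3 + 8) * x)) * ennreal (exp x)"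
      using D by (intro mult_mono) auto
    also have "\<dots> = ennreal (exp (- (2 * C3 + 7) * x))"
      by (simp add: ennreal_mult[symmetric] exp_add[symmetric] algebra_simps)
    also have "T / D * D = T" using D0 Dtop
      by (simp add: ennreal_divide_times mult_divide_eq_ennreal ennreal_mult_divide_eq ennreal_times_divide)
    finally show ?thesis .
  qed
  \<comment> \<open>Balances the two terms of \<open>amgm\<close>: \<open>\<epsilon> * exp x\<close>
    and \<open>exp (- (2 * C3 + 7) * x) / \<epsilon>\<close> both equal
    \<open>exp (- (C3 + 3) * x)\<close>. This explains the contraction level
    \<open>2 * C3 + 8\<close>.\<close>
  define \<epsilon> where "\<epsilon> = exp (- (C3 + 4) * x)"
  have eps: "0 < \<epsilon>" by (simp add: \<epsilon>_def)
  have amgm: "1 + r\<^sup>2 \<le> \<epsilon> * (1 + r ^ 4) + 1 / \<epsilon>" for r :: real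
  proof -
    have r4: "r ^ 4 = (r\<^sup>2)\<^sup>2" by simp
    have "0 \<le> (\<epsilon> * (1 + r\<^sup>2) - 1)\<^sup>2" by simp
    then have "2 * \<epsilon> * (1 + r\<^sup>2) \<le> \<epsilon>\<^sup>2 * (1 + r\<^sup>2)\<^sup>2 + 1"
      by (simp add: power2_eq_square algebra_simps)
    also have "\<dots> \<le> \<epsilon>\<^sup>2 * (2 * (1 + r ^ 4)) + 2"
      using sum_squares_bound[of 1 "r\<^sup>2"] unfolding r4
      by (intro add_mono mult_left_mono) (auto simp: power2_sum)
    finally show ?thesis using eps by (simp add: field_simps power2_eq_square)
  qed
  have S: "(\<integral>\<^sup>+\<theta>. (1 + ennreal ((norm \<theta>)\<^sup>2)) * ennreal (w \<theta>) * indicator (- B) \<theta> \<partial>P)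
      \<le> ennreal (2 * exp (- (C3 + 3) * x))"
  proof -
    have "(\<integral>\<^sup>+\<theta>. (1 + ennreal ((norm \<theta>)\<^sup>2)) * ennreal (w \<theta>) * indicator (- B) \<theta> \<partial>P)
        \<le> (\<integral>\<^sup>+\<theta>. ennreal \<epsilon> * ennreal ((1 + norm \<theta> ^ 4) * w \<theta>) + ennreal (1 / \<epsilon>) * (ennreal (w \<theta>) * indicator (- B) \<theta>) \<partial>P)"
    proof (rule nn_integral_mono)
      fix \<theta>
      have "(1 + (norm \<theta>)\<^sup>2) * w \<theta> \<le> (\<epsilon> * (1 + norm \<theta> ^ 4) + 1 / \<epsilon>) * w \<theta>"
        by (intro mult_right_mono amgm w0)
      then have "ennreal ((1 + (norm \<theta>)\<^sup>2) * w \<theta>) \<le> ennreal (\<epsilon> * ((1 + norm \<theta> ^ 4) * w \<theta>) + 1 / \<epsilon> * w \<theta>)"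
        by (intro ennreal_leI) (simp add: algebra_simps)
      also have "\<dots> = ennreal \<epsilon> * ennreal ((1 + norm \<theta> ^ 4) * w \<theta>) + ennreal (1 / \<epsilon>) * ennreal (w \<theta>)"
        using eps w0[of \<theta>] by (subst ennreal_plus, simp, simp, subst (1 2) ennreal_mult) auto
      finally have "(1 + ennreal ((norm \<theta>)\<^sup>2)) * ennreal (w \<theta>)
          \<le> ennreal \<epsilon> * ennreal ((1 + norm \<theta> ^ 4) * w \<theta>) + ennreal (1 / \<epsilon>) * ennreal (w \<theta>)"
        using w0[of \<theta>] by (simp add: ennreal_mult ennreal_plus)
      then show "(1 + ennreal ((norm \<theta>)\<^sup>2)) * ennreal (w \<theta>) * indicator (- B) \<theta>
          \<le> ennreal \<epsilon> * ennreal ((1 + norm \<theta> ^ 4) * w \<theta>) + ennreal (1 / \<epsilon>) * (ennreal (w \<theta>) * indicator (- B) \<theta>)"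
        by (simp split: split_indicator)
    qed
    also have "\<dots> = ennreal \<epsilon> * (\<integral>\<^sup>+\<theta>. ennreal ((1 + norm \<theta> ^ 4) * w \<theta>) \<partial>P) + ennreal (1 / \<epsilon>) * T"
      by (simp add: nn_integral_add nn_integral_cmult T_def)
    also have "\<dots> \<le> ennreal \<epsilon> * ennreal (exp x) + ennreal (1 / \<epsilon>) * ennreal (exp (- (2 * C3 + 7) * x))"
      by (intro add_mono mult_left_mono total' T) auto
    also have "\<dots> = ennreal (\<epsilon> * exp x + 1 / \<epsilon> * exp (- (2 * C3 + 7) * x))"
      using eps by (subst ennreal_plus, simp, simp, subst (1 2) ennreal_mult) auto
    also have "1 / \<epsilon> = exp ((C3 + 4) * x)" by (simp add: \<epsilon>_def exp_minus[symmetric] divide_inverse algebra_simps)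
    also have "\<epsilon> * exp x + exp ((C3 + 4) * x) * exp (- (2 * C3 + 7) * x) = 2 * exp (- (C3 + 3) * x)"
      by (simp add: \<epsilon>_def exp_add[symmetric] algebra_simps)
    finally show ?thesis .
  qed
  have S': "(\<integral>\<^sup>+\<theta>. (1 + ennreal ((norm \<theta>)\<^sup>2)) * ennreal (u \<theta>) * indicator (- B) \<theta> \<partial>P)
      \<le> ennreal ((2 + M) * exp (- (C3 + 3) * x))"
  proof -
    have "(\<integral>\<^sup>+\<theta>. (1 + ennreal ((norm \<theta>)\<^sup>2)) * ennreal (u \<theta>) * indicator (- B) \<theta> \<partial>P)
        \<le> (\<integral>\<^sup>+\<theta>. (2 + ennreal (norm \<theta> ^ 4)) * ennreal (exp (- (C3 + 3) * x)) \<partial>P)"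
    \<comment> \<open>Almost everywhere only, since \<open>tail'\<close> speaks of points of R^p,
      where the prior is concentrated.\<close>
    proof (rule nn_integral_mono_AE)
      show "AE \<theta> in P. (1 + ennreal ((norm \<theta>)\<^sup>2)) * ennreal (u \<theta>) * indicator (- B) \<theta>
          \<le> (2 + ennreal (norm \<theta> ^ 4)) * ennreal (exp (- (C3 + 3) * x))"
        using AE_Rp
      proof eventually_elim
        case (elim \<theta>)
        show ?case
        proof (cases "\<theta> \<in> B")
          case False
          then have "u \<theta> \<le> exp (- (C3 + 3) * x)"
            using tail'[OF elim] by (simp add: u_def lt_def B_def)
          moreover have "1 + (norm \<theta>)\<^sup>2 \<le> 2 + norm \<theta> ^ 4"
            using zero_le_power2[of "(norm \<theta>)\<^sup>2 - 1 / 2"] by (simp add: power2_diff power_divide)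
          then have "ennreal (1 + (norm \<theta>)\<^sup>2) \<le> ennreal (2 + norm \<theta> ^ 4)" by (rule ennreal_leI)
          then have "1 + ennreal ((norm \<theta>)\<^sup>2) \<le> 2 + ennreal (norm \<theta> ^ 4)" by (simp add: ennreal_plus)
          ultimately show ?thesis using False by (auto intro!: mult_mono ennreal_leI)
        qed simp
      qed
    qed
    also have "\<dots> = (2 + (\<integral>\<^sup>+\<theta>. ennreal (norm \<theta> ^ 4) \<partial>P)) * ennreal (exp (- (C3 + 3) * x))"
      by (simp add: nn_integral_multc nn_integral_add emeasure_space_1)
    also have "\<dots> \<le> (2 + ennreal M) * ennreal (exp (- (C3 + 3) * x))"
      by (intro mult_right_mono add_left_mono M) simp
    also have "\<dots> = ennreal ((2 + M) * exp (- (C3 + 3) * x))"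
      using M by (simp add: ennreal_mult ennreal_plus)
    finally show ?thesis .
  qed
  have uw: "u \<theta> = w \<theta>" if "\<theta> \<in> B" for \<theta>
    using ltilde_eq[OF v phi eta] that by (simp add: u_def w_def lt_def B_def)
  have Du: "(\<integral>\<^sup>+\<theta>. ennreal (u \<theta>) \<partial>P) < \<infinity>"
  proof -
    have "(\<integral>\<^sup>+\<theta>. ennreal (u \<theta>) \<partial>P) \<le> (\<integral>\<^sup>+\<theta>. ennreal (w \<theta>) + (1 + ennreal ((norm \<theta>)\<^sup>2)) * ennreal (u \<theta>) * indicator (- B) \<theta> \<partial>P)"
      by (intro nn_integral_mono) (auto simp: uw distrib_right split: split_indicator)
    also have "\<dots> = D + (\<integral>\<^sup>+\<theta>. (1 + ennreal ((norm \<theta>)\<^sup>2)) * ennreal (u \<theta>) * indicator (- B) \<theta> \<partial>P)"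
      unfolding D_def by (rule nn_integral_add) auto
    also have "\<dots> < \<infinity>"
      using Dtop S' by (auto simp: less_top[symmetric] top_unique)
    finally show ?thesis .
  qed
  have "W2sq (gibbs p prior lt) (gibbs p prior ll)
      \<le> (4 * ennreal (R\<^sup>2) + 2) * ((ennreal (2 * exp (- (C3 + 3) * x)) + ennreal ((2 + M) * exp (- (C3 + 3) * x)))
          / ennreal (exp (- C3 * x)))"
    unfolding gibbs_ll gibbs_lt D_def
  proof (rule W2sq_normalised_weights[where B = B])
    show "norm \<theta> \<le> R" if "\<theta> \<in> B" for \<theta> using R that by (simp add: B_def)
    show "(\<integral>\<^sup>+\<theta>. ennreal (w \<theta>) \<partial>P) < \<infinity>" using Dtop by (simp add: D_def)
    show "sets P = sets borel" by (rule sets_P)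
  qed (use a R Du S S' uw in \<open>auto intro: prob_space_axioms\<close>)
  also have "(ennreal (2 * exp (- (C3 + 3) * x)) + ennreal ((2 + M) * exp (- (C3 + 3) * x)))
          / ennreal (exp (- C3 * x)) = ennreal ((M + 4) * exp (- 3 * x))"
  proof -
    have "ennreal (2 * exp (- (C3 + 3) * x)) + ennreal ((2 + M) * exp (- (C3 + 3) * x))
        = ennreal ((M + 4) * exp (- (C3 + 3) * x))"
      using M by (subst ennreal_plus[symmetric]) (auto simp: algebra_simps)
    then show ?thesis
      using M by (simp add: divide_ennreal exp_diff[symmetric] times_divide_eq_right[symmetric]
          del: times_divide_eq_right) (simp add: algebra_simps)
  qed
  also have "(4 * ennreal (R\<^sup>2) + 2) * ennreal ((M + 4) * exp (- 3 * x))
      = ennreal ((4 * R\<^sup>2 + 2) * (M + 4) * exp (- 3 * x))"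
    using M by (simp add: ennreal_mult ennreal_plus mult.assoc)
  finally show ?thesis by (simp add: lt_def)
qed

subsection \<open>Likelihood ratios\<close>

text \<open>Events about posteriors need not be measurable; a measurable superset \<open>A\<close>
  can be removed from the good event in their place.\<close>

lemma outer_prob_leD:
  assumes "outer_prob_le M {Z. Q Z} b"
  shows "\<exists>A\<in>sets M. measure M A \<le> b \<and> (\<forall>Z\<in>space M. Z \<notin> A \<longrightarrow> \<not> Q Z)"
  using assms unfolding outer_prob_le_def by blast

locale dominated_model =
  fixes \<nu> :: "'z measure" and dens :: "l2 \<Rightarrow> 'z \<Rightarrow> real" and \<Theta> :: "l2 set" and \<theta>0 :: l2
  assumes \<theta>0: "\<theta>0 \<in> \<Theta>"
    and model: "\<forall>\<theta>\<in>\<Theta>. dens \<theta> \<in> borel_measurable \<nu> \<and> (\<forall>z\<in>space \<nu>. 0 < dens \<theta> z) \<and>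
                   prob_space (density \<nu> (\<lambda>z. ennreal (dens \<theta> z)))"
    and model_meas: "(\<lambda>(\<theta>, z). dens \<theta> z) \<in> borel_measurable (borel \<Otimes>\<^sub>M \<nu>)"
begin

lemma prob_space_data_law: "prob_space (data_law \<nu> dens \<theta>0 n)"
  unfolding data_law_def using model \<theta>0 by (intro prob_space_PiM) auto

lemma loglik_measurable_joint:
  "(\<lambda>(\<theta>, Z). loglik dens n Z \<theta>) \<in> borel_measurable (borel \<Otimes>\<^sub>M data_law \<nu> dens \<theta>' n)"
proof -
  have "(\<lambda>x. dens (fst x) (snd x i)) \<in> borel_measurable (borel \<Otimes>\<^sub>M data_law \<nu> dens \<theta>' n)" if "i < n" for i
  proof -
    have "(\<lambda>Z. Z i) \<in> data_law \<nu> dens \<theta>' n \<rightarrow>\<^sub>M density \<nu> (\<lambda>z. ennreal (dens \<theta>' z))"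
      unfolding data_law_def using that by (intro measurable_component_singleton) auto
    then have "(\<lambda>x. (fst x, snd x i)) \<in> (borel \<Otimes>\<^sub>M data_law \<nu> dens \<theta>' n) \<rightarrow>\<^sub>M (borel \<Otimes>\<^sub>M \<nu>)"
      by (intro measurable_Pair) (auto simp: measurable_cong_sets[OF refl sets_density] intro: measurable_compose[OF measurable_snd])
    from measurable_compose[OF this model_meas] show ?thesis by simp
  qed
  then show ?thesis
    unfolding loglik_def case_prod_unfold by (intro borel_measurable_sum borel_measurable_ln) auto
qed

lemma loglik_measurable:
  assumes "Z \<in> space (data_law \<nu> dens \<theta>' n)"
  shows "loglik dens n Z \<in> borel_measurable borel"
  using measurable_compose[OF measurable_Pair[OF measurable_ident_sets[OF refl] measurable_const[OF assms]] loglik_measurable_joint]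
  by simp

text \<open>Under the product law the expectation factors. In each factor the positive density at
  \<open>\<theta>0\<close> cancels, leaving the total mass 1 of the model at
  \<open>\<theta>\<close>.\<close>

lemma expected_likelihood_ratio:
  assumes \<theta>: "\<theta> \<in> \<Theta>"
  shows "(\<integral>\<^sup>+Z. ennreal (exp (loglik dens n Z \<theta> - loglik dens n Z \<theta>0)) \<partial>data_law \<nu> dens \<theta>0 n) = 1"
proof -
  define N where "N = density \<nu> (\<lambda>z. ennreal (dens \<theta>0 z))"
  interpret N: prob_space N using model \<theta>0 by (simp add: N_def)
  interpret product_sigma_finite "\<lambda>_::nat. N" ..
  have [measurable]: "dens \<theta> \<in> borel_measurable \<nu>" "dens \<theta>0 \<in> borel_measurable \<nu>"
    using model \<theta> \<theta>0 by auto
  have pos: "0 < dens \<theta> z" "0 < dens \<theta>0 z" if "z \<in> space \<nu>" for z using model \<theta> \<theta>0 that by auto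
  have one: "(\<integral>\<^sup>+z. ennreal (dens \<theta> z / dens \<theta>0 z) \<partial>N) = 1"
  proof -
    interpret prob_space "density \<nu> (\<lambda>z. ennreal (dens \<theta> z))" using model \<theta> by simp
    have "(\<integral>\<^sup>+z. ennreal (dens \<theta> z / dens \<theta>0 z) \<partial>N) = (\<integral>\<^sup>+z. ennreal (dens \<theta>0 z) * ennreal (dens \<theta> z / dens \<theta>0 z) \<partial>\<nu>)"
      unfolding N_def by (rule nn_integral_density) measurable
    also have "\<dots> = (\<integral>\<^sup>+z. ennreal (dens \<theta> z) * indicator (space \<nu>) z \<partial>\<nu>)"
    proof (rule nn_integral_cong)
      fix z assume z: "z \<in> space \<nu>"
      then show "ennreal (dens \<theta>0 z) * ennreal (dens \<theta> z / dens \<theta>0 z) = ennreal (dens \<theta> z) * indicator (space \<nu>) z"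
        using pos[OF z] by (simp add: ennreal_mult[symmetric] less_imp_le)
    qed
    also have "\<dots> = 1" using emeasure_space_1 by (simp add: emeasure_density)
    finally show ?thesis .
  qed
  have "(\<integral>\<^sup>+Z. ennreal (exp (loglik dens n Z \<theta> - loglik dens n Z \<theta>0)) \<partial>data_law \<nu> dens \<theta>0 n)
      = (\<integral>\<^sup>+Z. (\<Prod>i<n. ennreal (dens \<theta> (Z i) / dens \<theta>0 (Z i))) \<partial>PiM {..<n} (\<lambda>_. N))"
    unfolding data_law_def N_def[symmetric]
  proof (rule nn_integral_cong)
    fix Z assume "Z \<in> space (PiM {..<n} (\<lambda>_. N))"
    then have Z: "Z i \<in> space \<nu>" if "i < n" for i using that by (auto simp: space_PiM N_def)
    have "exp (loglik dens n Z \<theta> - loglik dens n Z \<theta>0) = (\<Prod>i<n. dens \<theta> (Z i) / dens \<theta>0 (Z i))"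
      unfolding loglik_def sum_subtractf[symmetric] exp_sum[OF finite_lessThan]
      using pos Z by (intro prod.cong) (auto simp: exp_diff)
    also have "ennreal \<dots> = (\<Prod>i<n. ennreal (dens \<theta> (Z i) / dens \<theta>0 (Z i)))"
      using pos Z by (intro prod_ennreal[symmetric]) (auto simp: less_imp_le)
    finally show "ennreal (exp (loglik dens n Z \<theta> - loglik dens n Z \<theta>0)) = (\<Prod>i<n. ennreal (dens \<theta> (Z i) / dens \<theta>0 (Z i)))" .
  qed
  also have "\<dots> = (\<Prod>i<n. \<integral>\<^sup>+z. ennreal (dens \<theta> z / dens \<theta>0 z) \<partial>N)"
    by (rule product_nn_integral_prod) (auto simp: N_def)
  finally show ?thesis by (simp add: one)
qed

text \<open>Fubini's theorem and Markov's inequality. \<open>Q\<close> and \<open>\<psi>\<close> are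
  general because the bound serves twice: for the prior with weight
  \<open>1 + norm \<theta> ^ 4\<close>, and for the point mass at \<open>\<theta>s\<close> with
  weight 1.\<close>

lemma outer_prob_likelihood_ratio:
  assumes "prob_space Q" and [measurable_cong]: "sets Q = sets borel" and supp: "AE \<theta> in Q. \<theta> \<in> \<Theta>"
    and [measurable]: "\<psi> \<in> borel_measurable borel" and nonneg: "\<And>\<theta>. 0 \<le> \<psi> \<theta>"
    and M: "(\<integral>\<^sup>+\<theta>. ennreal (\<psi> \<theta>) \<partial>Q) \<le> ennreal M" "0 \<le> M"
  shows "outer_prob_le (data_law \<nu> dens \<theta>0 n)
     {Z. ennreal (exp x) < (\<integral>\<^sup>+\<theta>. ennreal (\<psi> \<theta> * exp (loglik dens n Z \<theta> - loglik dens n Z \<theta>0)) \<partial>Q)}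
     (M * exp (- x))"
proof -
  let ?D = "data_law \<nu> dens \<theta>0 n"
  interpret Q: prob_space Q by fact
  interpret D: prob_space ?D by (rule prob_space_data_law)
  interpret QD: pair_prob_space Q ?D ..
  define F where "F Z = (\<integral>\<^sup>+\<theta>. ennreal (\<psi> \<theta> * exp (loglik dens n Z \<theta> - loglik dens n Z \<theta>0)) \<partial>Q)" for Z
  have ll: "(\<lambda>(\<theta>, Z). loglik dens n Z \<theta>) \<in> borel_measurable (Q \<Otimes>\<^sub>M ?D)"
    using loglik_measurable_joint by (simp cong: measurable_cong_sets sets_pair_measure_cong add: assms(2))
  have ll0: "(\<lambda>Z. loglik dens n Z \<theta>0) \<in> borel_measurable ?D"
    using measurable_compose[OF measurable_Pair1' loglik_measurable_joint[of n \<theta>0], of \<theta>0] by simp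
  have J: "(\<lambda>(\<theta>, Z). ennreal (\<psi> \<theta> * exp (loglik dens n Z \<theta> - loglik dens n Z \<theta>0))) \<in> borel_measurable (Q \<Otimes>\<^sub>M ?D)"
    using ll measurable_compose[OF measurable_snd ll0, of Q] unfolding case_prod_unfold by measurable
  have J': "(\<lambda>(Z, \<theta>). ennreal (\<psi> \<theta> * exp (loglik dens n Z \<theta> - loglik dens n Z \<theta>0))) \<in> borel_measurable (?D \<Otimes>\<^sub>M Q)"
    using measurable_compose[OF measurable_pair_swap' J] by (simp add: case_prod_unfold)
  have [measurable]: "F \<in> borel_measurable ?D"
    unfolding F_def using J' by (rule Q.borel_measurable_nn_integral)
  have "(\<integral>\<^sup>+Z. F Z \<partial>?D) = (\<integral>\<^sup>+\<theta>. \<integral>\<^sup>+Z. ennreal (\<psi> \<theta> * exp (loglik dens n Z \<theta> - loglik dens n Z \<theta>0)) \<partial>?D \<partial>Q)"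
    unfolding F_def using QD.Fubini[OF J] by simp
  also have "\<dots> = (\<integral>\<^sup>+\<theta>. ennreal (\<psi> \<theta>) \<partial>Q)"
  proof (rule nn_integral_cong_AE)
    show "AE \<theta> in Q. (\<integral>\<^sup>+Z. ennreal (\<psi> \<theta> * exp (loglik dens n Z \<theta> - loglik dens n Z \<theta>0)) \<partial>?D) = ennreal (\<psi> \<theta>)"
      using supp
    proof eventually_elim
      case (elim \<theta>)
      have [measurable]: "(\<lambda>Z. loglik dens n Z \<theta>) \<in> borel_measurable ?D" "(\<lambda>Z. loglik dens n Z \<theta>0) \<in> borel_measurable ?D"
        using measurable_compose[OF measurable_Pair1' loglik_measurable_joint[of n \<theta>0], of \<theta>] ll0 by simp_all
      show ?case
        using nonneg by (simp add: ennreal_mult nn_integral_cmult expected_likelihood_ratio[OF elim])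
    qed
  qed
  finally have EF: "(\<integral>\<^sup>+Z. F Z \<partial>?D) \<le> ennreal M" using M by simp
  let ?A = "{Z \<in> space ?D. 1 \<le> ennreal (exp (- x)) * F Z}"
  have "emeasure ?D ?A \<le> ennreal (exp (- x)) * (\<integral>\<^sup>+Z. F Z * indicator (space ?D) Z \<partial>?D)"
    using nn_integral_Markov_inequality[of F "space ?D" ?D "ennreal (exp (- x))"] by simp
  also have "(\<integral>\<^sup>+Z. F Z * indicator (space ?D) Z \<partial>?D) = (\<integral>\<^sup>+Z. F Z \<partial>?D)"
    by (intro nn_integral_cong) auto
  also have "ennreal (exp (- x)) * (\<integral>\<^sup>+Z. F Z \<partial>?D) \<le> ennreal (exp (- x)) * ennreal M"
    by (intro mult_left_mono EF) auto
  also have "\<dots> = ennreal (M * exp (- x))" using M by (simp add: ennreal_mult[symmetric] mult.commute)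
  finally have "measure ?D ?A \<le> M * exp (- x)"
    using M by (simp add: measure_def enn2real_leI)
  moreover have "?A \<in> sets ?D" by measurable
  moreover have "{Z. ennreal (exp x) < F Z} \<inter> space ?D \<subseteq> ?A"
  proof safe
    fix Z assume "ennreal (exp x) < F Z"
    then have "ennreal (exp (- x)) * ennreal (exp x) \<le> ennreal (exp (- x)) * F Z"
      by (intro mult_left_mono) auto
    then show "1 \<le> ennreal (exp (- x)) * F Z"
      by (simp add: ennreal_mult[symmetric] exp_minus)
  qed
  ultimately show ?thesis unfolding outer_prob_le_def F_def by blast
qed

end

lemma AE_prior_Rp:
  assumes "prior \<in> borel_measurable borel"
  shows "AE \<theta> in density (lebRp p) (\<lambda>\<theta>. ennreal (prior \<theta>)). \<theta> \<in> Rp p"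
  using assms AE_lebRp[of p] by (subst AE_density) auto

subsection \<open>The bound for a fixed sample\<close>

text \<open>Puts the complement of the \<eta>/2-ball inside the contraction event. A factor
  \<open>3 / 8 * l \<ge> 1\<close> does not shrink when raised to the power
  \<open>\<beta> \<ge> 1\<close>, so a growing \<open>l\<close> overtakes the fixed constant
  \<open>L\<close>.\<close>

lemma powr_tail_lower_bound:
  fixes \<beta> \<delta> \<eta> l L d q :: real
  assumes "1 \<le> \<beta>" "0 < \<delta>" and lead: "l * max (\<delta> powr (1 / \<beta>)) q \<le> \<eta>"
    and l: "1 \<le> 3 / 8 * l" "L < 3 / 8 * l" and d: "3 / 8 * \<eta> \<le> d"
  shows "L * \<delta> < d powr \<beta>"
proof -
  have "3 / 8 * l * \<delta> powr (1 / \<beta>) \<le> 3 / 8 * (l * max (\<delta> powr (1 / \<beta>)) q)"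
    using l by (simp add: mult_left_mono)
  also have "\<dots> \<le> d" using lead d by linarith
  finally have *: "3 / 8 * l * \<delta> powr (1 / \<beta>) \<le> d" .
  have "L * \<delta> < 3 / 8 * l * \<delta>" using l assms by (intro mult_strict_right_mono)
  also have "\<dots> \<le> (3 / 8 * l) powr \<beta> * \<delta>"
    using assms l powr_mono[of 1 \<beta> "3 / 8 * l"] by (intro mult_right_mono) auto
  also have "\<dots> = (3 / 8 * l * \<delta> powr (1 / \<beta>)) powr \<beta>"
  proof -
    have "(\<delta> powr (1 / \<beta>)) powr \<beta> = \<delta>" using assms by (simp add: powr_powr)
    then show ?thesis using powr_mult[of "3 / 8 * l" "\<delta> powr (1 / \<beta>)" \<beta>] l by simp
  qed
  also have "\<dots> \<le> d powr \<beta>" using assms l * by (intro powr_mono2) auto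
  finally show ?thesis .
qed

text \<open>A number \<open>\<delta> \<le> 1\<close> is at most its root. This places the small ball
  of the evidence bound where surrogate and log-likelihood agree, as
  \<open>3 / 8 + 1 / 8 = 1 / 2\<close>.\<close>

lemma powr_ball_upper_bound:
  fixes \<beta> \<delta> \<eta> l q :: real
  assumes "1 \<le> \<beta>" "0 < \<delta>" "\<delta> \<le> 1" "l * max (\<delta> powr (1 / \<beta>)) q \<le> \<eta>" "1 \<le> 3 / 8 * l"
  shows "\<delta> \<le> 3 / 8 * \<eta>"
proof -
  have "\<delta> = \<delta> powr 1" using assms by simp
  also have "\<dots> \<le> \<delta> powr (1 / \<beta>)" using assms by (intro powr_mono') auto
  also have "\<dots> \<le> 3 / 8 * l * \<delta> powr (1 / \<beta>)" using assms mult_right_mono[of 1 "3 / 8 * l" "\<delta> powr (1 / \<beta>)"] by simp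
  also have "\<dots> \<le> 3 / 8 * (l * max (\<delta> powr (1 / \<beta>)) q)" using assms by (simp add: mult_left_mono)
  also have "\<dots> \<le> 3 / 8 * \<eta>" using assms by simp
  finally show ?thesis .
qed

text \<open>Up to \<open>cmax / cmin\<close>,
  \<open>\<delta> * real p powr (\<kappa>1 + \<kappa>3)\<close> is the ratio of gradient to
  curvature, the radius beyond which the quadratic term wins. Exceeding it by the factor
  \<open>l\<close> yields a gain of order \<open>l * n * \<delta>^2\<close>. For
  \<open>p = 0\<close> this fails, because \<open>0 powr a = 0\<close> makes \<open>m\<close>
  vanish.\<close>

lemma gradient_curvature_scales:
  fixes cmin cmax \<delta> \<eta> l \<kappa>1 \<kappa>3 q :: real and n p :: nat
  assumes "0 < cmin" "cmin \<le> cmax" "0 < \<delta>" "0 \<le> \<kappa>1" "0 \<le> \<kappa>3"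
    and lead: "l * max q (\<delta> * real p powr (\<kappa>1 + \<kappa>3)) \<le> \<eta>"
    and l: "1 \<le> l" "32 * cmax \<le> 3 * cmin * l"
  defines "m \<equiv> cmin * real n * real p powr (- \<kappa>3)"
  shows "cmax * real n * \<delta> * real p powr \<kappa>1 \<le> 3 / 32 * m * \<eta>"
    and "m \<le> cmax * real n"
    and "p \<noteq> 0 \<Longrightarrow> cmin * l * (real n * \<delta>\<^sup>2) \<le> m * \<eta>\<^sup>2"
proof -
  define b where "b = \<delta> * real p powr (\<kappa>1 + \<kappa>3)"
  have b0: "0 \<le> b" using assms by (simp add: b_def)
  have "l * b \<le> l * max q b" using l by (intro mult_left_mono) auto
  then have b: "l * b \<le> \<eta>" using lead by (simp add: b_def)
  have pk: "real p powr \<kappa>1 = real p powr (- \<kappa>3) * real p powr (\<kappa>1 + \<kappa>3)"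
    by (simp add: powr_add[symmetric])
  have "cmax * real n * \<delta> * real p powr \<kappa>1 = cmax * (real n * real p powr (- \<kappa>3) * b)"
    by (simp add: pk b_def)
  also have "\<dots> \<le> 3 / 32 * cmin * l * (real n * real p powr (- \<kappa>3) * b)"
    using l b0 by (intro mult_right_mono) auto
  also have "\<dots> = 3 / 32 * m * (l * b)" by (simp add: m_def)
  also have "\<dots> \<le> 3 / 32 * m * \<eta>" using b assms by (intro mult_left_mono) (auto simp: m_def)
  finally show "cmax * real n * \<delta> * real p powr \<kappa>1 \<le> 3 / 32 * m * \<eta>" .
  have "real p powr (- \<kappa>3) \<le> 1"
    using assms by (cases "p = 0") (auto simp: powr_minus inverse_le_1_iff ge_one_powr_ge_zero)
  then show "m \<le> cmax * real n"
    unfolding m_def using assms mult_mono[of "cmin * real n" "cmax * real n" "real p powr (- \<kappa>3)" 1]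
    by (simp add: mult_right_mono)
  assume p: "p \<noteq> 0"
  have "1 \<le> real p powr (\<kappa>1 + (\<kappa>1 + \<kappa>3))" using p assms by (intro ge_one_powr_ge_zero) auto
  also have "\<dots> = real p powr (- \<kappa>3) * (real p powr (\<kappa>1 + \<kappa>3))\<^sup>2"
  proof -
    have "\<kappa>1 + (\<kappa>1 + \<kappa>3) = - \<kappa>3 + ((\<kappa>1 + \<kappa>3) + (\<kappa>1 + \<kappa>3))" by simp
    then show ?thesis unfolding power2_eq_square by (simp only: powr_add)
  qed
  finally have "l * (cmin * real n * \<delta>\<^sup>2) * 1 \<le> l\<^sup>2 * (cmin * real n * \<delta>\<^sup>2) * (real p powr (- \<kappa>3) * (real p powr (\<kappa>1 + \<kappa>3))\<^sup>2)"
    using assms l by (intro mult_mono) (auto simp: power2_eq_square)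
  also have "\<dots> = m * (l * b)\<^sup>2" by (simp add: m_def b_def power_mult_distrib)
  also have "\<dots> \<le> m * \<eta>\<^sup>2" using b b0 l assms by (intro mult_left_mono power_mono) (auto simp: m_def)
  finally show "cmin * l * (real n * \<delta>\<^sup>2) \<le> m * \<eta>\<^sup>2" by (simp add: mult_ac)
qed

lemma (in prob_space) prob_Diff_lower:
  assumes "A \<in> events" "B \<in> events" "a \<le> prob A" "prob B \<le> b"
  shows "a - b \<le> prob (A - B)"
proof -
  have "prob A \<le> prob ((A - B) \<union> B)" using assms by (intro finite_measure_mono) auto
  also have "\<dots> \<le> prob (A - B) + prob B" using assms by (intro measure_Un_le) auto
  finally show ?thesis using assms by linarith
qed

text \<open>The total mass is a quotient \<open>I / I\<close>, finite for every \<open>I\<close>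
  because \<open>0 / 0\<close> and \<open>\<infinity> / \<infinity>\<close> are 0.\<close>

lemma finite_measure_gibbs:
  assumes [measurable]: "prior \<in> borel_measurable borel" "f \<in> borel_measurable borel"
  shows "finite_measure (gibbs p prior f)"
proof (rule finite_measureI)
  have "emeasure (gibbs p prior f) (space (gibbs p prior f)) =
      (\<integral>\<^sup>+\<theta>. ennreal (exp (f \<theta>) * prior \<theta>) \<partial>lebRp p) / (\<integral>\<^sup>+\<theta>. ennreal (exp (f \<theta>) * prior \<theta>) \<partial>lebRp p)"
    unfolding gibbs_def by (subst emeasure_density) (auto simp: nn_integral_divide)
  then show "emeasure (gibbs p prior f) (space (gibbs p prior f)) \<noteq> \<infinity>"
    by (simp add: ennreal_divide_eq_top_iff)
qed

lemma bounded_initial_segment: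
  fixes f :: "nat \<Rightarrow> real"
  assumes "\<And>n. 0 \<le> f n"
  shows "\<exists>X\<ge>b. \<forall>n. n < N \<longrightarrow> f n \<le> X"
proof -
  have "f n \<le> (\<Sum>i<N. f i)" if "n < N" for n
    using assms that by (intro member_le_sum) auto
  then show ?thesis by (intro exI[of _ "max b (\<Sum>i<N. f i)"]) (auto simp: le_max_iff_disj)
qed

text \<open>The constants are those of Assumption (A): \<open>C3\<close> bounds the evidence from below, and the
  contraction rate is required at the level \<open>c = 2 * C3 + 8\<close>. The variable \<open>l\<close> stands for \<open>ln n\<close>.\<close>

lemma W2sq_surrogate_posterior:
  fixes prior :: "l2 \<Rightarrow> real" and \<beta> \<delta> \<eta> l :: real and n p :: nat
  assumes v: "cutoff_fun v" and phi: "mollifier \<phi>"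
    and prior: "prior \<in> borel_measurable borel" "\<And>\<theta>. 0 \<le> prior \<theta>" "(\<integral>\<^sup>+\<theta>. ennreal (prior \<theta>) \<partial>lebRp p) = 1"
    and ll: "ll \<in> borel_measurable borel"
    and \<theta>s: "\<theta>s \<in> Rp p" "norm \<theta>s \<le> c0"
    and M: "0 \<le> M" "(\<integral>\<^sup>+\<theta>. ennreal (norm \<theta> ^ 4) \<partial>density (lebRp p) (\<lambda>\<theta>. ennreal (prior \<theta>))) \<le> ennreal M"
    and par: "0 < cmin" "cmin \<le> cmax" "0 \<le> \<kappa>1" "0 \<le> \<kappa>2" "0 \<le> \<kappa>3" "1 \<le> \<beta>" "0 < \<delta>" "\<delta> \<le> 1" "0 < \<eta>" "\<eta> \<le> 1" "0 \<le> C3" "0 < c0"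
    and C2: "C2_grad_hess p (ballRp p \<theta>s \<eta>) ll G H"
    and grad: "norm (G \<theta>s) \<le> cmax * real n * \<delta> * real p powr \<kappa>1"
    and lam: "\<And>\<theta>. \<theta> \<in> ballRp p \<theta>s \<eta> \<Longrightarrow> cmin * real n * real p powr (- \<kappa>3) \<le> lam_min_Rp p (\<lambda>h. - H \<theta> h)"
    and \<theta>i: "\<theta>init \<in> Rp p" "norm (\<theta>init - \<theta>s) \<le> \<eta> / 8"
    and K: "60 * cmax * C2norm v * real n * (1 + real p powr \<kappa>2) \<le> K"
    and lead: "l * delta_tilde \<beta> \<delta> p \<kappa>1 \<kappa>3 \<le> \<eta>"
    and l: "8 \<le> 3 * l" "8 * L < 3 * l" "32 * cmax \<le> 3 * cmin * l" "256 * (C3 + 4) \<le> 9 * cmin * l"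
    and star: "ll \<theta>s - L0 \<le> real n * \<delta>\<^sup>2"
    and total: "(\<integral>\<^sup>+\<theta>. ennreal ((1 + norm \<theta> ^ 4) * exp (ll \<theta> - L0)) \<partial>density (lebRp p) (\<lambda>\<theta>. ennreal (prior \<theta>)))
        \<le> ennreal (exp (real n * \<delta>\<^sup>2))"
    and small: "ennreal (exp (- C3 * real n * \<delta>\<^sup>2)) \<le> (\<integral>\<^sup>+\<theta>. ennreal (exp (ll \<theta> - L0) * prior \<theta>)
        * indicator {\<theta>. norm (\<theta> - \<theta>s) \<le> \<delta>} \<theta> \<partial>lebRp p)"
    and tail: "measure (gibbs p prior ll) {\<theta>. L * \<delta> < norm (\<theta> - \<theta>s) powr \<beta>} \<le> exp (- (2 * C3 + 8) * real n * \<delta>\<^sup>2)"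
  shows "W2sq (gibbs p prior (ltilde v \<phi> \<eta> K \<theta>init ll)) (gibbs p prior ll)
           \<le> ennreal ((4 * (1 + c0)\<^sup>2 + 2) * (M + 4) * exp (- 3 * (real n * \<delta>\<^sup>2)))"
proof -
  note [measurable] = prior(1) ll
  define P where "P = density (lebRp p) (\<lambda>\<theta>. ennreal (prior \<theta>))"
  have P: "prob_space P"
    by (rule prob_spaceI) (simp add: P_def emeasure_density prior(3))
  define x where "x = real n * \<delta>\<^sup>2"
  have x: "0 \<le> x" by (simp add: x_def)
  note lead = lead[unfolded delta_tilde_def]
  define m where "m = cmin * real n * real p powr (- \<kappa>3)"
  define g where "g = cmax * real n * \<delta> * real p powr \<kappa>1"
  have l1: "1 \<le> l" using l by simp
  have scales: "g \<le> 3 / 32 * m * \<eta>" "m \<le> cmax * real n" "p \<noteq> 0 \<Longrightarrow> cmin * l * x \<le> m * \<eta>\<^sup>2"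
    using gradient_curvature_scales[OF par(1,2,7,3,5) lead l1 l(3), of n] by (simp_all add: g_def m_def x_def)
  have far: "3 / 8 * \<eta> \<le> norm (\<theta> - \<theta>s)" if "\<eta> / 2 < norm (\<theta> - \<theta>init)" for \<theta>
    using that \<theta>i norm_triangle_ineq[of "\<theta> - \<theta>s" "\<theta>s - \<theta>init"] by (auto simp: norm_minus_commute)
  have sub: "{\<theta>. \<eta> / 2 < norm (\<theta> - \<theta>init)} \<subseteq> {\<theta>. L * \<delta> < norm (\<theta> - \<theta>s) powr \<beta>}"
    using powr_tail_lower_bound[OF par(6,7) lead _ _ far] l by auto
  have ball: "norm (\<theta> - \<theta>init) \<le> \<eta> / 2" if "norm (\<theta> - \<theta>s) \<le> \<delta>" for \<theta>
    using that powr_ball_upper_bound[OF par(6,7,8) lead] l \<theta>i norm_triangle_ineq[of "\<theta> - \<theta>s" "\<theta>s - \<theta>init"]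
    by (auto simp: norm_minus_commute)
  have quad: "ll \<theta> \<le> ll \<theta>s + g * norm (\<theta> - \<theta>s) - m / 2 * (norm (\<theta> - \<theta>s))\<^sup>2" if \<theta>: "\<theta> \<in> ballRp p \<theta>s \<eta>" for \<theta>
  proof -
    have "inner (G \<theta>s) (\<theta> - \<theta>s) \<le> norm (G \<theta>s) * norm (\<theta> - \<theta>s)" by (rule norm_cauchy_schwarz)
    also have "\<dots> \<le> g * norm (\<theta> - \<theta>s)" using grad by (intro mult_right_mono) (auto simp: g_def)
    finally show ?thesis
      using quadratic_upper_bound[OF C2 lam[folded m_def] \<theta>s(1) \<theta>] by linarith
  qed
  \<comment> \<open>The remaining factors in the bound for \<open>K\<close> are at least 1.\<close>
  have K': "60 * (cmax * real n) \<le> K"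
  proof -
    have "60 * cmax * 1 * real n * 1 \<le> 60 * cmax * C2norm v * real n * (1 + real p powr \<kappa>2)"
      using par one_le_C2norm[OF v] by (intro mult_mono) auto
    then show ?thesis using K by simp
  qed
  have tail': "ltilde v \<phi> \<eta> K \<theta>init ll \<theta> - L0 \<le> - (C3 + 3) * x"
    if \<theta>: "\<theta> \<in> Rp p" "\<eta> / 2 < norm (\<theta> - \<theta>init)" for \<theta>
  proof -
    \<comment> \<open>R^0 is a single point, so nothing lies outside the ball.\<close>
    have "p \<noteq> 0"
    proof
      assume "p = 0"
      then have "\<theta> = \<theta>init" using \<theta> \<theta>i by (intro l2_eqI) (simp add: Rp_def)
      then show False using \<theta> par by simp
    qed
    have "ltilde v \<phi> \<eta> K \<theta>init ll \<theta> \<le> ll \<theta>s - 9 / 256 * m * \<eta>\<^sup>2"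
      by (rule ltilde_tail_bound[OF v phi par(9) \<theta>i quad _ _ scales(1,2) K' \<theta>]) (use par in \<open>auto simp: g_def m_def\<close>)
    \<comment> \<open>One unit of \<open>C3 + 4\<close> pays, by \<open>star\<close>, for passing
      from the reference \<open>ll \<theta>s\<close> to \<open>L0\<close>.\<close>
    moreover have "(C3 + 4) * x \<le> 9 / 256 * cmin * l * x" using l x by (intro mult_right_mono) auto
    ultimately show ?thesis using scales(3)[OF \<open>p \<noteq> 0\<close>] star by (simp add: x_def algebra_simps)
  qed
  have "W2sq (gibbs p prior (ltilde v \<phi> \<eta> K \<theta>init ll)) (gibbs p prior ll)
      \<le> ennreal ((4 * (1 + c0)\<^sup>2 + 2) * (M + 4) * exp (- 3 * x))"
  proof (rule W2sq_gibbs_ltilde_le[OF ll prior(1,2) P[unfolded P_def] v phi par(9) _ _ M x par(11) _ _ _ tail'])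
    show "norm \<theta> \<le> 1 + c0" if "norm (\<theta> - \<theta>init) \<le> \<eta> / 2" for \<theta>
      using that \<theta>s \<theta>i par norm_triangle_ineq[of "\<theta> - \<theta>init" "\<theta>init - \<theta>s"] norm_triangle_ineq[of "\<theta> - \<theta>s" \<theta>s]
      by simp
    show "(\<integral>\<^sup>+\<theta>. ennreal ((1 + norm \<theta> ^ 4) * exp (ll \<theta> - L0)) \<partial>density (lebRp p) (\<lambda>\<theta>. ennreal (prior \<theta>)))
        \<le> ennreal (exp x)"
      using total by (simp add: x_def)
    have "ennreal (exp (- C3 * x)) \<le> (\<integral>\<^sup>+\<theta>. ennreal (exp (ll \<theta> - L0) * prior \<theta>)
        * indicator {\<theta>. norm (\<theta> - \<theta>s) \<le> \<delta>} \<theta> \<partial>lebRp p)"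
      using small by (simp add: x_def mult.assoc)
    also have "\<dots> \<le> (\<integral>\<^sup>+\<theta>. ennreal (prior \<theta>) * (ennreal (exp (ll \<theta> - L0))
        * indicator {\<theta>. norm (\<theta> - \<theta>init) \<le> \<eta> / 2} \<theta>) \<partial>lebRp p)"
      using ball prior(2) by (intro nn_integral_mono) (auto simp: ennreal_mult mult_ac split: split_indicator)
    also have "\<dots> = (\<integral>\<^sup>+\<theta>. ennreal (exp (ll \<theta> - L0)) * indicator {\<theta>. norm (\<theta> - \<theta>init) \<le> \<eta> / 2} \<theta>
        \<partial>density (lebRp p) (\<lambda>\<theta>. ennreal (prior \<theta>)))"
      by (rule nn_integral_density[symmetric]) measurable
    finally show "ennreal (exp (- C3 * x)) \<le> \<dots>" .
    have "measure (gibbs p prior ll) {\<theta>. \<eta> / 2 < norm (\<theta> - \<theta>init)}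
        \<le> measure (gibbs p prior ll) {\<theta>. L * \<delta> < norm (\<theta> - \<theta>s) powr \<beta>}"
    proof -
      interpret finite_measure "gibbs p prior ll" by (rule finite_measure_gibbs) measurable
      show ?thesis using sub by (intro finite_measure_mono) (auto simp: gibbs_def)
    qed
    also note tail
    finally show "measure (gibbs p prior ll) {\<theta>. \<eta> / 2 < norm (\<theta> - \<theta>init)} \<le> exp (- (2 * C3 + 8) * x)"
      by (simp add: x_def mult.assoc)
  qed (use par in auto)
  then show ?thesis by (simp add: x_def)
qed

subsection \<open>Combining the exceptional events\<close>

theorem theorem3p4:
  fixes \<nu> :: "'z measure" and dens :: "l2 \<Rightarrow> 'z \<Rightarrow> real" and \<Theta> :: "l2 set" and \<theta>0 :: l2
    and p :: "nat \<Rightarrow> nat" and \<delta> :: "nat \<Rightarrow> real" and prior :: "nat \<Rightarrow> l2 \<Rightarrow> real"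
    and \<theta>s :: "nat \<Rightarrow> l2" and c0 \<beta> :: real and m\<pi> \<Lambda>\<pi> :: "nat \<Rightarrow> real"
    and \<eta> :: "nat \<Rightarrow> real" and E :: "nat \<Rightarrow> (nat \<Rightarrow> 'z) set"
    and cE cE' cmax cmin \<kappa>1 \<kappa>2 \<kappa>3 :: real
    and v \<phi> :: "real \<Rightarrow> real" and K :: "nat \<Rightarrow> real" and \<theta>init :: "nat \<Rightarrow> l2" and C :: real
  assumes
    \<comment> \<open>the statistical model\<close>
    Theta: "\<forall>q. Rp q \<subseteq> \<Theta>" "\<theta>0 \<in> \<Theta>"
    and model: "\<forall>\<theta>\<in>\<Theta>. dens \<theta> \<in> borel_measurable \<nu> \<and> (\<forall>z\<in>space \<nu>. 0 < dens \<theta> z) \<and>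
                   prob_space (density \<nu> (\<lambda>z. ennreal (dens \<theta> z)))"
    and model_meas: "(\<lambda>(\<theta>, z). dens \<theta> z) \<in> borel_measurable (borel \<Otimes>\<^sub>M \<nu>)"
    \<comment> \<open>the priors Pi_n on R^{p_n}\<close>
    and prior: "\<forall>\<^sub>F n in sequentially. prior n \<in> borel_measurable borel \<and> (\<forall>\<theta>. 0 \<le> prior n \<theta>) \<and>
                   (\<integral>\<^sup>+\<theta>. ennreal (prior n \<theta>) \<partial>lebRp (p n)) = 1"
    \<comment> \<open>Assumption (A)\<close>
    and delta: "\<forall>n. 0 < \<delta> n" "\<delta> \<longlonglongrightarrow> 0"
    and A_c0: "0 < c0" "\<forall>\<^sub>F n in sequentially. \<theta>s n \<in> Rp (p n) \<and> norm (\<theta>s n) \<le> c0"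
    and A_beta: "1 \<le> \<beta>"
    and A: "\<forall>c>0. \<exists>L0. \<forall>L\<ge>L0. \<exists>C1 C2 C3 C4. 0 < C1 \<and> 0 < C2 \<and> 0 < C3 \<and> 0 < C4 \<and>
             (\<forall>\<^sub>F n in sequentially.
               outer_prob_le (data_law \<nu> dens \<theta>0 n)
                 {Z. exp (- c * real n * (\<delta> n)\<^sup>2) \<le> measure (gibbs (p n) (prior n) (loglik dens n Z))
                        {\<theta>. L * \<delta> n < norm (\<theta> - \<theta>s n) powr \<beta>}}
                 (C2 * exp (- C1 * real n * (\<delta> n)\<^sup>2)) \<and>
               outer_prob_le (data_law \<nu> dens \<theta>0 n)
                 {Z. (\<integral>\<^sup>+\<theta>. ennreal (exp (loglik dens n Z \<theta> - loglik dens n Z \<theta>0) * prior n \<theta>)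
                          * indicator {\<theta>. norm (\<theta> - \<theta>s n) \<le> \<delta> n} \<theta> \<partial>lebRp (p n))
                       \<le> ennreal (exp (- C3 * real n * (\<delta> n)\<^sup>2))}
                 (exp (- C4 * real n * (\<delta> n)\<^sup>2)))"
    \<comment> \<open>Assumption (B)\<close>
    and B: "\<forall>\<^sub>F n in sequentially. 0 < m\<pi> n \<and> 0 \<le> \<Lambda>\<pi> n \<and> (\<forall>\<theta>\<in>Rp (p n). 0 < prior n \<theta>) \<and>
              strongly_concave_Rp (p n) (m\<pi> n) (\<lambda>\<theta>. ln (prior n \<theta>)) \<and>
              lipschitz_grad_Rp (p n) (\<Lambda>\<pi> n) (\<lambda>\<theta>. ln (prior n \<theta>)) \<and>
              (\<exists>\<theta>max\<in>Rp (p n). (\<forall>\<theta>\<in>Rp (p n). ln (prior n \<theta>) \<le> ln (prior n \<theta>max)) \<and> norm \<theta>max \<le> c0)"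
    and B_moments: "\<exists>M. \<forall>\<^sub>F n in sequentially.
              (\<integral>\<^sup>+\<theta>. ennreal (norm \<theta> ^ 4) \<partial>density (lebRp (p n)) (\<lambda>\<theta>. ennreal (prior n \<theta>))) \<le> ennreal M"
    \<comment> \<open>Assumption (C)\<close>
    and C_consts: "0 < cE" "0 < cE'" "0 < cmin" "cmin \<le> cmax" "0 \<le> \<kappa>1" "0 \<le> \<kappa>2" "0 \<le> \<kappa>3"
    and C: "\<forall>\<^sub>F n in sequentially. 0 < \<eta> n \<and> \<eta> n \<le> 1 \<and>
              E n \<in> sets (data_law \<nu> dens \<theta>0 n) \<and>
              1 - cE' * exp (- cE * real n * (\<delta> n)\<^sup>2) \<le> measure (data_law \<nu> dens \<theta>0 n) (E n) \<and>
              (AE Z in data_law \<nu> dens \<theta>0 n. C2_on (p n) (ballRp (p n) (\<theta>s n) (\<eta> n)) (loglik dens n Z)) \<and>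
              (\<forall>Z\<in>E n. \<exists>G H. C2_grad_hess (p n) (ballRp (p n) (\<theta>s n) (\<eta> n)) (loglik dens n Z) G H \<and>
                 norm (G (\<theta>s n)) \<le> cmax * real n * \<delta> n * real (p n) powr \<kappa>1 \<and>
                 (\<forall>\<theta>\<in>ballRp (p n) (\<theta>s n) (\<eta> n). opnorm_Rp (p n) (H \<theta>) \<le> cmax * real n * real (p n) powr \<kappa>2) \<and>
                 (\<forall>\<theta>\<in>ballRp (p n) (\<theta>s n) (\<eta> n).
                    cmin * real n * real (p n) powr (- \<kappa>3) \<le> lam_min_Rp (p n) (\<lambda>h. - H \<theta> h)))"
    \<comment> \<open>the surrogate construction and Assumption (D)\<close>
    and v: "cutoff_fun v" and phi: "mollifier \<phi>"
    and D_C: "0 < C"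
    and D: "\<forall>\<^sub>F n in sequentially. \<theta>init n \<in> Rp (p n) \<and> norm (\<theta>init n - \<theta>s n) \<le> \<eta> n / 8 \<and>
              real (p n) \<le> C * real n * (\<delta> n)\<^sup>2 \<and>
              ln (real n) * delta_tilde \<beta> (\<delta> n) (p n) \<kappa>1 \<kappa>3 \<le> \<eta> n \<and>
              0 < K n \<and> 60 * cmax * C2norm v * real n * (1 + real (p n) powr \<kappa>2) \<le> K n"
  shows "\<exists>c c'. 0 < c \<and> 0 < c' \<and>
           (\<forall>n. \<exists>Et\<in>sets (data_law \<nu> dens \<theta>0 n).
              1 - c' * exp (- c * real n * (\<delta> n)\<^sup>2) \<le> measure (data_law \<nu> dens \<theta>0 n) Et \<and>
              (\<forall>Z\<in>Et. W2sq (gibbs (p n) (prior n) (ltilde v \<phi> (\<eta> n) (K n) (\<theta>init n) (loglik dens n Z)))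
                             (gibbs (p n) (prior n) (loglik dens n Z))
                        \<le> ennreal (exp (- real n * (\<delta> n)\<^sup>2))))"
proof -
  interpret dominated_model \<nu> dens \<Theta> \<theta>0
    using Theta model model_meas by unfold_locales auto
  let ?D = "data_law \<nu> dens \<theta>0"
  define x where "x n = real n * (\<delta> n)\<^sup>2" for n
  have x0: "0 \<le> x n" for n by (simp add: x_def)
  obtain M0 where M0: "\<forall>\<^sub>F n in sequentially.
      (\<integral>\<^sup>+\<theta>. ennreal (norm \<theta> ^ 4) \<partial>density (lebRp (p n)) (\<lambda>\<theta>. ennreal (prior n \<theta>))) \<le> ennreal M0"
    using B_moments by blast
  define M where "M = max M0 0"
  have M_nonneg: "0 \<le> M" by (simp add: M_def)
  have moment: "\<forall>\<^sub>F n in sequentially.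
      (\<integral>\<^sup>+\<theta>. ennreal (norm \<theta> ^ 4) \<partial>density (lebRp (p n)) (\<lambda>\<theta>. ennreal (prior n \<theta>))) \<le> ennreal M"
    using M0 by eventually_elim (auto simp: M_def intro: order_trans ennreal_leI)
  \<comment> \<open>The constants in \<open>A\<close> depend on \<open>c\<close>, yet the
    contraction level must depend on \<open>C3\<close>. Hence \<open>A\<close> is used twice:
    \<open>C3\<close> is fixed from \<open>c = 1\<close>, and the second use supplies only the
    contraction.\<close>
  obtain C3 C4 where C34: "0 < C3" "0 < C4" and small: "\<forall>\<^sub>F n in sequentially.
      outer_prob_le (?D n)
        {Z. (\<integral>\<^sup>+\<theta>. ennreal (exp (loglik dens n Z \<theta> - loglik dens n Z \<theta>0) * prior n \<theta>)
                 * indicator {\<theta>. norm (\<theta> - \<theta>s n) \<le> \<delta> n} \<theta> \<partial>lebRp (p n))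
              \<le> ennreal (exp (- C3 * real n * (\<delta> n)\<^sup>2))}
        (exp (- C4 * real n * (\<delta> n)\<^sup>2))"
    using A[rule_format, OF zero_less_one] unfolding eventually_conj_iff by (meson order_refl)
  obtain L C1 C2 where C12: "0 < C1" "0 < C2" and tail: "\<forall>\<^sub>F n in sequentially.
      outer_prob_le (?D n)
        {Z. exp (- (2 * C3 + 8) * real n * (\<delta> n)\<^sup>2) \<le> measure (gibbs (p n) (prior n) (loglik dens n Z))
               {\<theta>. L * \<delta> n < norm (\<theta> - \<theta>s n) powr \<beta>}}
        (C2 * exp (- C1 * real n * (\<delta> n)\<^sup>2))"
  proof -
    have "0 < 2 * C3 + 8" using C34 by simp
    from A[rule_format, OF this] show ?thesis
      using that unfolding eventually_conj_iff by (meson order_refl)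
  qed
  have ln_large: "\<forall>\<^sub>F n in sequentially. Y \<le> ln (real n)" for Y
    using filterlim_compose[OF ln_at_top filterlim_real_sequentially] by (simp add: filterlim_at_top)
  have \<delta>_le: "\<forall>\<^sub>F n in sequentially. \<delta> n < 1"
    using order_tendstoD(2)[OF delta(2), of 1] by simp
  \<comment> \<open>The entry 1 accounts for the two likelihood-ratio events, whose probabilities
    are of order \<open>exp (- x n)\<close>.\<close>
  define c where "c = min (min cE C1) (min C4 1)"
  have c: "0 < c" "c \<le> cE" "c \<le> C1" "c \<le> C4" "c \<le> 1" using C_consts C12 C34 by (auto simp: c_def)
  \<comment> \<open>One summand per exceptional event: the complement of \<open>E n\<close>,
    contraction, evidence, the weighted likelihood integral, the likelihood ratio at
    \<open>\<theta>s n\<close>.\<close>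
  define c1 where "c1 = cE' + C2 + 1 + (1 + M) + 1"
  define Kc where "Kc = (4 * (1 + c0)\<^sup>2 + 2) * (M + 4)"
  have "\<forall>\<^sub>F n in sequentially. \<exists>Et\<in>sets (?D n). 1 - c1 * exp (- c * x n) \<le> measure (?D n) Et \<and>
      (\<forall>Z\<in>Et. W2sq (gibbs (p n) (prior n) (ltilde v \<phi> (\<eta> n) (K n) (\<theta>init n) (loglik dens n Z)))
                    (gibbs (p n) (prior n) (loglik dens n Z)) \<le> ennreal (Kc * exp (- 3 * x n)))"
    using prior A_c0(2) C D moment tail small \<delta>_le
      \<comment> \<open>The summand 1 beside \<open>8 * L\<close> provides the strict inequality
        required there.\<close>
      ln_large[of "8 / 3"] ln_large[of "(8 * L + 1) / 3"] ln_large[of "32 * cmax / (3 * cmin)"]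
      ln_large[of "256 * (C3 + 4) / (9 * cmin)"]
  proof eventually_elim
    case (elim n)
    interpret D: prob_space "?D n" by (rule prob_space_data_law)
    define P where "P = density (lebRp (p n)) (\<lambda>\<theta>. ennreal (prior n \<theta>))"
    have [measurable]: "prior n \<in> borel_measurable borel" using elim by simp
    have P: "prob_space P" using elim by (intro prob_spaceI) (simp add: P_def emeasure_density)
    then interpret P: prob_space P .
    have Rp: "\<theta> \<in> Rp q \<Longrightarrow> \<theta> \<in> \<Theta>" for \<theta> q using Theta by auto
    have "(\<integral>\<^sup>+\<theta>. ennreal (1 + norm \<theta> ^ 4) \<partial>P) = (\<integral>\<^sup>+\<theta>. 1 + ennreal (norm \<theta> ^ 4) \<partial>P)"
      by (simp add: ennreal_plus)
    also have "\<dots> = 1 + (\<integral>\<^sup>+\<theta>. ennreal (norm \<theta> ^ 4) \<partial>P)"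
      by (subst nn_integral_add) (use P.emeasure_space_1 in \<open>auto simp: P_def\<close>)
    also have "\<dots> \<le> 1 + ennreal M" using elim by (intro add_left_mono) (simp add: P_def)
    also have "\<dots> = ennreal (1 + M)" using M_nonneg by (simp add: ennreal_plus)
    finally have mom: "(\<integral>\<^sup>+\<theta>. ennreal (1 + norm \<theta> ^ 4) \<partial>P) \<le> ennreal (1 + M)" .
    have supp: "AE \<theta> in P. \<theta> \<in> \<Theta>"
      using AE_prior_Rp[of "prior n" "p n"] unfolding P_def by (rule AE_mp) (use elim Rp in auto)
    have "outer_prob_le (?D n)
        {Z. ennreal (exp (x n)) < (\<integral>\<^sup>+\<theta>. ennreal ((1 + norm \<theta> ^ 4) * exp (loglik dens n Z \<theta> - loglik dens n Z \<theta>0)) \<partial>P)}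
        ((1 + M) * exp (- x n))"
      using M_nonneg by (intro outer_prob_likelihood_ratio P supp mom) (auto simp: P_def)
    from outer_prob_leD[OF this] obtain A3 where A3: "A3 \<in> sets (?D n)" "measure (?D n) A3 \<le> (1 + M) * exp (- x n)"
      "\<And>Z. Z \<in> space (?D n) \<Longrightarrow> Z \<notin> A3 \<Longrightarrow>
        (\<integral>\<^sup>+\<theta>. ennreal ((1 + norm \<theta> ^ 4) * exp (loglik dens n Z \<theta> - loglik dens n Z \<theta>0)) \<partial>P) \<le> ennreal (exp (x n))"
      unfolding not_less by blast
    have "Measurable.pred borel (\<lambda>\<theta>. \<theta> \<in> Rp (p n))"
      using borel_closed[OF closed_Rp] by (simp add: pred_def)
    then have "AE \<theta> in return borel (\<theta>s n). \<theta> \<in> Rp (p n)"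
      using elim by (simp add: AE_return)
    then have supp_s: "AE \<theta> in return borel (\<theta>s n). \<theta> \<in> \<Theta>"
      by (rule AE_mp) (use Rp in auto)
    \<comment> \<open>Integration against the point mass evaluates the likelihood ratio at
      \<open>\<theta>s n\<close>.\<close>
    have "outer_prob_le (?D n)
        {Z. ennreal (exp (x n)) < (\<integral>\<^sup>+\<theta>. ennreal (1 * exp (loglik dens n Z \<theta> - loglik dens n Z \<theta>0)) \<partial>return borel (\<theta>s n))}
        (1 * exp (- x n))"
      by (intro outer_prob_likelihood_ratio prob_space_return supp_s) (auto simp: nn_integral_return)
    then have "outer_prob_le (?D n)
        {Z. ennreal (exp (x n)) < (\<integral>\<^sup>+\<theta>. ennreal (exp (loglik dens n Z \<theta> - loglik dens n Z \<theta>0)) \<partial>return borel (\<theta>s n))}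
        (exp (- x n))" by (simp only: mult_1)
    from outer_prob_leD[OF this] obtain A4 where A4: "A4 \<in> sets (?D n)" "measure (?D n) A4 \<le> exp (- x n)"
      "\<And>Z. Z \<in> space (?D n) \<Longrightarrow> Z \<notin> A4 \<Longrightarrow>
        (\<integral>\<^sup>+\<theta>. ennreal (exp (loglik dens n Z \<theta> - loglik dens n Z \<theta>0)) \<partial>return borel (\<theta>s n)) \<le> ennreal (exp (x n))"
      unfolding not_less by blast
    have "outer_prob_le (?D n)
        {Z. exp (- (2 * C3 + 8) * real n * (\<delta> n)\<^sup>2) \<le> measure (gibbs (p n) (prior n) (loglik dens n Z))
               {\<theta>. L * \<delta> n < norm (\<theta> - \<theta>s n) powr \<beta>}}
        (C2 * exp (- C1 * real n * (\<delta> n)\<^sup>2))" using elim by simp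
    from outer_prob_leD[OF this] obtain A1 where A1: "A1 \<in> sets (?D n)"
      "measure (?D n) A1 \<le> C2 * exp (- C1 * real n * (\<delta> n)\<^sup>2)"
      "\<And>Z. Z \<in> space (?D n) \<Longrightarrow> Z \<notin> A1 \<Longrightarrow> measure (gibbs (p n) (prior n) (loglik dens n Z))
               {\<theta>. L * \<delta> n < norm (\<theta> - \<theta>s n) powr \<beta>} < exp (- (2 * C3 + 8) * real n * (\<delta> n)\<^sup>2)"
      unfolding not_le by blast
    have "outer_prob_le (?D n)
        {Z. (\<integral>\<^sup>+\<theta>. ennreal (exp (loglik dens n Z \<theta> - loglik dens n Z \<theta>0) * prior n \<theta>)
                 * indicator {\<theta>. norm (\<theta> - \<theta>s n) \<le> \<delta> n} \<theta> \<partial>lebRp (p n))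
              \<le> ennreal (exp (- C3 * real n * (\<delta> n)\<^sup>2))}
        (exp (- C4 * real n * (\<delta> n)\<^sup>2))" using elim by simp
    from outer_prob_leD[OF this] obtain A2 where A2: "A2 \<in> sets (?D n)"
      "measure (?D n) A2 \<le> exp (- C4 * real n * (\<delta> n)\<^sup>2)"
      "\<And>Z. Z \<in> space (?D n) \<Longrightarrow> Z \<notin> A2 \<Longrightarrow> ennreal (exp (- C3 * real n * (\<delta> n)\<^sup>2)) <
         (\<integral>\<^sup>+\<theta>. ennreal (exp (loglik dens n Z \<theta> - loglik dens n Z \<theta>0) * prior n \<theta>)
                 * indicator {\<theta>. norm (\<theta> - \<theta>s n) \<le> \<delta> n} \<theta> \<partial>lebRp (p n))"
      unfolding not_le by blast
    define Et where "Et = E n - A1 - A2 - A3 - A4"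
    have E: "E n \<in> sets (?D n)" "1 - cE' * exp (- cE * x n) \<le> measure (?D n) (E n)"
      using elim by (auto simp: x_def mult.assoc)
    have rate: "a * exp (- b * x n) \<le> a * exp (- c * x n)" if "0 \<le> a" "c \<le> b" for a b
      using that x0[of n] by (intro mult_left_mono) (auto intro: mult_right_mono)
    have Et_sets: "Et \<in> sets (?D n)" unfolding Et_def using E A1 A2 A3 A4 by auto
    have "1 - c1 * exp (- c * x n) \<le>
        1 - cE' * exp (- cE * x n) - C2 * exp (- C1 * x n) - exp (- C4 * x n) - (1 + M) * exp (- x n) - exp (- x n)"
    proof -
      have "cE' * exp (- cE * x n) \<le> cE' * exp (- c * x n)" "C2 * exp (- C1 * x n) \<le> C2 * exp (- c * x n)"
        "1 * exp (- C4 * x n) \<le> 1 * exp (- c * x n)" "(1 + M) * exp (- 1 * x n) \<le> (1 + M) * exp (- c * x n)"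
        "1 * exp (- 1 * x n) \<le> 1 * exp (- c * x n)"
        by (rule rate; use c C_consts C12 M_nonneg in simp)+
      moreover have "c1 * exp (- c * x n) = cE' * exp (- c * x n) + C2 * exp (- c * x n) + 1 * exp (- c * x n)
          + (1 + M) * exp (- c * x n) + 1 * exp (- c * x n)"
        by (simp add: c1_def algebra_simps)
      moreover have "- 1 * x n = - x n" by simp
      ultimately show ?thesis by (simp only:)
    qed
    also have "\<dots> \<le> measure (?D n) Et"
      unfolding Et_def using E A1 A2 A3 A4
      by (intro D.prob_Diff_lower) (auto simp: x_def mult.assoc)
    finally have prob: "1 - c1 * exp (- c * x n) \<le> measure (?D n) Et" .
    have "W2sq (gibbs (p n) (prior n) (ltilde v \<phi> (\<eta> n) (K n) (\<theta>init n) (loglik dens n Z)))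
                    (gibbs (p n) (prior n) (loglik dens n Z)) \<le> ennreal (Kc * exp (- 3 * x n))" if Z: "Z \<in> Et" for Z
    proof -
      have Zs: "Z \<in> space (?D n)" using Z Et_sets sets.sets_into_space by blast
      note [measurable] = loglik_measurable[OF Zs]
      have ZE: "Z \<in> E n" using Z by (simp add: Et_def)
      obtain G H where GH: "C2_grad_hess (p n) (ballRp (p n) (\<theta>s n) (\<eta> n)) (loglik dens n Z) G H"
        "norm (G (\<theta>s n)) \<le> cmax * real n * \<delta> n * real (p n) powr \<kappa>1"
        "\<And>\<theta>. \<theta>\<in>ballRp (p n) (\<theta>s n) (\<eta> n) \<Longrightarrow>
            cmin * real n * real (p n) powr (- \<kappa>3) \<le> lam_min_Rp (p n) (\<lambda>h. - H \<theta> h)"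
        using elim ZE by blast
      have star: "loglik dens n Z (\<theta>s n) - loglik dens n Z \<theta>0 \<le> real n * (\<delta> n)\<^sup>2"
        using A4(3)[OF Zs] Z by (simp add: Et_def nn_integral_return x_def)
      have cases: "8 \<le> 3 * ln (real n)" "8 * L < 3 * ln (real n)" "32 * cmax \<le> 3 * cmin * ln (real n)"
        "256 * (C3 + 4) \<le> 9 * cmin * ln (real n)"
        using elim C_consts by (auto simp: field_simps)
      show ?thesis
        unfolding Kc_def x_def
      proof (rule W2sq_surrogate_posterior[OF v phi _ _ _ _ _ _ M_nonneg _ C_consts(3-7) A_beta _ _ _ _ _ A_c0(1) GH _ _ _ _ cases star])
        show "ennreal (exp (- C3 * real n * (\<delta> n)\<^sup>2)) \<le> (\<integral>\<^sup>+\<theta>. ennreal (exp (loglik dens n Z \<theta> - loglik dens n Z \<theta>0) * prior n \<theta>)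
            * indicator {\<theta>. norm (\<theta> - \<theta>s n) \<le> \<delta> n} \<theta> \<partial>lebRp (p n))"
          using A2(3)[OF Zs] Z by (simp add: Et_def)
        show "measure (gibbs (p n) (prior n) (loglik dens n Z)) {\<theta>. L * \<delta> n < norm (\<theta> - \<theta>s n) powr \<beta>}
            \<le> exp (- (2 * C3 + 8) * real n * (\<delta> n)\<^sup>2)"
          using A1(3)[OF Zs] Z by (simp add: Et_def)
        show "(\<integral>\<^sup>+\<theta>. ennreal ((1 + norm \<theta> ^ 4) * exp (loglik dens n Z \<theta> - loglik dens n Z \<theta>0))
            \<partial>density (lebRp (p n)) (\<lambda>\<theta>. ennreal (prior n \<theta>))) \<le> ennreal (exp (real n * (\<delta> n)\<^sup>2))"
          using A3(3)[OF Zs] Z by (simp add: Et_def P_def x_def)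
      qed (use elim delta(1) C34 loglik_measurable[OF Zs] in \<open>auto simp: less_imp_le\<close>)
    qed
    with Et_sets prob show ?case by blast
  qed
  then obtain N where N: "\<And>n. N \<le> n \<Longrightarrow> \<exists>Et\<in>sets (?D n). 1 - c1 * exp (- c * x n) \<le> measure (?D n) Et \<and>
      (\<forall>Z\<in>Et. W2sq (gibbs (p n) (prior n) (ltilde v \<phi> (\<eta> n) (K n) (\<theta>init n) (loglik dens n Z)))
                    (gibbs (p n) (prior n) (loglik dens n Z)) \<le> ennreal (Kc * exp (- 3 * x n)))"
    unfolding eventually_sequentially by blast
  \<comment> \<open>Beyond this threshold the reserve \<open>exp (- 2 * x n)\<close> absorbs
    \<open>Kc\<close>.\<close>
  define b where "b = ln (max Kc 1)"
  obtain X where X: "b \<le> X" "\<And>n. n < N \<Longrightarrow> x n \<le> X"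
    using bounded_initial_segment[of x b N] x0 by blast
  \<comment> \<open>If \<open>x n \<le> X\<close>, the second entry makes the required probability
    nonpositive and the empty event will do. Otherwise \<open>n\<close> is at least \<open>N\<close>
    and \<open>Kc \<le> exp (2 * x n)\<close>.\<close>
  define c' where "c' = max c1 (exp (c * X))"
  have "\<exists>Et\<in>sets (?D n). 1 - c' * exp (- c * x n) \<le> measure (?D n) Et \<and>
      (\<forall>Z\<in>Et. W2sq (gibbs (p n) (prior n) (ltilde v \<phi> (\<eta> n) (K n) (\<theta>init n) (loglik dens n Z)))
                    (gibbs (p n) (prior n) (loglik dens n Z)) \<le> ennreal (exp (- x n)))" for n
  proof (cases "x n \<le> X")
    case True
    have "1 \<le> exp (c * X) * exp (- c * x n)"
      using True c by (simp add: exp_add[symmetric] mult_left_mono)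
    also have "\<dots> \<le> c' * exp (- c * x n)" by (intro mult_right_mono) (auto simp: c'_def)
    finally show ?thesis by (intro bexI[of _ "{}"]) auto
  next
    case False
    then have "N \<le> n" using X(2)[of n] by force
    from N[OF this] obtain Et where Et: "Et \<in> sets (?D n)" "1 - c1 * exp (- c * x n) \<le> measure (?D n) Et"
      "\<And>Z. Z \<in> Et \<Longrightarrow> W2sq (gibbs (p n) (prior n) (ltilde v \<phi> (\<eta> n) (K n) (\<theta>init n) (loglik dens n Z)))
                    (gibbs (p n) (prior n) (loglik dens n Z)) \<le> ennreal (Kc * exp (- 3 * x n))"
      by blast
    have "Kc \<le> exp b" by (simp add: b_def)
    also have "\<dots> \<le> exp (2 * x n)" using False X(1) x0[of n] by simp
    finally have "Kc * exp (- 3 * x n) \<le> exp (2 * x n) * exp (- 3 * x n)" by (intro mult_right_mono) auto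
    also have "\<dots> = exp (- x n)" by (simp add: exp_add[symmetric])
    finally have le: "ennreal (Kc * exp (- 3 * x n)) \<le> ennreal (exp (- x n))" by (rule ennreal_leI)
    have "c1 * exp (- c * x n) \<le> c' * exp (- c * x n)"
      by (intro mult_right_mono) (auto simp: c'_def)
    with Et(2) have "1 - c' * exp (- c * x n) \<le> measure (?D n) Et" by linarith
    then show ?thesis using Et(1) order_trans[OF Et(3) le] by blast
  qed
  moreover have "0 < c'" by (simp add: c'_def less_max_iff_disj)
  ultimately show ?thesis
    using c(1) by (intro exI[of _ c] exI[of _ c']) (simp add: x_def mult.assoc)
qed

end
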